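(* Let $\gamma>1$, let $J(d,\gamma,k)$ be the Leray symbol function and let $\boldsymbol{L}_k$ ($k=0,1,2,\dots$) be the sub-Leray operators on $M_\gamma$. Then: (a) If $\gamma=2$ and $d\in(-1,1)\cup(1,3)$, the function $k\mapsto J(d,\gamma,k)$ is strictly decreasing on the non-negative integers. Thus $\|\boldsymbol{L}_k\|_{L^2(M_2,\mu_d)}>\|\boldsymbol{L}_{k+1}\|_{L^2(M_2,\mu_d)}$ for all integers $k\ge0$. (b) If $\gamma>2$ and $d\in(-1,1]\cup[\gamma-1,2\gamma-1)$, the function $k\mapsto J(d,\gamma,k)$ is strictly decreasing on the non-negative integers. Thus $\|\boldsymbol{L}_k\|_{L^2(M_\gamma,\mu_d)}>\|\boldsymbol{L}_{k+1}\|_{L^2(M_\gamma,\mu_d)}$ for all integers $k\ge0$. (c) If $\gamma<2$ and $d\in(-1,\gamma-1]\cup[1,2\gamma-1)$, the function $k\mapsto J(d,\gamma,k)$ is strictly decreasing on the non-negative integers. Thus $\|\boldsymbol{L}_k\|_{L^2(M_\gamma,\mu_d)}>\|\boldsymbol{L}_{k+1}\|_{L^2(M_\gamma,\mu_d)}$ for all integers $k\ge0$. (d) If $\gamma\ne2$, the preferred symbol function $k\mapsto C_\nu(\gamma,k)=J\left(\tfrac{\gamma+1}{3},\gamma,k\right)$ is strictly increasing on the non-negative integers. Thus $\|\boldsymbol{L}_k\|_{L^2(M_\gamma,\nu)}<\|\boldsymbol{L}_{k+1}\|_{L^2(M_\gamma,\nu)}$ for all integers $k\ge0$.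
   Context: For $d\in\mathbb{R}$, $\gamma>1$ and integers $k\ge0$ the Leray symbol function is $$J(d,\gamma,k)=\frac{\Gamma\left(\frac{2k+1+d}{\gamma}\right)\Gamma\left(2k+2-\frac{2k+1+d}{\gamma}\right)}{\Gamma(k+1)^2}\left(\frac{\gamma}{2}\right)^{2k+2}(\gamma-1)^{-\left(2k+2-\frac{2k+1+d}{\gamma}\right)}.$$ For $\gamma>1$ let $M_\gamma=\{(\zeta_1,\zeta_2)\in\mathbb{C}^2:\operatorname{Im}\zeta_2=|\zeta_1|^\gamma\}$, the boundary of $\Omega_\gamma=\{(z_1,z_2)\in\mathbb{C}^2:\operatorname{Im}z_2>|z_1|^\gamma\}$. Parametrize $M_\gamma$ by $(\zeta_1,\zeta_2)=(re^{i\theta},s+ir^\gamma)$ with $r\ge0$, $s\in\mathbb{R}$, $\theta\in[0,2\pi)$. For $d\in\mathbb{R}$ let $\mu_d$ be the measure $r^d\,dr\,d\theta\,ds$ on $M_\gamma$, and let $\nu=\mu_{(\gamma+1)/3}$ (the preferred measure). The Leray transform of a function $f$ on $M_\gamma$ is the holomorphic function on $\Omega_\gamma$ $$\boldsymbol{L}f(z)=\int_{\zeta\in M_\gamma}f(\zeta)\,\frac{1}{(2\pi i)^2}\frac{\partial\rho(\zeta)\wedge\bar\partial\partial\rho(\zeta)}{\langle\partial\rho(\zeta),\zeta-z\rangle^2},$$ where $\rho$ is a defining function (the formula does not depend on the choice; e.g. $\rho(\zeta)=|\zeta_1|^\gamma-\operatorname{Im}\zeta_2$) and $\langle\cdot,\cdot\rangle$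 is the bilinear pairing of $(1,0)$-forms and vectors. In the parametrization $(\zeta_1,\zeta_2)=(re^{i\theta},s+ir^\gamma)$ of $M_\gamma$, $$\boldsymbol{L}f(z)=\frac{\gamma^2}{16\pi^2}\int_{\mathbb{R}}\int_0^{2\pi}\int_0^\infty\frac{f(r,\theta,s)\,r^{\gamma-1}\,dr\,d\theta\,ds}{\left[\tfrac{\gamma}{2}\left(r^\gamma-r^{\gamma-1}e^{-i\theta}z_1\right)+\tfrac{i}{2}\left(s+ir^\gamma-z_2\right)\right]^2}.$$ As an operator on functions on $M_\gamma$, $\boldsymbol{L}f$ denotes the boundary function $z\mapsto\lim_{\varepsilon\to0^+}\boldsymbol{L}f(z_1,z_2+i\varepsilon)$, $z\in M_\gamma$, defined first for $f$ smooth with compact support in $\{r>0\}\subset M_\gamma$. Writing $f=\sum_{k\in\mathbb{Z}}f_k(r,s)e^{ik\theta}$, the rotational symmetry in $\zeta_1$ gives an orthogonal decomposition $\boldsymbol{L}=\bigoplus_{k=0}^\infty\boldsymbol{L}_k$, where the sub-Leray operator $\boldsymbol{L}_k$ sends $f$ to the $e^{ik\theta}$-component of $\boldsymbol{L}f$, equivalently $\boldsymbol{L}_kf=\boldsymbol{L}(f_ke^{ik\theta})$. Its norm $\|\boldsymbol{L}_k\|_{L^2(M_\gamma,\mu_d)}$ is the supremum of $\|\boldsymbol{L}_kf\|/\|f\|$ in $L^2(M_\gamma,\mu_d)$ over nonzero smooth $f$ with compact support in $\{r>0\}$; when finite, $\boldsymbol{L}_k$ is extended by density to a bounded operator on $L^2(M_\gamma,\mu_d)$.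 *)

theory Defs
  imports "HOL-Analysis.Analysis"
begin

section \<open>The Leray symbol function\<close>

definition leray_symbol :: "real \<Rightarrow> real \<Rightarrow> nat \<Rightarrow> real" where
  "leray_symbol d \<gamma> k =
     Gamma ((2 * real k + 1 + d) / \<gamma>) * Gamma (2 * real k + 2 - (2 * real k + 1 + d) / \<gamma>)
       / (Gamma (real k + 1))\<^sup>2
     * (\<gamma> / 2) ^ (2 * k + 2)
     * (\<gamma> - 1) powr (- (2 * real k + 2 - (2 * real k + 1 + d) / \<gamma>))"

abbreviation preferred_symbol :: "real \<Rightarrow> nat \<Rightarrow> real" where
  "preferred_symbol \<gamma> \<equiv> leray_symbol ((\<gamma> + 1) / 3) \<gamma>"


section \<open>The hypersurface and its measures\<close>

definition hypersurface :: "real \<Rightarrow> (complex \<times> complex) set" where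
  "hypersurface \<gamma> = {\<zeta>. Im (snd \<zeta>) = norm (fst \<zeta>) powr \<gamma>}"

text \<open>The slice \<open>r = 0\<close>, where the hypersurface need not be smooth and \<open>(r, \<theta>, s)\<close> are not
  coordinates, is left out. It is a null set for all the integrals below.\<close>

definition param_dom :: "(real \<times> real \<times> real) set" where
  "param_dom = {0<..} \<times> {0..<2 * pi} \<times> UNIV"

definition param :: "real \<Rightarrow> real \<times> real \<times> real \<Rightarrow> complex \<times> complex" where
  "param \<gamma> = (\<lambda>(r, \<theta>, s). (of_real r * cis \<theta>, Complex s (r powr \<gamma>)))"

text \<open>The measure \<open>r\<^sup>d dr d\<theta> ds\<close>, as a Borel measure on \<open>\<complex>\<^sup>2\<close> that is concentrated on the
  hypersurface.\<close>

definition hyp_measure :: "real \<Rightarrow> real \<Rightarrow> (complex \<times> complex) measure" where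
  "hyp_measure \<gamma> d =
     distr (density (restrict_space lborel param_dom) (\<lambda>(r, \<theta>, s). ennreal (r powr d)))
       borel (param \<gamma>)"

abbreviation preferred_measure :: "real \<Rightarrow> (complex \<times> complex) measure" where
  "preferred_measure \<gamma> \<equiv> hyp_measure \<gamma> ((\<gamma> + 1) / 3)"

lemma param_measurable [measurable]: "param \<gamma> \<in> borel_measurable borel"
proof -
  have "param \<gamma> = (\<lambda>p. (of_real (fst p) * cis (fst (snd p)),
      of_real (snd (snd p)) + \<i> * of_real (fst p powr \<gamma>)))"
    by (auto simp: param_def fun_eq_iff complex_eq_iff)
  also have "\<dots> \<in> borel_measurable borel"
    unfolding cis_conv_exp borel_prod[symmetric] by measurable
  finally show ?thesis .
qed

lemma nn_integral_hyp_measure: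
  assumes [measurable]: "g \<in> borel_measurable borel"
  shows "(\<integral>\<^sup>+\<zeta>. g \<zeta> \<partial>hyp_measure \<gamma> d) =
    (\<integral>\<^sup>+p. ennreal (fst p powr d) * g (param \<gamma> p) * indicator param_dom p \<partial>lborel)"
proof -
  have P [measurable]: "param_dom \<in> sets borel"
    unfolding param_dom_def by (auto simp: borel_prod[symmetric])
  have [measurable]: "(\<lambda>p :: real \<times> real \<times> real. ennreal (fst p powr d)) \<in> borel_measurable borel"
    unfolding borel_prod[symmetric] by measurable
  have m: "h \<in> borel_measurable (restrict_space lborel param_dom)"
    if "h \<in> borel_measurable borel" for h :: "real \<times> real \<times> real \<Rightarrow> 'b :: topological_space"
    using that by (intro measurable_restrict_space1) simp
  have "(\<integral>\<^sup>+\<zeta>. g \<zeta> \<partial>hyp_measure \<gamma> d) =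
      (\<integral>\<^sup>+p. g (param \<gamma> p) \<partial>density (restrict_space lborel param_dom) (\<lambda>p. ennreal (fst p powr d)))"
    unfolding hyp_measure_def case_prod_unfold
    by (rule nn_integral_distr) (simp_all add: m)
  also have "\<dots> = (\<integral>\<^sup>+p. ennreal (fst p powr d) * g (param \<gamma> p) \<partial>restrict_space lborel param_dom)"
    by (rule nn_integral_density; rule m; measurable)
  also have "\<dots> = (\<integral>\<^sup>+p. ennreal (fst p powr d) * g (param \<gamma> p) * indicator param_dom p \<partial>lborel)"
    by (rule nn_integral_restrict_space) (simp add: P)
  finally show ?thesis .
qed

definition L2_norm_on :: "'a measure \<Rightarrow> ('a \<Rightarrow> complex) \<Rightarrow> ennreal" where
  "L2_norm_on M f =
     (let I = \<integral>\<^sup>+x. ennreal ((norm (f x))\<^sup>2) \<partial>M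
      in if I = \<infinity> then \<infinity> else ennreal (sqrt (enn2real I)))"


section \<open>Test functions\<close>

text \<open>For open \<open>S\<close>, the predicate \<open>Ck_on n S g\<close> says that \<open>g\<close> is \<open>n\<close> times continuously
  differentiable on \<open>S\<close>.\<close>

primrec Ck_on ::
  "nat \<Rightarrow> 'a::real_normed_vector set \<Rightarrow> ('a \<Rightarrow> 'b::real_normed_vector) \<Rightarrow> bool" where
  "Ck_on 0 S g \<longleftrightarrow> continuous_on S g"
| "Ck_on (Suc n) S g \<longleftrightarrow>
     (\<forall>x\<in>S. g differentiable (at x)) \<and> (\<forall>v. Ck_on n S (\<lambda>x. frechet_derivative g (at x) v))"

definition smooth_fun_on ::
  "'a::real_normed_vector set \<Rightarrow> ('a \<Rightarrow> 'b::real_normed_vector) \<Rightarrow> bool" where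
  "smooth_fun_on S g \<longleftrightarrow> (\<forall>n. Ck_on n S g)"

text \<open>Smooth functions with compact support in the part \<open>\<zeta>\<^sub>1 \<noteq> 0\<close> of the hypersurface. There
  \<open>(\<zeta>\<^sub>1, Re \<zeta>\<^sub>2)\<close> is a global smooth chart. Only the values of \<open>f\<close> on the hypersurface matter.\<close>

definition test_fun :: "real \<Rightarrow> (complex \<times> complex \<Rightarrow> complex) \<Rightarrow> bool" where
  "test_fun \<gamma> f \<longleftrightarrow>
     smooth_fun_on ((- {0}) \<times> UNIV)
       (\<lambda>(w :: complex, s :: real). f (w, Complex s (norm w powr \<gamma>))) \<and>
     (\<exists>K. compact K \<and> K \<subseteq> hypersurface \<gamma> \<inter> {\<zeta>. fst \<zeta> \<noteq> 0} \<and>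
          (\<forall>\<zeta> \<in> hypersurface \<gamma> - K. f \<zeta> = 0))"


section \<open>The Leray transform\<close>

text \<open>Multiplication by \<open>\<i>\<close> on \<open>\<complex>\<^sup>2\<close>, and the forms \<open>\<partial>g\<close> and \<open>\<partial>bar g\<close> (the parts of \<open>dg\<close> that
  are complex linear and complex antilinear) at the point \<open>\<zeta>\<close> evaluated on the real tangent
  vector \<open>v\<close>.\<close>

definition mult_i :: "complex \<times> complex \<Rightarrow> complex \<times> complex" where
  "mult_i v = (\<i> * fst v, \<i> * snd v)"

definition del :: "(complex \<times> complex \<Rightarrow> complex) \<Rightarrow> complex \<times> complex \<Rightarrow> complex \<times> complex \<Rightarrow> complex"
  where "del g \<zeta> v =
    (frechet_derivative g (at \<zeta>) v - \<i> * frechet_derivative g (at \<zeta>) (mult_i v)) / 2"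

definition delbar :: "(complex \<times> complex \<Rightarrow> complex) \<Rightarrow> complex \<times> complex \<Rightarrow> complex \<times> complex \<Rightarrow> complex"
  where "delbar g \<zeta> v =
    (frechet_derivative g (at \<zeta>) v + \<i> * frechet_derivative g (at \<zeta>) (mult_i v)) / 2"

text \<open>If \<open>\<alpha> = \<Sum>\<^sub>k a\<^sub>k d\<zeta>\<^sub>k\<close> then \<open>\<partial>bar \<alpha> = \<Sum>\<^sub>k \<partial>bar a\<^sub>k \<and> d\<zeta>\<^sub>k\<close>; on constant vector fields \<open>v\<close>, \<open>w\<close>
  this is \<open>\<partial>bar (\<alpha>(w))(v) - \<partial>bar (\<alpha>(v))(w)\<close>. The definition is the case \<open>\<alpha> = \<partial>g\<close>.\<close>

definition delbar_del ::
  "(complex \<times> complex \<Rightarrow> complex) \<Rightarrow> complex \<times> complex \<Rightarrow>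
     complex \<times> complex \<Rightarrow> complex \<times> complex \<Rightarrow> complex" where
  "delbar_del g \<zeta> v w = delbar (\<lambda>\<eta>. del g \<eta> w) \<zeta> v - delbar (\<lambda>\<eta>. del g \<eta> v) \<zeta> w"

text \<open>Wedge product of a 1-form and a 2-form, normalized so that \<open>dx \<and> dy \<and> dz\<close> has the value 1
  on the standard basis.\<close>

definition wedge12 :: "('v \<Rightarrow> complex) \<Rightarrow> ('v \<Rightarrow> 'v \<Rightarrow> complex) \<Rightarrow> 'v \<Rightarrow> 'v \<Rightarrow> 'v \<Rightarrow> complex" where
  "wedge12 \<alpha> \<beta> u v w = \<alpha> u * \<beta> v w - \<alpha> v * \<beta> u w + \<alpha> w * \<beta> u v"

definition def_fun :: "real \<Rightarrow> complex \<times> complex \<Rightarrow> complex" where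
  "def_fun \<gamma> \<zeta> = of_real (norm (fst \<zeta>) powr \<gamma> - Im (snd \<zeta>))"

definition param_dr :: "real \<Rightarrow> real \<times> real \<times> real \<Rightarrow> complex \<times> complex" where
  "param_dr \<gamma> = (\<lambda>(r, \<theta>, s). vector_derivative (\<lambda>t. param \<gamma> (t, \<theta>, s)) (at r))"

definition param_d\<theta> :: "real \<Rightarrow> real \<times> real \<times> real \<Rightarrow> complex \<times> complex" where
  "param_d\<theta> \<gamma> = (\<lambda>(r, \<theta>, s). vector_derivative (\<lambda>t. param \<gamma> (r, t, s)) (at \<theta>))"

definition param_ds :: "real \<Rightarrow> real \<times> real \<times> real \<Rightarrow> complex \<times> complex" where
  "param_ds \<gamma> = (\<lambda>(r, \<theta>, s). vector_derivative (\<lambda>t. param \<gamma> (r, \<theta>, t)) (at s))"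

text \<open>The integral of the 3-form over the hypersurface is written as the integral of its pullback
  under \<open>param\<close>. The coordinates \<open>(r, \<theta>, s)\<close> are positively oriented for the hypersurface as the
  boundary of \<open>Im z\<^sub>2 > |z\<^sub>1|\<^sup>\<gamma>\<close>.\<close>

definition leray :: "real \<Rightarrow> (complex \<times> complex \<Rightarrow> complex) \<Rightarrow> complex \<times> complex \<Rightarrow> complex" where
  "leray \<gamma> f z =
     set_lebesgue_integral lborel param_dom
       (\<lambda>p. let \<zeta> = param \<gamma> p; \<rho> = def_fun \<gamma> in
          f \<zeta> * (1 / (2 * of_real pi * \<i>)\<^sup>2
            * wedge12 (del \<rho> \<zeta>) (delbar_del \<rho> \<zeta>) (param_dr \<gamma> p) (param_d\<theta> \<gamma> p) (param_ds \<gamma> p)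
            / (del \<rho> \<zeta> (\<zeta> - z))\<^sup>2))"

definition leray_bdry :: "real \<Rightarrow> (complex \<times> complex \<Rightarrow> complex) \<Rightarrow> complex \<times> complex \<Rightarrow> complex"
  where "leray_bdry \<gamma> f z =
    Lim (at_right 0) (\<lambda>\<epsilon>::real. leray \<gamma> f (fst z, snd z + \<i> * of_real \<epsilon>))"


section \<open>The sub-Leray operators\<close>

definition fourier_coeff ::
  "real \<Rightarrow> nat \<Rightarrow> (complex \<times> complex \<Rightarrow> complex) \<Rightarrow> real \<Rightarrow> real \<Rightarrow> complex" where
  "fourier_coeff \<gamma> k f r s =
     1 / (2 * of_real pi) * (LINT \<phi>:{0..2 * pi}|lborel. f (param \<gamma> (r, \<phi>, s)) * cis (- real k * \<phi>))"

text \<open>The component \<open>f\<^sub>k(r, s) e\<^sup>i\<^sup>k\<^sup>\<theta>\<close> as a function of \<open>\<zeta> = (r e\<^sup>i\<^sup>\<theta>, s + i r\<^sup>\<gamma>)\<close>.\<close>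

definition fourier_component ::
  "real \<Rightarrow> nat \<Rightarrow> (complex \<times> complex \<Rightarrow> complex) \<Rightarrow> complex \<times> complex \<Rightarrow> complex" where
  "fourier_component \<gamma> k f \<zeta> =
     fourier_coeff \<gamma> k f (norm (fst \<zeta>)) (Re (snd \<zeta>)) * cis (real k * Arg (fst \<zeta>))"

definition sub_leray ::
  "real \<Rightarrow> nat \<Rightarrow> (complex \<times> complex \<Rightarrow> complex) \<Rightarrow> complex \<times> complex \<Rightarrow> complex" where
  "sub_leray \<gamma> k f = leray_bdry \<gamma> (fourier_component \<gamma> k f)"

definition sub_leray_norm :: "real \<Rightarrow> nat \<Rightarrow> (complex \<times> complex) measure \<Rightarrow> ennreal" where
  "sub_leray_norm \<gamma> k \<mu> =
     (SUP f \<in> {f. test_fun \<gamma> f \<and> (\<exists>\<zeta> \<in> hypersurface \<gamma>. f \<zeta> \<noteq> 0)}.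
        L2_norm_on \<mu> (sub_leray \<gamma> k f) / L2_norm_on \<mu> f)"


section \<open>The Leray transform in the parametrization\<close>

lemma norm_powr_has_derivative:
  fixes w :: complex
  assumes "w \<noteq> 0"
  shows "((\<lambda>w. norm w powr a) has_derivative (\<lambda>v. a * norm w powr (a - 2) * (w \<bullet> v))) (at w)"
proof -
  have n: "norm w > 0" using assms by simp
  have 1: "(norm has_derivative (\<lambda>v. v \<bullet> sgn w)) (at w)"
    using assms by (rule has_derivative_norm)
  have 2: "((\<lambda>x. x powr a) has_derivative (\<lambda>x. a * norm w powr (a - 1) * x)) (at (norm w))"
    using has_real_derivative_powr[OF n, of a] by (simp add: has_field_derivative_def)
  have 3: "norm w powr (a - 1) = norm w powr (a - 2) * norm w"
    using n powr_add[of "norm w" "a - 2" 1] by simp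
  have "((\<lambda>w. norm w powr a) has_derivative (\<lambda>v. a * norm w powr (a - 1) * (v \<bullet> sgn w))) (at w)"
    using has_derivative_compose[OF 1 2] .
  moreover have "a * norm w powr (a - 1) * (v \<bullet> sgn w) = a * norm w powr (a - 2) * (w \<bullet> v)" for v
    unfolding 3 using n by (simp add: sgn_div_norm inner_commute)
  ultimately show ?thesis by simp
qed

lemma def_fun_has_derivative:
  assumes "fst \<zeta> \<noteq> 0"
  shows "(def_fun \<gamma> has_derivative
     (\<lambda>v. of_real (\<gamma> * norm (fst \<zeta>) powr (\<gamma> - 2) * (fst \<zeta> \<bullet> fst v) - Im (snd v)))) (at \<zeta>)"
proof -
  have f: "(fst has_derivative fst) (at \<zeta>)"
    by (rule bounded_linear_imp_has_derivative[OF bounded_linear_fst])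
  have "((\<lambda>\<zeta>. norm (fst \<zeta>) powr \<gamma>) has_derivative
     (\<lambda>v. \<gamma> * norm (fst \<zeta>) powr (\<gamma> - 2) * (fst \<zeta> \<bullet> fst v))) (at \<zeta>)"
    using has_derivative_compose[OF f norm_powr_has_derivative[OF assms, of \<gamma>]] .
  moreover have "((\<lambda>\<zeta>. Im (snd \<zeta>)) has_derivative (\<lambda>v. Im (snd v))) (at \<zeta>)"
    by (intro has_derivative_Im has_derivative_snd has_derivative_ident)
  ultimately show ?thesis
    unfolding def_fun_def by (intro has_derivative_of_real has_derivative_diff)
qed

lemma del_def_fun:
  assumes "fst \<zeta> \<noteq> 0"
  shows "del (def_fun \<gamma>) \<zeta> v =
    of_real (\<gamma> / 2 * norm (fst \<zeta>) powr (\<gamma> - 2)) * cnj (fst \<zeta>) * fst v + \<i> / 2 * snd v"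
  using frechet_derivative_at[OF def_fun_has_derivative[OF assms], of \<gamma>, symmetric]
  by (simp add: del_def mult_i_def complex_eq_iff inner_complex_def algebra_simps
      add_divide_distrib diff_divide_distrib)

lemma delbar_del_def_fun:
  assumes "fst \<zeta> \<noteq> 0"
  shows "delbar_del (def_fun \<gamma>) \<zeta> v w =
    of_real (\<gamma>\<^sup>2 / 4 * norm (fst \<zeta>) powr (\<gamma> - 2)) * (cnj (fst v) * fst w - cnj (fst w) * fst v)"
proof -
  have db: "delbar (\<lambda>\<eta>. del (def_fun \<gamma>) \<eta> w) \<zeta> v =
    of_real (\<gamma>\<^sup>2 / 4 * norm (fst \<zeta>) powr (\<gamma> - 2)) * cnj (fst v) * fst w" for v w
  proof -
    define D where "D = (\<lambda>v :: complex \<times> complex. of_real (\<gamma> / 2) * fst w *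
        (of_real (norm (fst \<zeta>) powr (\<gamma> - 2)) * cnj (fst v)
         + of_real ((\<gamma> - 2) * norm (fst \<zeta>) powr (\<gamma> - 4) * (fst \<zeta> \<bullet> fst v)) * cnj (fst \<zeta>)))"
    have f: "(fst has_derivative fst) (at \<zeta>)"
      by (rule bounded_linear_imp_has_derivative[OF bounded_linear_fst])
    have 1: "((\<lambda>\<zeta>. norm (fst \<zeta>) powr (\<gamma> - 2)) has_derivative
       (\<lambda>v. (\<gamma> - 2) * norm (fst \<zeta>) powr (\<gamma> - 4) * (fst \<zeta> \<bullet> fst v))) (at \<zeta>)"
      using has_derivative_compose[OF f norm_powr_has_derivative[OF assms, of "\<gamma> - 2"]] by simp
    have 2: "((\<lambda>\<zeta>. cnj (fst \<zeta>)) has_derivative (\<lambda>v. cnj (fst v))) (at \<zeta>)"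
      by (intro has_derivative_cnj has_derivative_fst has_derivative_ident)
    have "((\<lambda>\<eta>. of_real (\<gamma> / 2) * fst w *
        (of_real (norm (fst \<eta>) powr (\<gamma> - 2)) * cnj (fst \<eta>)) + \<i> / 2 * snd w) has_derivative D) (at \<zeta>)"
      unfolding D_def
      by (rule has_derivative_add_const, rule has_derivative_mult_right,
          rule has_derivative_mult[OF has_derivative_of_real[OF 1] 2])
    moreover have "open ((- {0::complex}) \<times> (UNIV :: complex set))"
      by (intro open_Times) auto
    moreover have "\<zeta> \<in> (- {0}) \<times> UNIV" using assms by (cases \<zeta>) auto
    ultimately have "((\<lambda>\<eta>. del (def_fun \<gamma>) \<eta> w) has_derivative D) (at \<zeta>)"
      by (rule has_derivative_transform_within_open) (subst del_def_fun, auto simp: algebra_simps)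
    then have fd: "frechet_derivative (\<lambda>\<eta>. del (def_fun \<gamma>) \<eta> w) (at \<zeta>) = D"
      by (rule frechet_derivative_at[symmetric])
    have n: "norm (fst \<zeta>) powr (\<gamma> - 2) = norm (fst \<zeta>) powr (\<gamma> - 4) * ((Re (fst \<zeta>))\<^sup>2 + (Im (fst \<zeta>))\<^sup>2)"
      using assms powr_add[of "norm (fst \<zeta>)" "\<gamma> - 4" 2] by (simp add: cmod_def)
    show ?thesis
      unfolding delbar_def fd D_def mult_i_def n
      by (simp add: complex_eq_iff inner_complex_def algebra_simps power2_eq_square
          add_divide_distrib diff_divide_distrib)
  qed
  show ?thesis unfolding delbar_del_def db by (simp add: algebra_simps)
qed

lemma param_tangents:
  assumes "r > 0"
  shows "param_dr \<gamma> (r, \<theta>, s) = (cis \<theta>, \<i> * of_real (\<gamma> * r powr (\<gamma> - 1)))"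
    and "param_d\<theta> \<gamma> (r, \<theta>, s) = (\<i> * of_real r * cis \<theta>, 0)"
    and "param_ds \<gamma> (r, \<theta>, s) = (0, 1)"
proof -
  have c: "Complex a b = of_real a + \<i> * of_real b" for a b
    by (simp add: complex_eq_iff)
  have "((\<lambda>t. param \<gamma> (t, \<theta>, s)) has_vector_derivative
      (cis \<theta>, \<i> * of_real (\<gamma> * r powr (\<gamma> - 1)))) (at r)"
    unfolding param_def prod.case c using assms
    by (auto intro!: has_vector_derivative_Pair derivative_eq_intros
        simp: has_real_derivative_iff_has_vector_derivative[symmetric])
  then show "param_dr \<gamma> (r, \<theta>, s) = (cis \<theta>, \<i> * of_real (\<gamma> * r powr (\<gamma> - 1)))"
    unfolding param_dr_def by (simp add: vector_derivative_at)
  have "((\<lambda>t. param \<gamma> (r, t, s)) has_vector_derivative (\<i> * of_real r * cis \<theta>, 0)) (at \<theta>)"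
  proof -
    have "((\<lambda>t. exp (\<i> * of_real t)) has_vector_derivative exp (\<i> * of_real \<theta>) * \<i>) (at \<theta>)"
      by (rule has_vector_derivative_real_field[where f = "\<lambda>z. exp (\<i> * z)"])
        (auto intro!: derivative_eq_intros)
    from has_vector_derivative_mult_right[OF this, of "of_real r"] show ?thesis
      unfolding param_def prod.case cis_conv_exp
      by (auto intro!: has_vector_derivative_Pair derivative_eq_intros simp: mult_ac)
  qed
  then show "param_d\<theta> \<gamma> (r, \<theta>, s) = (\<i> * of_real r * cis \<theta>, 0)"
    unfolding param_d\<theta>_def by (simp add: vector_derivative_at)
  have "((\<lambda>t. param \<gamma> (r, \<theta>, t)) has_vector_derivative (0, 1)) (at s)"
    unfolding param_def prod.case c
    by (auto intro!: has_vector_derivative_Pair derivative_eq_intros)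
  then show "param_ds \<gamma> (r, \<theta>, s) = (0, 1)"
    unfolding param_ds_def by (simp add: vector_derivative_at)
qed

lemma leray_in_coordinates:
  "leray \<gamma> f z = of_real (\<gamma>\<^sup>2 / (16 * pi\<^sup>2)) *
     set_lebesgue_integral lborel param_dom
       (\<lambda>(r, \<theta>, s). f (param \<gamma> (r, \<theta>, s)) * of_real (r powr (\<gamma> - 1)) /
          (of_real (\<gamma> / 2) * (of_real (r powr \<gamma>) - of_real (r powr (\<gamma> - 1)) * cis (- \<theta>) * fst z)
           + \<i> / 2 * (of_real s + \<i> * of_real (r powr \<gamma>) - snd z))\<^sup>2)"
proof -
  let ?F = "\<lambda>p. let \<zeta> = param \<gamma> p; \<rho> = def_fun \<gamma> in
    f \<zeta> * (1 / (2 * of_real pi * \<i>)\<^sup>2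
      * wedge12 (del \<rho> \<zeta>) (delbar_del \<rho> \<zeta>) (param_dr \<gamma> p) (param_d\<theta> \<gamma> p) (param_ds \<gamma> p)
      / (del \<rho> \<zeta> (\<zeta> - z))\<^sup>2)"
  let ?G = "\<lambda>(r, \<theta>, s). f (param \<gamma> (r, \<theta>, s)) * of_real (r powr (\<gamma> - 1)) /
    (of_real (\<gamma> / 2) * (of_real (r powr \<gamma>) - of_real (r powr (\<gamma> - 1)) * cis (- \<theta>) * fst z)
     + \<i> / 2 * (of_real s + \<i> * of_real (r powr \<gamma>) - snd z))\<^sup>2"
  have eq: "?F (r, \<theta>, s) = of_real (\<gamma>\<^sup>2 / (16 * pi\<^sup>2)) * ?G (r, \<theta>, s)" if r: "r > 0" for r \<theta> s
  proof -
    define \<zeta> where "\<zeta> = param \<gamma> (r, \<theta>, s)"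
    have f: "fst \<zeta> = of_real r * cis \<theta>" and g: "snd \<zeta> = of_real s + \<i> * of_real (r powr \<gamma>)"
      by (simp_all add: \<zeta>_def param_def complex_eq_iff)
    have nz: "fst \<zeta> \<noteq> 0" and n: "norm (fst \<zeta>) = r"
      using r by (auto simp: f norm_mult)
    have p1: "r powr (\<gamma> - 2) * r = r powr (\<gamma> - 1)"
      using r powr_add[of r "\<gamma> - 2" 1] by simp
    have p2: "r powr (\<gamma> - 1) * r = r powr \<gamma>"
      using r powr_add[of r "\<gamma> - 1" 1] by simp
    have c: "cnj (cis \<theta>) * cis \<theta> = 1" "cis \<theta> * cnj (cis \<theta>) = 1"
      by (simp_all add: cis_cnj cis_mult)
    have W: "wedge12 (del (def_fun \<gamma>) \<zeta>) (delbar_del (def_fun \<gamma>) \<zeta>)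
        (param_dr \<gamma> (r, \<theta>, s)) (param_d\<theta> \<gamma> (r, \<theta>, s)) (param_ds \<gamma> (r, \<theta>, s))
      = - of_real (\<gamma>\<^sup>2 / 4 * r powr (\<gamma> - 1))"
    proof -
      have "cnj (cis \<theta>) * (\<i> * of_real r * cis \<theta>) - cnj (\<i> * of_real r * cis \<theta>) * cis \<theta>
          = 2 * \<i> * of_real r * (cnj (cis \<theta>) * cis \<theta>)"
        by (simp add: algebra_simps)
      then have "wedge12 (del (def_fun \<gamma>) \<zeta>) (delbar_del (def_fun \<gamma>) \<zeta>)
          (param_dr \<gamma> (r, \<theta>, s)) (param_d\<theta> \<gamma> (r, \<theta>, s)) (param_ds \<gamma> (r, \<theta>, s))
        = \<i> / 2 * (of_real (\<gamma>\<^sup>2 / 4 * r powr (\<gamma> - 2)) * (2 * \<i> * of_real r))"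
        unfolding wedge12_def param_tangents[OF r] delbar_del_def_fun[OF nz] del_def_fun[OF nz] n c
        by simp
      also have "\<dots> = - of_real (\<gamma>\<^sup>2 / 4 * (r powr (\<gamma> - 2) * r))"
        by (simp add: algebra_simps)
      finally show ?thesis unfolding p1 .
    qed
    have D: "del (def_fun \<gamma>) \<zeta> (\<zeta> - z) =
        of_real (\<gamma> / 2) * (of_real (r powr \<gamma>) - of_real (r powr (\<gamma> - 1)) * cis (- \<theta>) * fst z)
        + \<i> / 2 * (of_real s + \<i> * of_real (r powr \<gamma>) - snd z)"
    proof -
      define h where "h = (of_real (\<gamma> / 2) :: complex)"
      have "of_real (\<gamma> / 2 * r powr (\<gamma> - 2)) * cnj (fst \<zeta>) * (fst \<zeta> - fst z)
        = of_real (\<gamma> / 2) * (of_real ((r powr (\<gamma> - 2) * r) * r) * (cnj (cis \<theta>) * cis \<theta>)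
            - of_real (r powr (\<gamma> - 2) * r) * cnj (cis \<theta>) * fst z)"
        unfolding f of_real_mult[of "\<gamma> / 2"] h_def[symmetric] by (simp add: algebra_simps)
      then show ?thesis
        unfolding del_def_fun[OF nz] n p1 p2 c by (simp add: g cis_cnj)
    qed
    have "(2 * of_real pi * \<i>)\<^sup>2 = (of_real (- 4 * pi\<^sup>2) :: complex)"
      by (simp add: power_mult_distrib)
    then show ?thesis
      unfolding Let_def \<zeta>_def[symmetric] W D prod.case by (simp add: field_simps)
  qed
  have "leray \<gamma> f z = set_lebesgue_integral lborel param_dom (\<lambda>p. of_real (\<gamma>\<^sup>2 / (16 * pi\<^sup>2)) * ?G p)"
    unfolding leray_def set_lebesgue_integral_def
  proof (rule Bochner_Integration.integral_cong[OF refl])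
    fix p :: "real \<times> real \<times> real"
    obtain r \<theta> s where p: "p = (r, \<theta>, s)" by (cases p)
    show "indicator param_dom p *\<^sub>R ?F p =
        indicator param_dom p *\<^sub>R (of_real (\<gamma>\<^sup>2 / (16 * pi\<^sup>2)) * ?G p)"
    proof (cases "p \<in> param_dom")
      case True
      then have "r > 0" by (simp add: p param_dom_def)
      from eq[OF this] show ?thesis by (simp only: p)
    qed simp
  qed
  then show ?thesis by simp
qed

end

theory Submission
  imports Defs "HOL-Probability.Probability" "HOL-Computational_Algebra.Polynomial"
begin

text \<open>The norm of \<open>L\<^sub>k\<close> on \<open>L\<^sup>2(r\<^sup>d dr d\<theta> ds)\<close> is the square root of the symbol \<open>J(d, \<gamma>, k)\<close>, for every
  \<open>d\<close> between \<open>-1\<close> and \<open>2\<gamma> - 1\<close> (lemma \<open>sub_leray_norm_eq\<close>). The theorem follows from this and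
  from the monotonicity of \<open>J\<close> in \<open>k\<close>.

  The norm. Expand the kernel in powers of \<open>e\<^sup>-\<^sup>i\<^sup>\<theta>\<close>. On a function \<open>F(r, s) e\<^sup>i\<^sup>k\<^sup>\<theta>\<close> one term survives,
  a multiple of \<open>\<rho>\<^sup>k r\<^sup>m (b + i(s - t))\<^sup>-\<^sup>(\<^sup>k\<^sup>+\<^sup>2\<^sup>)\<close> with \<open>m = (\<gamma> - 1)(k + 1)\<close> and
  \<open>b = (\<gamma> - 1) r\<^sup>\<gamma> + \<rho>\<^sup>\<gamma>\<close>. The power of \<open>b + i(s - t)\<close> is the Laplace transform of \<open>\<xi>\<^sup>k\<^sup>+\<^sup>1\<close>, and
  \<open>exp (- \<xi> b)\<close> is a function of \<open>r\<close> times a function of \<open>\<rho>\<close>. So at each frequency \<open>\<xi> > 0\<close> dual to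
  \<open>s\<close> the operator has rank one:
  it sends \<open>g\<close> to \<open>c \<xi>\<^sup>k\<^sup>+\<^sup>1 \<rho>\<^sup>k exp (- \<xi> \<rho>\<^sup>\<gamma>) \<integral> r\<^sup>m exp (- \<xi> (\<gamma> - 1) r\<^sup>\<gamma>) g(r) dr\<close>. Its norm on
  \<open>L\<^sup>2(r\<^sup>d dr)\<close> is the product of the norms of two explicit functions. Both are Gamma integrals; in
  their product the powers of \<open>\<xi>\<close> cancel, and what remains is \<open>J\<close> under the square root. By
  Plancherel's identity, the Cauchy-Schwarz inequality in \<open>r\<close> gives the upper bound. For the lower
  bound the test functions concentrate at the frequency \<open>1\<close>, and their radial factor approximates the
  function for which Cauchy-Schwarz is an equality.

  The symbol. Put \<open>p = 2/\<gamma>\<close>, \<open>q = 2 - p\<close>, \<open>\<delta> = (d - 1)/\<gamma>\<close> and \<open>K = k + 1\<close>. Up to a term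
  independent of \<open>k\<close>, \<open>ln J\<close> is the function
  \<open>G(K) = ln \<Gamma>(pK + \<delta>) + ln \<Gamma>(qK - \<delta>) - 2 ln \<Gamma>(K) - K (p ln p + q ln q)\<close>, so it is enough to find
  the sign of \<open>G'\<close> for real \<open>K \<ge> 1\<close>. Let \<open>X\<^sub>c(z) = z (\<psi>(z + c) - ln z)\<close>, where \<open>\<psi>\<close> is the digamma
  function.

  For \<open>d = 1\<close>, that is \<open>\<delta> = 0\<close>, one has \<open>K G'(K) = X\<^sub>0(pK) + X\<^sub>0(qK) - 2 X\<^sub>0(K)\<close>. For \<open>d = \<gamma> - 1\<close>, that
  is \<open>\<delta> = 1 - p\<close>, the same holds with \<open>X\<^sub>1\<close> and \<open>K - 1\<close>. Now \<open>X\<^sub>1 = X\<^sub>0 + 1\<close> is strictly concave, and \<open>K\<close>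
  is the midpoint of \<open>pK\<close> and \<open>qK\<close>; so \<open>G' < 0\<close>. The other values of \<open>d\<close> for which \<open>J\<close> is claimed to decrease
  lie beyond these two, and there \<open>G'\<close> is smaller still: it is concave in \<open>\<delta>\<close>, and its slope at
  \<open>\<delta> = 0\<close> and at \<open>\<delta> = 1 - p\<close> has the right sign because \<open>z \<psi>'(z)\<close> decreases and \<open>z \<psi>'(z + 1)\<close>
  increases. The preferred value of \<open>d\<close> is \<open>\<delta> = (1 - p)/3\<close>; with \<open>t = K - 1/3\<close> it gives
  \<open>t G'(K) = X(pt) + X(qt) - 2 X(t)\<close> for \<open>X = X\<^sub>1\<^sub>/\<^sub>3\<close>. This \<open>X\<close> is not convex near \<open>0\<close>, but its
  graph lies above its tangent at every \<open>t \<ge> 2/3\<close>; so \<open>G' > 0\<close>. If \<open>\<gamma> = 2\<close> then \<open>p = q = 1\<close> and the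
  functional equation of \<open>\<Gamma>\<close> gives the ratio of consecutive values of \<open>J\<close>.\<close>

section \<open>Bounds for the trigamma and tetragamma functions\<close>

text \<open>The bounds for polygamma functions below are partial sums of their asymptotic expansions at
  infinity. Such an \<open>f\<close> bounds a series over the shifts of its argument as soon as its differences
  bound the terms, and these differences are rational functions with an explicit sign.\<close>

lemma sums_le_telescoping:
  fixes f g :: "real \<Rightarrow> real"
  assumes "\<And>x. x > 0 \<Longrightarrow> g x \<le> f x - f (x + 1)" and "(f \<longlongrightarrow> 0) at_top"
    and "(\<lambda>k. g (w + real k)) sums S" and "w > 0"
  shows "S \<le> f w"
proof -
  have "filterlim (\<lambda>k. w + real k) at_top sequentially" by real_asymp
  then have "(\<lambda>k. f (w + real k)) \<longlonglongrightarrow> 0"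
    using assms(2) by (rule filterlim_compose[rotated])
  from telescope_sums'[OF this] have "(\<lambda>k. f (w + real k) - f (w + real (Suc k))) sums f w"
    by simp
  moreover have "g (w + real k) \<le> f (w + real k) - f (w + real (Suc k))" for k
    using assms(1)[of "w + real k"] \<open>w > 0\<close> by (simp add: add_ac)
  ultimately show ?thesis using assms(3) by (meson sums_le)
qed

lemma trigamma_sums: "w > 0 \<Longrightarrow> (\<lambda>k. 1 / (w + real k)^2) sums Polygamma 1 (w::real)"
  using Polygamma_LIMSEQ[of w 1] by (simp add: power2_eq_square inverse_eq_divide)

lemma tetragamma_sums: "w > 0 \<Longrightarrow> (\<lambda>k. 1 / (w + real k)^3) sums (- Polygamma 2 (w::real) / 2)"
  using Polygamma_LIMSEQ[of w 2] by (simp add: inverse_eq_divide numeral_3_eq_3 fact_numeral)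

lemma trigamma_upper:
  assumes "w > 0"
  shows "Polygamma 1 (w::real) \<le> 1/w + 1/(2*w^2) + 1/(6*w^3)"
proof (rule sums_le_telescoping[OF _ _ trigamma_sums[OF assms] assms])
  show "((\<lambda>w::real. 1/w + 1/(2*w^2) + 1/(6*w^3)) \<longlongrightarrow> 0) at_top" by real_asymp
  fix x :: real assume x: "x > 0"
  have "1/x + 1/(2*x^2) + 1/(6*x^3) - (1/(x+1) + 1/(2*(x+1)^2) + 1/(6*(x+1)^3)) - 1/x^2
      = 1 / (6 * x^3 * (x+1)^3)"
    using x by (simp add: divide_simps) algebra
  moreover have "1 / (6 * x^3 * (x+1)^3) \<ge> 0" using x by simp
  ultimately show "1/x^2 \<le> 1/x + 1/(2*x^2) + 1/(6*x^3) - (1/(x+1) + 1/(2*(x+1)^2) + 1/(6*(x+1)^3))"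
    by linarith
qed

lemma trigamma_lower:
  assumes "w > 0"
  shows "Polygamma 1 (w::real) \<ge> 1/w + 1/(2*w^2) + 1/(6*w^3) - 1/(30*w^5)"
proof -
  have "- Polygamma 1 w \<le> - (1/w + 1/(2*w^2) + 1/(6*w^3) - 1/(30*w^5))"
  proof (rule sums_le_telescoping[OF _ _ sums_minus[OF trigamma_sums[OF assms]] assms])
    show "((\<lambda>w::real. - (1/w + 1/(2*w^2) + 1/(6*w^3) - 1/(30*w^5))) \<longlongrightarrow> 0) at_top" by real_asymp
    fix x :: real assume x: "x > 0"
    have "- (1/x + 1/(2*x^2) + 1/(6*x^3) - 1/(30*x^5))
         - - (1/(x+1) + 1/(2*(x+1)^2) + 1/(6*(x+1)^3) - 1/(30*(x+1)^5)) - - (1/x^2)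
        = (5*x^2+5*x+1) / (30 * x^5 * (x+1)^5)"
      using x by (simp add: divide_simps) algebra
    moreover have "(5*x^2+5*x+1) / (30 * x^5 * (x+1)^5) \<ge> 0" using x by simp
    ultimately show "- (1/x^2) \<le> - (1/x + 1/(2*x^2) + 1/(6*x^3) - 1/(30*x^5))
         - - (1/(x+1) + 1/(2*(x+1)^2) + 1/(6*(x+1)^3) - 1/(30*(x+1)^5))"
      by linarith
  qed
  then show ?thesis by simp
qed

lemma tetragamma_lower:
  assumes "w > 0"
  shows "- Polygamma 2 (w::real) / 2 \<le> 1/(2*w^2) + 1/(2*w^3) + 1/(4*w^4)"
proof (rule sums_le_telescoping[OF _ _ tetragamma_sums[OF assms] assms])
  show "((\<lambda>w::real. 1/(2*w^2) + 1/(2*w^3) + 1/(4*w^4)) \<longlongrightarrow> 0) at_top" by real_asymp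
  fix x :: real assume x: "x > 0"
  have "1/(2*x^2) + 1/(2*x^3) + 1/(4*x^4) - (1/(2*(x+1)^2) + 1/(2*(x+1)^3) + 1/(4*(x+1)^4)) - 1/x^3
      = (2*x+1) / (4 * x^4 * (x+1)^4)"
    using x by (simp add: divide_simps) algebra
  moreover have "(2*x+1) / (4 * x^4 * (x+1)^4) \<ge> 0" using x by simp
  ultimately show "1/x^3 \<le> 1/(2*x^2) + 1/(2*x^3) + 1/(4*x^4) - (1/(2*(x+1)^2) + 1/(2*(x+1)^3) + 1/(4*(x+1)^4))"
    by linarith
qed

lemma tetragamma_upper:
  assumes "w > 0"
  shows "- Polygamma 2 (w::real) / 2 \<ge> 1/(2*w^2) + 1/(2*w^3) + 1/(4*w^4) - 1/(12*w^6)"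
proof -
  have "- (- Polygamma 2 w / 2) \<le> - (1/(2*w^2) + 1/(2*w^3) + 1/(4*w^4) - 1/(12*w^6))"
  proof (rule sums_le_telescoping[OF _ _ sums_minus[OF tetragamma_sums[OF assms]] assms])
    show "((\<lambda>w::real. - (1/(2*w^2) + 1/(2*w^3) + 1/(4*w^4) - 1/(12*w^6))) \<longlongrightarrow> 0) at_top" by real_asymp
    fix x :: real assume x: "x > 0"
    have "- (1/(2*x^2) + 1/(2*x^3) + 1/(4*x^4) - 1/(12*x^6))
          - - (1/(2*(x+1)^2) + 1/(2*(x+1)^3) + 1/(4*(x+1)^4) - 1/(12*(x+1)^6)) - - (1/x^3)
        = (8*x^3+12*x^2+6*x+1) / (12 * x^6 * (x+1)^6)"
      using x by (simp add: divide_simps) algebra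
    moreover have "(8*x^3+12*x^2+6*x+1) / (12 * x^6 * (x+1)^6) \<ge> 0" using x by simp
    ultimately show "- (1/x^3) \<le> - (1/(2*x^2) + 1/(2*x^3) + 1/(4*x^4) - 1/(12*x^6))
          - - (1/(2*(x+1)^2) + 1/(2*(x+1)^3) + 1/(4*(x+1)^4) - 1/(12*(x+1)^6))"
      by linarith
  qed
  then show ?thesis by simp
qed

section \<open>Convexity properties of the digamma function\<close>

lemma above_tangent_line:
  fixes f f' :: "real \<Rightarrow> real"
  assumes d: "\<And>t. t \<in> closed_segment x y \<Longrightarrow> (f has_real_derivative f' t) (at t)"
    and m: "\<And>s t. s \<in> closed_segment x y \<Longrightarrow> t \<in> closed_segment x y \<Longrightarrow> s < t \<Longrightarrow> f' s < f' t"
    and ne: "x \<noteq> y"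
  shows "f x + f' x * (y - x) < f y"
proof (cases "x < y")
  case True
  then have cs: "closed_segment x y = {x..y}" by (simp add: closed_segment_eq_real_ivl)
  obtain z where z: "x < z" "z < y" "f y - f x = (y - x) * f' z"
    using MVT2[OF True, of f f'] d unfolding cs by auto
  have "f' x < f' z" using m[of x z] z unfolding cs by auto
  then have "(y - x) * f' x < (y - x) * f' z" using True by simp
  then show ?thesis using z(3) by (simp add: algebra_simps)
next
  case False
  then have lt: "y < x" using ne by simp
  then have cs: "closed_segment x y = {y..x}" by (simp add: closed_segment_eq_real_ivl)
  obtain z where z: "y < z" "z < x" "f x - f y = (x - y) * f' z"
    using MVT2[OF lt, of f f'] d unfolding cs by auto
  have "f' z < f' x" using m[of z x] z unfolding cs by auto
  then have "(x - y) * f' z < (x - y) * f' x" using lt by simp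
  then show ?thesis using z(3) by (simp add: algebra_simps)
qed

lemma closed_segment_ge:
  fixes a x y t :: real
  assumes "t \<in> closed_segment x y" "a \<le> x" "a \<le> y"
  shows "a \<le> t"
  using assms by (auto simp: closed_segment_eq_real_ivl split: if_splits)

lemma above_tangent_line_deriv2:
  fixes f f' f'' :: "real \<Rightarrow> real"
  assumes d: "\<And>t. t \<ge> a \<Longrightarrow> (f has_real_derivative f' t) (at t)"
    and d2: "\<And>t. t \<ge> a \<Longrightarrow> (f' has_real_derivative f'' t) (at t)"
    and pos: "\<And>t. t \<ge> a \<Longrightarrow> f'' t > 0"
    and "a \<le> x" "a \<le> y" "x \<noteq> y"
  shows "f x + f' x * (y - x) < f y"
proof (rule above_tangent_line)
  show "(f has_real_derivative f' t) (at t)" if "t \<in> closed_segment x y" for t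
    using d[of t] closed_segment_ge[OF that assms(4,5)] .
  show "x \<noteq> y" by fact
  fix s t :: real assume "s \<in> closed_segment x y" "t \<in> closed_segment x y" "s < t"
  moreover from this have "a \<le> s" using closed_segment_ge[of s x y a] assms(4,5) by simp
  ultimately show "f' s < f' t"
    using DERIV_pos_imp_increasing[of s t f'] d2 pos by (meson order_trans)
qed

text \<open>Concavity of the digamma function, from the sign of the tetragamma function.\<close>

lemma Digamma_below_tangent:
  fixes x y :: real
  assumes "x > 0" "y > 0"
  shows "Digamma y \<le> Digamma x + Polygamma 1 x * (y - x)"
proof (cases "x = y")
  case False
  have "- Digamma x + (- Polygamma 1 x) * (y - x) < - Digamma y"
  proof (rule above_tangent_line_deriv2[where a = "min x y" and f'' = "\<lambda>t. - Polygamma 2 t"])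
    fix t assume "min x y \<le> t"
    then have t: "t > 0" using assms by auto
    then have "t \<notin> \<int>\<^sub>\<le>\<^sub>0" by (auto elim!: nonpos_Ints_cases)
    then show "((\<lambda>y. - Digamma y) has_real_derivative - Polygamma 1 t) (at t)"
       "((\<lambda>y. - Polygamma 1 y) has_real_derivative - Polygamma 2 t) (at t)"
      by (auto intro!: derivative_eq_intros simp: numeral_2_eq_2)
    show "- Polygamma 2 t > 0" using Polygamma_real_even_neg[of t 2] t by simp
  qed (use False in auto)
  then show ?thesis by simp
qed simp

text \<open>As \<open>z\<close> tends to infinity, \<open>digamma_gap c z\<close> tends to \<open>c - 1/2\<close>. The values \<open>c = 0, 1, 1/3\<close> belong to
  \<open>d = 1\<close>, \<open>d = \<gamma> - 1\<close> and the preferred \<open>d\<close>.\<close>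

definition digamma_gap :: "real \<Rightarrow> real \<Rightarrow> real" where
  "digamma_gap c z = z * (Digamma (z + c) - ln z)"

definition digamma_gap' :: "real \<Rightarrow> real \<Rightarrow> real" where
  "digamma_gap' c z = Digamma (z + c) - ln z + z * Polygamma 1 (z + c) - 1"

definition digamma_gap'' :: "real \<Rightarrow> real \<Rightarrow> real" where
  "digamma_gap'' c z = 2 * Polygamma 1 (z + c) + z * Polygamma 2 (z + c) - 1 / z"

lemma digamma_gap_derivs:
  assumes "z > 0" "c \<ge> 0"
  shows "(digamma_gap c has_real_derivative digamma_gap' c z) (at z)" "(digamma_gap' c has_real_derivative digamma_gap'' c z) (at z)"
proof -
  have "z + c > 0" using assms by simp
  then have "z + c \<notin> \<int>\<^sub>\<le>\<^sub>0" by (auto elim!: nonpos_Ints_cases)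
  then show "(digamma_gap c has_real_derivative digamma_gap' c z) (at z)" "(digamma_gap' c has_real_derivative digamma_gap'' c z) (at z)"
    unfolding digamma_gap_def[abs_def] digamma_gap'_def[abs_def] digamma_gap''_def using assms
    by (auto intro!: derivative_eq_intros simp: numeral_2_eq_2 algebra_simps)
qed

text \<open>In \<open>v = 1/(z + 1)\<close> the asymptotic bounds turn \<open>z\<close> times the second derivative into a polynomial whose
  only positive term \<open>v\<^sup>6/6\<close> is absorbed by \<open>- v\<^sup>2/6\<close>.\<close>

lemma digamma_gap_1_deriv2_neg:
  assumes z: "z > 0" shows "digamma_gap'' 1 z < 0"
proof -
  define w where "w = z + 1"
  define v where "v = 1 / w"
  have w: "w > 1" using z by (simp add: w_def)
  have v: "0 < v" "v < 1" using w by (auto simp: v_def)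
  have zw: "z = w - 1" by (simp add: w_def)
  have wv: "w = 1 / v" by (simp add: v_def)
  have "z * (2 * Polygamma 1 w) \<le> z * (2 * (1/w + 1/(2*w^2) + 1/(6*w^3)))"
    using trigamma_upper[of w] w z by (intro mult_left_mono) auto
  moreover have "z^2 * (2 * (- Polygamma 2 w / 2)) \<ge> z^2 * (2 * (1/(2*w^2) + 1/(2*w^3) + 1/(4*w^4) - 1/(12*w^6)))"
    using tetragamma_upper[of w] w by (intro mult_left_mono) auto
  moreover have "z * (2 * (1/w + 1/(2*w^2) + 1/(6*w^3))) - z^2 * (2 * (1/(2*w^2) + 1/(2*w^3) + 1/(4*w^4) - 1/(12*w^6))) - 1
     = -(v^2)/6 - v^3/3 - v^4/3 - v^5/3 + v^6/6"
    unfolding zw wv using v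
      by (simp add: power_divide algebra_simps eval_nat_numeral) (simp add: field_simps)
  moreover have "v^6 \<le> v^2" using v by (intro power_decreasing) auto
  then have "-(v^2)/6 - v^3/3 - v^4/3 - v^5/3 + v^6/6 < 0"
    using zero_less_power[OF v(1), of 3] zero_less_power[OF v(1), of 4] zero_less_power[OF v(1), of 5] by linarith
  moreover have "z^2 * (2 * (- Polygamma 2 w / 2)) = - (z^2 * Polygamma 2 w)" by simp
  ultimately have "z * (2 * Polygamma 1 w) + z^2 * Polygamma 2 w - 1 < 0" by linarith
  then have "z * digamma_gap'' 1 z < 0"
    unfolding digamma_gap''_def w_def using z by (simp add: algebra_simps power2_eq_square)
  then show ?thesis using z by (simp add: mult_less_0_iff)
qed

text \<open>Near \<open>0\<close> the term \<open>- z ln z\<close> makes \<open>digamma_gap (1/3)\<close> concave: its second derivative changes sign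
  near \<open>0.098\<close>. The bound \<open>7/25\<close> is where the asymptotic bounds, evaluated at \<open>z + 1/3\<close>, are still
  accurate enough.\<close>

lemma digamma_gap_third_deriv2_pos:
  assumes z: "z \<ge> 7/25" shows "digamma_gap'' (1/3) z > 0"
proof -
  define w where "w = z + 1/3"
  define v where "v = 1 / w"
  have w: "w \<ge> 46/75" using z by (simp add: w_def)
  then have v: "0 < v" "v \<le> 75/46" by (auto simp: v_def field_simps)
  have zw: "z = w - 1/3" by (simp add: w_def)
  have wv: "w = 1 / v" by (simp add: v_def)
  have "z * (2 * Polygamma 1 w) \<ge> z * (2 * (1/w + 1/(2*w^2) + 1/(6*w^3) - 1/(30*w^5)))"
    using trigamma_lower[of w] w z by (intro mult_left_mono) auto
  moreover have "z^2 * (2 * (- Polygamma 2 w / 2)) \<le> z^2 * (2 * (1/(2*w^2) + 1/(2*w^3) + 1/(4*w^4)))"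
    using tetragamma_lower[of w] w by (intro mult_left_mono) auto
  moreover have "z * (2 * (1/w + 1/(2*w^2) + 1/(6*w^3) - 1/(30*w^5))) - z^2 * (2 * (1/(2*w^2) + 1/(2*w^3) + 1/(4*w^4))) - 1
     = v^2/90 * (5 + 10 * v - 11 * v^2 + 2 * v^3)"
    unfolding zw wv using v
      by (simp add: power_divide algebra_simps eval_nat_numeral) (simp add: field_simps)
  moreover have "5 + 10 * v - 11 * v^2 + 2 * v^3 > 0"
  proof -
    have "5 + 10 * v - 11 * v^2 + 2 * v^3 = 2 * v * (v - 3/2)^2 + (5 + 11/2 * v - 5 * v^2)"
      by (simp add: power2_eq_square power3_eq_cube algebra_simps)
    moreover have "2 * v * (v - 3/2)^2 \<ge> 0" using v by simp
    moreover have "5 + 11/2 * v - 5 * v^2 > 0"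
    proof -
      have "v * v \<le> 75/46 * v" using v by (intro mult_right_mono) auto
      then show ?thesis unfolding power2_eq_square using v by linarith
    qed
    ultimately show ?thesis by linarith
  qed
  then have "v^2/90 * (5 + 10 * v - 11 * v^2 + 2 * v^3) > 0" using v by simp
  moreover have "z^2 * (2 * (- Polygamma 2 w / 2)) = - (z^2 * Polygamma 2 w)" by simp
  ultimately have "z * (2 * Polygamma 1 w) + z^2 * Polygamma 2 w - 1 > 0" by linarith
  then have "z * digamma_gap'' (1/3) z > 0"
    unfolding digamma_gap''_def w_def using z by (simp add: algebra_simps power2_eq_square)
  then show ?thesis using z by (simp add: zero_less_mult_iff)
qed

lemma digamma_gap_1_midpoint:
  assumes "p > 0" "q > 0" "p + q = 2" "p \<noteq> q" "t > 0"
  shows "digamma_gap 1 (p * t) + digamma_gap 1 (q * t) < 2 * digamma_gap 1 t"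
proof -
  have *: "- digamma_gap 1 t + (- digamma_gap' 1 t) * (y - t) < - digamma_gap 1 y" if "y > 0" "y \<noteq> t" for y
  proof (rule above_tangent_line_deriv2[where a = "min t y" and f'' = "\<lambda>t. - digamma_gap'' 1 t"])
    fix s assume "min t y \<le> s"
    then have "s > 0" using assms that by auto
    then show "((\<lambda>y. - digamma_gap 1 y) has_real_derivative - digamma_gap' 1 s) (at s)"
       "((\<lambda>y. - digamma_gap' 1 y) has_real_derivative - digamma_gap'' 1 s) (at s)" "- digamma_gap'' 1 s > 0"
      using digamma_gap_derivs[of s 1] digamma_gap_1_deriv2_neg[of s] by (auto intro!: DERIV_minus)
  qed (use that in auto)
  have q: "q = 2 - p" using assms by simp
  have "p \<noteq> 1" using assms by auto
  then show ?thesis using *[of "p * t"] *[of "q * t"] assms(1,2,5) unfolding q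
    by (auto simp: algebra_simps)
qed

text \<open>The asymptotic bounds are not sharp enough near \<open>0\<close>; one step of the recurrence moves the argument
  to \<open>w = z + 1 > 1\<close> and isolates the pole.\<close>

lemma trigamma_mult_antimono:
  assumes "0 < x" "x \<le> y"
  shows "y * Polygamma 1 y \<le> x * Polygamma 1 (x::real)"
proof (rule DERIV_nonpos_imp_nonincreasing[OF assms(2)])
  fix z :: real assume z: "x \<le> z" "z \<le> y"
  then have z0: "z > 0" using assms by auto
  then have "z \<notin> \<int>\<^sub>\<le>\<^sub>0" by (auto elim!: nonpos_Ints_cases)
  then have "((\<lambda>z. z * Polygamma 1 z) has_real_derivative Polygamma 1 z + z * Polygamma 2 z) (at z)"
    by (auto intro!: derivative_eq_intros simp: numeral_2_eq_2)
  moreover have "Polygamma 1 z + z * Polygamma 2 z \<le> 0"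
  proof -
    define w where "w = z + 1"
    have w: "w > 1" using z0 by (simp add: w_def)
    have "Polygamma 1 z = Polygamma 1 w + 1/z^2" "Polygamma 2 z = Polygamma 2 w - 2/z^3"
      using Polygamma_plus1[of z 1] Polygamma_plus1[of z 2] z0
      by (auto simp: w_def power2_eq_square numeral_3_eq_3 numeral_2_eq_2)
    then have eq: "Polygamma 1 z + z * Polygamma 2 z = Polygamma 1 w + z * Polygamma 2 w - 1/z^2"
      using z0 by (simp add: field_simps power2_eq_square power3_eq_cube)
    have 1: "Polygamma 1 w \<le> 1/w + 1/(2*w^2) + 1/(6*w^3)" using trigamma_upper[of w] w by auto
    have 2: "z * (2 * (- Polygamma 2 w / 2)) \<ge> z * (2 * (1/(2*w^2) + 1/(2*w^3) + 1/(4*w^4) - 1/(12*w^6)))"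
      using tetragamma_upper[of w] w z0 by (intro mult_left_mono) auto
    have zw: "z = w - 1" by (simp add: w_def)
    define v where "v = 1 / w"
    have v: "0 < v" "v < 1" using w by (auto simp: v_def)
    have wv: "w = 1 / v" by (simp add: v_def)
    have 3: "1/w + 1/(2*w^2) + 1/(6*w^3) - z * (2 * (1/(2*w^2) + 1/(2*w^3) + 1/(4*w^4) - 1/(12*w^6)))
      = v^2/2 + 2 * v^3/3 + v^4/2 + v^5/6 - v^6/6"
      unfolding zw wv using v
      by (simp add: power_divide algebra_simps eval_nat_numeral) (simp add: field_simps)
    have 4: "1/z^2 = v^2/(1-v)^2" unfolding zw wv using v by (simp add: divide_simps)
    have "v^2/2 + 2 * v^3/3 + v^4/2 + v^5/6 \<le> v^2/(1-v)^2"
    proof -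
      have "(1-v)^2 * (1/2 + 2 * v/3 + v^2/2 + v^3/6) = 1/2 - v/3 - v^2/3 - v^3/6 + v^4/6 + v^5/6"
        by (simp add: algebra_simps eval_nat_numeral) (simp add: field_simps)
      also have "\<dots> \<le> 1"
        using v power_le_one[of v 4] power_le_one[of v 5] zero_less_power[OF v(1), of 2]
          zero_less_power[OF v(1), of 3] by linarith
      finally have "v^2 * ((1-v)^2 * (1/2 + 2 * v/3 + v^2/2 + v^3/6)) \<le> v^2" using v by simp
      moreover have "v^2/2 + 2 * v^3/3 + v^4/2 + v^5/6 = v^2 * (1/2 + 2 * v/3 + v^2/2 + v^3/6)"
        by (simp add: algebra_simps eval_nat_numeral)
      ultimately have "(v^2/2 + 2 * v^3/3 + v^4/2 + v^5/6) * (1-v)^2 \<le> v^2"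
        by (simp only: mult_ac)
      then show ?thesis using v by (simp add: pos_le_divide_eq)
    qed
    moreover have "v^6 \<ge> 0" by simp
    moreover have "z * (2 * (- Polygamma 2 w / 2)) = - (z * Polygamma 2 w)" by simp
    ultimately show ?thesis using 1 2 3 4 unfolding eq by linarith
  qed
  ultimately show "\<exists>D. ((\<lambda>z. z * Polygamma 1 z) has_real_derivative D) (at z) \<and> D \<le> 0" by blast
qed

lemma trigamma_plus1_mult_mono:
  assumes "0 < x" "x \<le> y"
  shows "x * Polygamma 1 (x + 1) \<le> y * Polygamma 1 (y + 1 :: real)"
proof (rule DERIV_nonneg_imp_nondecreasing[OF assms(2)])
  fix z :: real assume z: "x \<le> z" "z \<le> y"
  then have z0: "z > 0" using assms by auto
  then have "z + 1 \<notin> \<int>\<^sub>\<le>\<^sub>0" by (auto elim!: nonpos_Ints_cases)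
  then have "((\<lambda>z. z * Polygamma 1 (z + 1)) has_real_derivative Polygamma 1 (z + 1) + z * Polygamma 2 (z + 1)) (at z)"
    by (auto intro!: derivative_eq_intros simp: numeral_2_eq_2)
  moreover have "Polygamma 1 (z + 1) + z * Polygamma 2 (z + 1) \<ge> 0"
  proof -
    define w where "w = z + 1"
    have w: "w > 1" using z0 by (simp add: w_def)
    have 1: "Polygamma 1 w \<ge> 1/w + 1/(2*w^2) + 1/(6*w^3) - 1/(30*w^5)" using trigamma_lower[of w] w by auto
    have 2: "z * (2 * (- Polygamma 2 w / 2)) \<le> z * (2 * (1/(2*w^2) + 1/(2*w^3) + 1/(4*w^4)))"
      using tetragamma_lower[of w] w z0 by (intro mult_left_mono) auto
    have zw: "z = w - 1" by (simp add: w_def)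
    define v where "v = 1 / w"
    have v: "0 < v" "v < 1" using w by (auto simp: v_def)
    have wv: "w = 1 / v" by (simp add: v_def)
    have 3: "1/w + 1/(2*w^2) + 1/(6*w^3) - 1/(30*w^5) - z * (2 * (1/(2*w^2) + 1/(2*w^3) + 1/(4*w^4)))
      = v^2/2 + 2 * v^3/3 + v^4/2 - v^5/30"
      unfolding zw wv using v
      by (simp add: power_divide algebra_simps eval_nat_numeral) (simp add: field_simps)
    have "v^5 \<le> v^2" using v by (intro power_decreasing) auto
    then have "v^2/2 + 2 * v^3/3 + v^4/2 - v^5/30 \<ge> 0" 
      using zero_less_power[OF v(1), of 2] zero_less_power[OF v(1), of 3] zero_less_power[OF v(1), of 4]
      by linarith
    moreover have "z * (2 * (- Polygamma 2 w / 2)) = - (z * Polygamma 2 w)" by simp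
    ultimately show ?thesis using 1 2 3 unfolding w_def[symmetric] by linarith
  qed
  ultimately show "\<exists>D. ((\<lambda>z. z * Polygamma 1 (z + 1)) has_real_derivative D) (at z) \<and> D \<ge> 0" by blast
qed

text \<open>The difference of the two sides is decreasing by the upper bound for the trigamma function, and it
  tends to \<open>0\<close> along the integers, where digamma is a harmonic number minus Euler's constant.\<close>

lemma Digamma_lower:
  assumes "w > 0"
  shows "Digamma (w::real) \<ge> ln w - 1/(2*w) - 1/(12*w^2)"
proof -
  define D where "D = (\<lambda>w::real. Digamma w - (ln w - 1/(2*w) - 1/(12*w^2)))"
  have mono: "D y \<le> D x" if "0 < x" "x \<le> y" for x y
  proof (rule DERIV_nonpos_imp_nonincreasing[OF \<open>x \<le> y\<close>])
    fix z assume "x \<le> z" "z \<le> y"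
    then have z: "z > 0" using that by auto
    then have "z \<notin> \<int>\<^sub>\<le>\<^sub>0" by (auto elim!: nonpos_Ints_cases)
    then have "(D has_real_derivative Polygamma 1 z - (1/z + 1/(2*z^2) + 1/(6*z^3))) (at z)"
      unfolding D_def using z
      by (auto intro!: derivative_eq_intros simp: field_simps power2_eq_square power3_eq_cube)
    then show "\<exists>d. (D has_real_derivative d) (at z) \<and> d \<le> 0"
      using trigamma_upper[OF z] by (intro exI conjI) auto
  qed
  have "(\<lambda>n. D (real (Suc n))) \<longlonglongrightarrow> 0"
  proof -
    have "(\<lambda>n. ln (real n) - ln (real (Suc n)) + (harm n - ln (real n) - euler_mascheroni)
        + 1/(2*real (Suc n)) + 1/(12*(real (Suc n))^2)) \<longlonglongrightarrow> 0 + (euler_mascheroni - euler_mascheroni) + 0 + 0"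
      by (intro tendsto_add tendsto_diff tendsto_const euler_mascheroni_LIMSEQ; real_asymp)
    moreover have "D (real (Suc n)) = ln (real n) - ln (real (Suc n)) + (harm n - ln (real n) - euler_mascheroni)
        + 1/(2*real (Suc n)) + 1/(12*(real (Suc n))^2)" for n
      using Digamma_of_nat[of n, where ?'a = real] by (simp add: D_def add_ac)
    ultimately show ?thesis by simp
  qed
  moreover have "\<forall>\<^sub>F n in sequentially. D (real (Suc n)) \<le> D w"
  proof -
    obtain N where N: "w \<le> real N" using real_arch_simple by blast
    show ?thesis
      using eventually_ge_at_top[of N]
    proof eventually_elim
      case (elim n)
      then have "w \<le> real (Suc n)" using N by simp
      then show ?case using mono[of w "real (Suc n)"] assms by simp
    qed
  qed
  ultimately have "0 \<le> D w" by (rule tendsto_upperbound) simp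
  then show ?thesis by (simp add: D_def)
qed

lemma ln_lower_harmonic_mean:
  fixes x :: real assumes "x \<ge> 0" shows "2 * x / (2 + x) \<le> ln (1 + x)"
proof -
  have "ln (1 + 0) - 2 * 0 / (2 + 0) \<le> ln (1 + x) - 2 * x / (2 + x)"
  proof (rule DERIV_nonneg_imp_nondecreasing[OF assms])
    fix y :: real assume "0 \<le> y" "y \<le> x"
    then have "((\<lambda>x. ln (1 + x) - 2 * x / (2 + x)) has_real_derivative
        1 / (1 + y) - (2 * (2 + y) - 2 * y) / ((2 + y) * (2 + y))) (at y)"
      by (auto intro!: derivative_eq_intros)
    moreover have "1 / (1 + y) - (2 * (2 + y) - 2 * y) / ((2 + y) * (2 + y)) = y^2 / ((1 + y) * (2 + y)^2)"
      using \<open>0 \<le> y\<close> by (simp add: divide_simps power2_eq_square) algebra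
    moreover have "y^2 / ((1 + y) * (2 + y)^2) \<ge> 0" using \<open>0 \<le> y\<close> by simp
    ultimately show "\<exists>d. ((\<lambda>x. ln (1 + x) - 2 * x / (2 + x)) has_real_derivative d) (at y) \<and> d \<ge> 0" by metis
  qed
  then show ?thesis by simp
qed

text \<open>On this interval the tangent at \<open>2/3\<close> is about \<open>-0.064 - 0.07 z\<close>, and crude rational lower
  bounds for the digamma function and the logarithm already exceed this. At \<open>2/3\<close> the argument
  \<open>z + 1/3\<close> is \<open>1\<close>, where digamma and trigamma have known values.\<close>

lemma digamma_gap_third_above_tangent_two_thirds:
  assumes z: "0 < z" "z \<le> 7/25"
  shows "digamma_gap (1/3) z > digamma_gap (1/3) (2/3) + digamma_gap' (1/3) (2/3) * (z - 2/3)"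
proof -
  define T where "T = Polygamma 1 (1::real)"
  define L where "L = Digamma (1::real) - ln (2/3)"
  have T: "1644/1000 \<le> T" "T \<le> 1646/1000"
  proof -
    have "Polygamma 1 (1::real) = Polygamma 1 4 + 1 + 1/4 + 1/9"
      using Polygamma_plus1[of "1::real" 1] Polygamma_plus1[of "2::real" 1] Polygamma_plus1[of "3::real" 1] by simp
    then show "1644/1000 \<le> T" "T \<le> 1646/1000"
      using trigamma_lower[of 4] trigamma_upper[of 4] by (auto simp: T_def)
  qed
  have L: "L \<le> -165/1000"
  proof -
    \<comment> \<open>The decimal bound 0.41 for \<open>ln (3/2)\<close>, from the Taylor polynomial of exp.\<close>
    have "exp (41/100::real) \<ge> 3/2"
    proof -
      have "1 + 41/100 + (41/100)^2/2 + (41/100)^3/6 \<le> exp (41/100::real)"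
        using exp_lower_Taylor_quadratic[of "41/100::real"] Maclaurin_exp_lt[of "41/100::real" 4]
        by (auto simp: eval_nat_numeral fact_numeral)
      then show ?thesis by (simp add: power2_eq_square power3_eq_cube)
    qed
    then have "ln (3/2) \<le> (41/100::real)" using ln_le_cancel_iff[of "3/2" "exp (41/100)"] by simp
    moreover have "ln (2/3 :: real) = - ln (3/2)" by (simp add: ln_div)
    moreover have "euler_mascheroni > (575/1000::real)" using euler_mascheroni_gt_19_over_33 by simp
    ultimately show ?thesis by (simp add: L_def)
  qed
  have e: "digamma_gap (1/3) (2/3) = 2/3 * L" "digamma_gap' (1/3) (2/3) = L + 2/3 * T - 1"
    by (simp_all add: digamma_gap_def digamma_gap'_def L_def T_def)
  have "digamma_gap (1/3) (2/3) + digamma_gap' (1/3) (2/3) * (z - 2/3) = z * L + (z - 2/3) * (2/3 * T - 1)"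
    unfolding e by (simp add: algebra_simps)
  also have "\<dots> \<le> z * (-165/1000) + (z - 2/3) * (2/3 * 1644/1000 - 1)"
    using L T z by (intro add_mono mult_left_mono mult_left_mono_neg) auto
  also have "\<dots> = -64/1000 - 69/1000 * z" by (simp add: field_simps)
  finally have tan: "digamma_gap (1/3) (2/3) + digamma_gap' (1/3) (2/3) * (z - 2/3) \<le> -64/1000 - 69/1000 * z" .
  define w where "w = 3 * z + 1"
  have w: "w > 0" using z by (simp add: w_def)
  have "2 / (6 * z + 1) \<le> ln (1 + 1/(3*z))"
    using ln_lower_harmonic_mean[of "1/(3*z)"] z by (simp add: field_simps)
  also have "ln (1 + 1/(3*z)) = ln (z + 1/3) - ln z"
  proof -
    have "1 + 1/(3*z) = (z + 1/3) / z" using z by (simp add: field_simps)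
    then show ?thesis using z by (simp add: ln_div)
  qed
  finally have "2 / (6 * z + 1) - 3/(2*w) - 3/(4*w^2) \<le> Digamma (z + 1/3) - ln z"
  proof -
    have zw: "z + 1/3 = w / 3" by (simp add: w_def field_simps)
    have "1/(2 * (z + 1/3)) = 3/(2*w)" "1/(12 * (z + 1/3)^2) = 3/(4*w^2)"
      unfolding zw using w by (simp_all add: field_simps power2_eq_square)
    moreover assume "2 / (6 * z + 1) \<le> ln (z + 1/3) - ln z"
    ultimately show ?thesis using Digamma_lower[of "z + 1/3"] z by linarith
  qed
  then have X: "z * (2 / (6 * z + 1) - 3/(2*w) - 3/(4*w^2)) \<le> digamma_gap (1/3) z"
    using z unfolding digamma_gap_def by (intro mult_left_mono) auto
  have "0 < z * (8 * w^2 - 6 * w * (6*z+1) - 3 * (6*z+1)) + 4 * (64/1000 + 69/1000 * z) * (6*z+1) * w^2"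
  proof -
    have "z * (8 * w^2 - 6 * w * (6*z+1) - 3 * (6*z+1)) + 4 * (64/1000 + 69/1000 * z) * (6*z+1) * w^2
      = 14904/1000 * z^4 - 9756/1000 * z^3 - 9168/1000 * z^2 + 2348/1000 * z + 256/1000"
      unfolding w_def by (simp add: algebra_simps eval_nat_numeral) (simp add: field_simps)
    also have "\<dots> > 0"
    proof -
      have 1: "z^2 \<le> 7/25 * z" using z by (simp add: power2_eq_square)
      have "z * z^2 \<le> 7/25 * z^2" using z by (intro mult_right_mono) auto
      then have 2: "z^3 \<le> 7/25 * z^2" by (simp add: power2_eq_square power3_eq_cube)
      \<comment> \<open>The tangent to \<open>z\<^sup>4\<close>, as a function of \<open>z\<^sup>2\<close>, at the end point \<open>z = 7/25\<close>, where the inequality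
        is tightest.\<close>
      have "(z^2 - 784/10000)^2 \<ge> 0" by simp
      then have 3: "z^4 - 1568/10000 * z^2 + 784/10000 * 784/10000 \<ge> 0"
        by (simp add: power2_eq_square algebra_simps eval_nat_numeral)
      show ?thesis using 1 2 3 z by linarith
    qed
    finally show ?thesis .
  qed
  then have "0 < (z * (8 * w^2 - 6 * w * (6*z+1) - 3 * (6*z+1)) + 4 * (64/1000 + 69/1000 * z) * (6*z+1) * w^2)
     / (4 * (6*z+1) * w^2)"
    using w z by (intro divide_pos_pos) auto
  also have "\<dots> = z * (2 / (6 * z + 1) - 3/(2*w) - 3/(4*w^2)) + (64/1000 + 69/1000 * z)"
    using w z by (simp add: divide_simps) (simp add: algebra_simps eval_nat_numeral)?
  finally show ?thesis using X tan by linarith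
qed

text \<open>The tangent of \<open>digamma_gap (1/3)\<close> at \<open>t\<close> lies below the graph: on \<open>[7/25, \<infinity>)\<close> by convexity,
  and on \<open>(0, 7/25)\<close> because there it lies below the tangent at \<open>2/3\<close>. Adding the tangent inequalities
  at \<open>p t\<close> and \<open>q t\<close>, whose midpoint is \<open>t\<close>, gives the claim.\<close>

lemma digamma_gap_third_midpoint:
  assumes "p > 0" "q > 0" "p + q = 2" "p \<noteq> q" "t \<ge> 2/3"
  shows "digamma_gap (1/3) (p * t) + digamma_gap (1/3) (q * t) > 2 * digamma_gap (1/3) t"
proof -
  have convex: "digamma_gap (1/3) x + digamma_gap' (1/3) x * (y - x) < digamma_gap (1/3) y"
    if "7/25 \<le> x" "7/25 \<le> y" "x \<noteq> y" for x y
  proof (rule above_tangent_line_deriv2[where a = "7/25" and f'' = "digamma_gap'' (1/3)"])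
    fix s :: real assume "7/25 \<le> s"
    then show "(digamma_gap (1/3) has_real_derivative digamma_gap' (1/3) s) (at s)"
       "(digamma_gap' (1/3) has_real_derivative digamma_gap'' (1/3) s) (at s)" "digamma_gap'' (1/3) s > 0"
      using digamma_gap_derivs[of s "1/3"] digamma_gap_third_deriv2_pos[of s] by auto
  qed (use that in auto)
  have *: "digamma_gap (1/3) t + digamma_gap' (1/3) t * (y - t) < digamma_gap (1/3) y" if "y > 0" "y \<noteq> t" for y
  proof (cases "y \<ge> 7/25")
    case True
    then show ?thesis using convex[of t y] that assms by auto
  next
    case False
    have 1: "digamma_gap (1/3) (2/3) \<ge> digamma_gap (1/3) t + digamma_gap' (1/3) t * (2/3 - t)"
    proof (cases "t = 2/3")
      case True
      show ?thesis unfolding True by simp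
    next
      case False
      then show ?thesis using convex[of t "2/3"] assms(5) by auto
    qed
    have 2: "digamma_gap' (1/3) (2/3) \<le> digamma_gap' (1/3) t"
    proof (rule DERIV_nonneg_imp_nondecreasing[OF assms(5)])
      fix s :: real assume "2/3 \<le> s"
      then show "\<exists>D. (digamma_gap' (1/3) has_real_derivative D) (at s) \<and> D \<ge> 0"
        using digamma_gap_derivs(2)[of s "1/3"] digamma_gap_third_deriv2_pos[of s]
        by (intro exI[of _ "digamma_gap'' (1/3) s"]) auto
    qed
    have "digamma_gap (1/3) t + digamma_gap' (1/3) t * (y - t)
       = digamma_gap (1/3) t + digamma_gap' (1/3) t * (2/3 - t) + digamma_gap' (1/3) t * (y - 2/3)"
      by (simp add: algebra_simps)
    also have "\<dots> \<le> digamma_gap (1/3) (2/3) + digamma_gap' (1/3) (2/3) * (y - 2/3)"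
      using 1 2 False by (intro add_mono mult_right_mono_neg) auto
    also have "\<dots> < digamma_gap (1/3) y"
      using digamma_gap_third_above_tangent_two_thirds[of y] that False by auto
    finally show ?thesis .
  qed
  have q: "q = 2 - p" using assms by simp
  have "p \<noteq> 1" using assms by auto
  then show ?thesis using *[of "p * t"] *[of "q * t"] assms(1,2,5) unfolding q
    by (auto simp: algebra_simps)
qed

section \<open>Monotonicity of the Leray symbol\<close>

text \<open>The logarithm of the Leray symbol as a function of real \<open>K = k + 1\<close>, without the term
  \<open>\<delta> ln (q / p)\<close> that does not depend on \<open>K\<close>.\<close>

definition log_symbol :: "real \<Rightarrow> real \<Rightarrow> real \<Rightarrow> real \<Rightarrow> real" where
  "log_symbol p q \<delta> K =
     ln_Gamma (p * K + \<delta>) + ln_Gamma (q * K - \<delta>) - 2 * ln_Gamma K - K * (p * ln p + q * ln q)"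

definition log_symbol' :: "real \<Rightarrow> real \<Rightarrow> real \<Rightarrow> real \<Rightarrow> real" where
  "log_symbol' p q \<delta> K =
     p * Digamma (p * K + \<delta>) + q * Digamma (q * K - \<delta>) - 2 * Digamma K - (p * ln p + q * ln q)"

lemma log_symbol_deriv:
  assumes "K > 0" "p * K + \<delta> > 0" "q * K - \<delta> > 0"
  shows "(log_symbol p q \<delta> has_real_derivative log_symbol' p q \<delta> K) (at K)"
  unfolding log_symbol_def[abs_def] log_symbol'_def using assms
  by (auto intro!: derivative_eq_intros simp: algebra_simps)

text \<open>Exchanging \<open>p\<close> and \<open>q\<close> exchanges \<open>\<gamma>\<close> with its conjugate exponent. This reduces \<open>\<gamma> < 2\<close> to
  \<open>\<gamma> > 2\<close>.\<close>

lemma log_symbol_swap: "log_symbol p q \<delta> K = log_symbol q p (-\<delta>) K"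
  by (simp add: log_symbol_def add_ac)

lemma digamma_gap_midpoint_identity:
  assumes "p > 0" "q > 0" "p + q = 2" "t > 0"
  shows "t * (p * Digamma (p * t + c) + q * Digamma (q * t + c) - 2 * Digamma (t + c) - (p * ln p + q * ln q))
       = digamma_gap c (p * t) + digamma_gap c (q * t) - 2 * digamma_gap c t"
proof -
  have q: "q = 2 - p" using assms by simp
  have "ln (p * t) = ln p + ln t" "ln (q * t) = ln q + ln t" using assms by (simp_all add: ln_mult)
  then show ?thesis unfolding digamma_gap_def q by (simp add: algebra_simps)
qed

lemma affine_pos:
  fixes p :: real assumes "p > 0" "p + \<delta> > 0" "K \<ge> 1" shows "p * K + \<delta> > 0"
proof -
  have "p * 1 \<le> p * K" using assms by (intro mult_left_mono) auto
  then show ?thesis using assms by linarith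
qed

text \<open>As a function of \<open>\<delta>\<close> the derivative is concave, since digamma is. At \<open>\<delta> = 0\<close> it is negative, and its
  slope there is nonnegative because \<open>z \<psi>'(z)\<close> decreases; so it stays negative for \<open>\<delta> \<le> 0\<close>.\<close>

lemma log_symbol'_neg_nonpos_shift:
  assumes "0 < p" "p < q" "p + q = 2" "\<delta> \<le> 0" "p + \<delta> > 0" "q - \<delta> > 0" "K \<ge> 1"
  shows "log_symbol' p q \<delta> K < 0"
proof -
  have q: "q > 0" using assms by simp
  have pos: "p * K + \<delta> > 0" "q * K - \<delta> > 0" "p * K > 0" "q * K > 0"
    using affine_pos[of p \<delta> K] affine_pos[of q "-\<delta>" K] assms q by auto
  have "p * Digamma (p * K + \<delta>) \<le> p * (Digamma (p * K) + Polygamma 1 (p * K) * \<delta>)"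
    using Digamma_below_tangent[of "p * K" "p * K + \<delta>"] pos assms(1) by (intro mult_left_mono) auto
  moreover have "q * Digamma (q * K - \<delta>) \<le> q * (Digamma (q * K) - Polygamma 1 (q * K) * \<delta>)"
    using Digamma_below_tangent[of "q * K" "q * K - \<delta>"] pos q by (intro mult_left_mono) auto
  moreover have "(p * K * Polygamma 1 (p * K) - q * K * Polygamma 1 (q * K)) * \<delta> \<le> 0"
    using trigamma_mult_antimono[of "p * K" "q * K"] pos assms by (intro mult_nonneg_nonpos) auto
  then have "K * ((p * Polygamma 1 (p * K) - q * Polygamma 1 (q * K)) * \<delta>) \<le> 0"
    by (simp add: algebra_simps)
  then have "(p * Polygamma 1 (p * K) - q * Polygamma 1 (q * K)) * \<delta> \<le> 0"
    using assms(7) by (simp add: mult_le_0_iff)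
  moreover have "p * Digamma (p * K) + q * Digamma (q * K) - 2 * Digamma K - (p * ln p + q * ln q) < 0"
  proof -
    \<comment> \<open>From the recurrence \<open>\<psi>(z + 1) = \<psi>(z) + 1/z\<close>.\<close>
    have X01: "digamma_gap 0 z = digamma_gap 1 z - 1" if "z > 0" for z
      using Digamma_plus1[of z] that by (simp add: digamma_gap_def field_simps)
    have "K * (p * Digamma (p * K) + q * Digamma (q * K) - 2 * Digamma K - (p * ln p + q * ln q))
        = digamma_gap 0 (p * K) + digamma_gap 0 (q * K) - 2 * digamma_gap 0 K"
      using digamma_gap_midpoint_identity[of p q K 0] assms q by simp
    also have "\<dots> = digamma_gap 1 (p * K) + digamma_gap 1 (q * K) - 2 * digamma_gap 1 K"
      using pos assms(7) by (simp add: X01)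
    also have "\<dots> < 0" using digamma_gap_1_midpoint[of p q K] assms q by simp
    finally show ?thesis using assms(7) by (simp add: mult_less_0_iff)
  qed
  ultimately show ?thesis unfolding log_symbol'_def by (simp add: algebra_simps)
qed

text \<open>The same argument starts from \<open>\<delta> = 1 - p\<close>. With \<open>k = K - 1\<close> the arguments there are \<open>p k + 1\<close> and
  \<open>q k + 1\<close>, and the slope in \<open>\<delta>\<close> is nonpositive because \<open>z \<psi>'(z + 1)\<close> increases.\<close>

lemma log_symbol'_neg_large_shift:
  assumes "0 < p" "p < q" "p + q = 2" "\<delta> \<ge> 1 - p" "q - \<delta> > 0" "K > 1"
  shows "log_symbol' p q \<delta> K < 0"
proof -
  define k where "k = K - 1"
  define e where "e = \<delta> - (1 - p)"
  have k: "k > 0" and e: "e \<ge> 0" using assms by (auto simp: k_def e_def)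
  have q: "q > 0" "q = 2 - p" using assms by simp_all
  have eqs: "p * K + \<delta> = p * k + 1 + e" "q * K - \<delta> = q * k + 1 - e" "Digamma K = Digamma (k + 1)"
    by (auto simp: k_def e_def q(2) algebra_simps)
  have "q * K - \<delta> > 0" using affine_pos[of q "-\<delta>" K] assms q by simp
  then have pos: "p * k > 0" "q * k > 0" "q * k + 1 - e > 0"
    using assms(1) q k unfolding eqs(2) by auto
  have "p * Digamma (p * k + 1 + e) \<le> p * (Digamma (p * k + 1) + Polygamma 1 (p * k + 1) * e)"
    using Digamma_below_tangent[of "p * k + 1" "p * k + 1 + e"] pos assms(1) e by (intro mult_left_mono) auto
  moreover have "q * Digamma (q * k + 1 - e) \<le> q * (Digamma (q * k + 1) - Polygamma 1 (q * k + 1) * e)"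
    using Digamma_below_tangent[of "q * k + 1" "q * k + 1 - e"] pos q(1) by (intro mult_left_mono) auto
  moreover have "(p * k * Polygamma 1 (p * k + 1) - q * k * Polygamma 1 (q * k + 1)) * e \<le> 0"
    using trigamma_plus1_mult_mono[of "p * k" "q * k"] pos assms e k by (intro mult_nonpos_nonneg) auto
  then have "k * ((p * Polygamma 1 (p * k + 1) - q * Polygamma 1 (q * k + 1)) * e) \<le> 0"
    by (simp add: algebra_simps)
  then have "(p * Polygamma 1 (p * k + 1) - q * Polygamma 1 (q * k + 1)) * e \<le> 0"
    using k by (simp add: mult_le_0_iff)
  moreover have "p * Digamma (p * k + 1) + q * Digamma (q * k + 1) - 2 * Digamma (k + 1) - (p * ln p + q * ln q) < 0"
  proof -
    have "k * (p * Digamma (p * k + 1) + q * Digamma (q * k + 1) - 2 * Digamma (k + 1) - (p * ln p + q * ln q))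
        = digamma_gap 1 (p * k) + digamma_gap 1 (q * k) - 2 * digamma_gap 1 k"
      using digamma_gap_midpoint_identity[of p q k 1] assms q k by simp
    also have "\<dots> < 0" using digamma_gap_1_midpoint[of p q k] assms q k by simp
    finally show ?thesis using k by (simp add: mult_less_0_iff)
  qed
  ultimately show ?thesis unfolding log_symbol'_def eqs by (simp add: algebra_simps)
qed

lemma log_symbol'_pos_third_shift:
  assumes "0 < p" "0 < q" "p \<noteq> q" "p + q = 2" "K \<ge> 1"
  shows "log_symbol' p q ((1 - p) / 3) K > 0"
proof -
  define t where "t = K - 1/3"
  have t: "t \<ge> 2/3" using assms by (simp add: t_def)
  have q: "q = 2 - p" using assms by simp
  have eqs: "p * K + (1 - p) / 3 = p * t + 1/3" "q * K - (1 - p) / 3 = q * t + 1/3" "Digamma K = Digamma (t + 1/3)"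
    by (auto simp: t_def q field_simps)
  have "t * log_symbol' p q ((1 - p) / 3) K = digamma_gap (1/3) (p * t) + digamma_gap (1/3) (q * t) - 2 * digamma_gap (1/3) t"
    unfolding log_symbol'_def eqs using digamma_gap_midpoint_identity[of p q t "1/3"] assms t by simp
  also have "\<dots> > 0" using digamma_gap_third_midpoint[of p q t] assms t by simp
  finally show ?thesis using t by (simp add: zero_less_mult_iff)
qed

lemma log_symbol_strict_decreasing:
  assumes "0 < p" "p < q" "p + q = 2" "p + \<delta> > 0" "q - \<delta> > 0" "\<delta> \<le> 0 \<or> \<delta> \<ge> 1 - p" "1 \<le> K" "K < L"
  shows "log_symbol p q \<delta> L < log_symbol p q \<delta> K"
proof (rule DERIV_neg_imp_decreasing_open[OF assms(8)])
  have q: "q > 0" using assms by simp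
  have D: "(log_symbol p q \<delta> has_real_derivative log_symbol' p q \<delta> z) (at z)" if "z \<ge> 1" for z
    using log_symbol_deriv[of z p \<delta> q] affine_pos[of p \<delta> z] affine_pos[of q "-\<delta>" z] that assms q by simp
  show "continuous_on {K..L} (log_symbol p q \<delta>)"
    using D assms by (intro DERIV_atLeastAtMost_imp_continuous_on) (meson order_trans)
  fix z assume "K < z" "z < L"
  then show "\<exists>y. (log_symbol p q \<delta> has_real_derivative y) (at z) \<and> y < 0"
    using D[of z] log_symbol'_neg_nonpos_shift[of p q \<delta> z] log_symbol'_neg_large_shift[of p q \<delta> z] assms
    by (intro exI[of _ "log_symbol' p q \<delta> z"]) auto
qed

lemma log_symbol_third_strict_increasing:
  assumes "0 < p" "0 < q" "p \<noteq> q" "p + q = 2" "1 \<le> K" "K < L"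
  shows "log_symbol p q ((1 - p) / 3) K < log_symbol p q ((1 - p) / 3) L"
proof (rule DERIV_pos_imp_increasing[OF assms(6)])
  fix z assume z: "K \<le> z" "z \<le> L"
  have "(log_symbol p q ((1 - p) / 3) has_real_derivative log_symbol' p q ((1 - p) / 3) z) (at z)"
    using log_symbol_deriv[of z p "(1 - p) / 3" q] affine_pos[of p "(1 - p) / 3" z]
      affine_pos[of q "- ((1 - p) / 3)" z] z assms by (simp add: field_simps)
  then show "\<exists>y. (log_symbol p q ((1 - p) / 3) has_real_derivative y) (at z) \<and> y > 0"
    using log_symbol'_pos_third_shift[of p q z] z assms
    by (intro exI[of _ "log_symbol' p q ((1 - p) / 3) z"]) auto
qed

lemma leray_symbol_eq_exp_log_symbol:
  assumes g: "\<gamma> > 1" and d: "-1 < d" "d < 2 * \<gamma> - 1"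
    and p: "p = 2 / \<gamma>" and q: "q = 2 - 2 / \<gamma>" and \<delta>: "\<delta> = (d - 1) / \<gamma>"
  shows "leray_symbol d \<gamma> k = exp (log_symbol p q \<delta> (real k + 1) + \<delta> * ln (q / p))"
proof -
  define K where "K = real k + 1"
  have K: "K \<ge> 1" by (simp add: K_def)
  have pq: "p > 0" "q > 0" "p + \<delta> > 0" "q - \<delta> > 0"
  proof -
    have "p + \<delta> = (d + 1) / \<gamma>" "q - \<delta> = (2 * \<gamma> - 1 - d) / \<gamma>" using g by (simp_all add: p q \<delta> field_simps)
    then show "p > 0" "q > 0" "p + \<delta> > 0" "q - \<delta> > 0" using g d by (auto simp: p q field_simps)
  qed
  have pos: "p * K + \<delta> > 0" "q * K - \<delta> > 0"
    using affine_pos[of p \<delta> K] affine_pos[of q "-\<delta>" K] pq K by auto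
  have x: "(2 * real k + 1 + d) / \<gamma> = p * K + \<delta>"
    using g by (simp add: p \<delta> K_def field_simps)
  have y: "2 * real k + 2 - (2 * real k + 1 + d) / \<gamma> = q * K - \<delta>"
    using g by (simp add: q \<delta> K_def field_simps)
  have "(\<gamma> / 2) ^ (2 * k + 2) = exp (real (2 * k + 2) * ln (\<gamma> / 2))"
    using g by (subst exp_of_nat_mult) simp
  also have "ln (\<gamma> / 2) = - ln p" using g by (simp add: p ln_div)
  also have "real (2 * k + 2) = 2 * K" by (simp add: K_def)
  finally have 1: "(\<gamma> / 2) ^ (2 * k + 2) = exp (- 2 * K * ln p)" by simp
  have "\<gamma> - 1 = q / p" using g by (simp add: p q field_simps)
  then have 2: "(\<gamma> - 1) powr (- (q * K - \<delta>)) = exp (- (q * K - \<delta>) * (ln q - ln p))"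
    using pq g by (simp add: powr_def ln_div)
  have "K * q * ln p = 2 * K * ln p - K * p * ln p" by (simp add: p q algebra_simps)
  then have "ln_Gamma (p * K + \<delta>) + ln_Gamma (q * K - \<delta>) - 2 * ln_Gamma K + - 2 * K * ln p + - (q * K - \<delta>) * (ln q - ln p)
    = log_symbol p q \<delta> K + \<delta> * (ln q - ln p)"
    by (simp add: log_symbol_def algebra_simps)
  moreover have "ln (q / p) = ln q - ln p" using pq by (simp add: ln_div)
  moreover have "leray_symbol d \<gamma> k = exp (ln_Gamma (p * K + \<delta>) + ln_Gamma (q * K - \<delta>) - 2 * ln_Gamma K
       + - 2 * K * ln p + - (q * K - \<delta>) * (ln q - ln p))"
    unfolding leray_symbol_def x y[unfolded x] 1 2 exp_add exp_diff
    using pos K by (simp add: Gamma_real_pos_exp K_def exp_double)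
  ultimately show ?thesis unfolding K_def[symmetric] by simp
qed

lemma leray_symbol_pos:
  assumes "\<gamma> > 1" "-1 < d" "d < 2 * \<gamma> - 1"
  shows "leray_symbol d \<gamma> k > 0"
  using leray_symbol_eq_exp_log_symbol[OF assms refl refl refl] by simp

text \<open>Here \<open>p = q = 1\<close>, and \<open>\<Gamma>(x + 1) = x \<Gamma>(x)\<close> gives the ratio \<open>(K\<^sup>2 - e\<^sup>2)/K\<^sup>2\<close> of consecutive values,
  where \<open>K = k + 1\<close> and \<open>e = (d - 1)/2\<close>.\<close>

lemma leray_symbol_two_decreasing:
  assumes "d \<in> {-1<..<1} \<union> {1<..<3}"
  shows "leray_symbol d 2 (Suc k) < leray_symbol d 2 k"
proof -
  define e where "e = (d - 1) / 2"
  define K where "K = real k + 1"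
  have e: "e \<noteq> 0" "\<bar>e\<bar> < 1" using assms by (auto simp: e_def)
  have J: "leray_symbol d 2 j = Gamma (real j + 1 + e) * Gamma (real j + 1 - e) / (Gamma (real j + 1))\<^sup>2" for j
  proof -
    have 1: "(2 * real j + 1 + d) / 2 = real j + 1 + e" "2 * real j + 2 - (2 * real j + 1 + d) / 2 = real j + 1 - e"
      by (simp_all add: e_def field_simps)
    show ?thesis unfolding leray_symbol_def 1 by (simp add: algebra_simps)
  qed
  have pos: "K + e > 0" "K - e > 0" "K > 0" using e by (auto simp: K_def)
  have G: "Gamma (x + 1) = x * Gamma x" if "x > 0" for x :: real
    using that by (intro Gamma_plus1) (auto elim!: nonpos_Ints_cases)
  have "leray_symbol d 2 (Suc k) = (K + e) * (K - e) / K\<^sup>2 * leray_symbol d 2 k"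
  proof -
    have "Gamma (K + 1 + e) = (K + e) * Gamma (K + e)" "Gamma (K + 1 - e) = (K - e) * Gamma (K - e)"
      "Gamma (K + 1) = K * Gamma K"
      using G[OF pos(1)] G[OF pos(2)] G[OF pos(3)] by (simp_all add: algebra_simps)
    moreover have eqs: "real (Suc k) + 1 = K + 1" "real k + 1 = K" by (simp_all add: K_def)
    ultimately show ?thesis unfolding J eqs using pos by (simp add: power_mult_distrib)
  qed
  moreover have "(K + e) * (K - e) / K\<^sup>2 < 1"
  proof -
    have "0 < e * e" using e(1) not_real_square_gt_zero by metis
    then show ?thesis using pos by (simp add: power2_eq_square algebra_simps)
  qed
  moreover have "leray_symbol d 2 k > 0" using leray_symbol_pos[of 2 d k] assms by auto
  ultimately show ?thesis
    using mult_strict_right_mono[of "(K + e) * (K - e) / K\<^sup>2" 1 "leray_symbol d 2 k"] by simp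
qed

lemma leray_symbol_decreasing:
  assumes g: "\<gamma> > 1" and d: "-1 < d" "d < 2 * \<gamma> - 1"
    and "\<gamma> > 2 \<and> (d \<le> 1 \<or> d \<ge> \<gamma> - 1) \<or> \<gamma> < 2 \<and> (d \<le> \<gamma> - 1 \<or> d \<ge> 1)"
  shows "leray_symbol d \<gamma> (Suc k) < leray_symbol d \<gamma> k"
proof -
  define p q \<delta> where "p = 2 / \<gamma>" and "q = 2 - 2 / \<gamma>" and "\<delta> = (d - 1) / \<gamma>"
  have eqs: "p + \<delta> = (d + 1) / \<gamma>" "q - \<delta> = (2 * \<gamma> - 1 - d) / \<gamma>" "1 - p = (\<gamma> - 2) / \<gamma>" "1 - q = (2 - \<gamma>) / \<gamma>"
    using g by (simp_all add: p_def q_def \<delta>_def field_simps)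
  have pos: "p > 0" "q > 0" "p + \<delta> > 0" "q - \<delta> > 0"
    using g d unfolding eqs by (auto simp: p_def q_def field_simps)
  have sum: "p + q = 2" by (simp add: p_def q_def)
  have "log_symbol p q \<delta> (real (Suc k) + 1) < log_symbol p q \<delta> (real k + 1)"
  proof (cases "\<gamma> > 2")
    case True
    have "p < q" using True by (simp add: p_def q_def field_simps)
    moreover have "\<delta> \<le> 0 \<or> \<delta> \<ge> 1 - p"
      using assms(4) True unfolding eqs \<delta>_def by (auto intro!: divide_right_mono simp: divide_nonpos_pos)
    ultimately show ?thesis using pos sum by (intro log_symbol_strict_decreasing) auto
  next
    case False
    have \<delta>': "- \<delta> = (1 - d) / \<gamma>" by (simp add: \<delta>_def diff_divide_distrib)
    have "q < p" using assms(4) g False by (simp add: p_def q_def field_simps)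
    moreover have "- \<delta> \<le> 0 \<or> - \<delta> \<ge> 1 - q"
      using assms(4) g False unfolding eqs \<delta>' by (auto intro!: divide_right_mono simp: divide_nonpos_pos)
    ultimately show ?thesis using pos sum unfolding log_symbol_swap[of p q]
      by (intro log_symbol_strict_decreasing) auto
  qed
  then show ?thesis
    unfolding leray_symbol_eq_exp_log_symbol[OF g d p_def q_def \<delta>_def] by simp
qed

lemma preferred_symbol_increasing:
  assumes g: "\<gamma> > 1" and "\<gamma> \<noteq> 2"
  shows "preferred_symbol \<gamma> k < preferred_symbol \<gamma> (Suc k)"
proof -
  define d where "d = (\<gamma> + 1) / 3"
  define p q \<delta> where "p = 2 / \<gamma>" and "q = 2 - 2 / \<gamma>" and "\<delta> = (d - 1) / \<gamma>"
  have d: "-1 < d" "d < 2 * \<gamma> - 1" using g by (auto simp: d_def)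
  have \<delta>: "\<delta> = (1 - p) / 3" using g by (simp add: \<delta>_def d_def p_def field_simps)
  have "log_symbol p q \<delta> (real k + 1) < log_symbol p q \<delta> (real (Suc k) + 1)"
    unfolding \<delta> using assms
    by (intro log_symbol_third_strict_increasing) (auto simp: p_def q_def field_simps)
  then show ?thesis
    unfolding d_def[symmetric] leray_symbol_eq_exp_log_symbol[OF g d p_def q_def \<delta>_def] by simp
qed

section \<open>Plancherel's identity on the line\<close>

abbreviation energy :: "'a measure \<Rightarrow> ('a \<Rightarrow> complex) \<Rightarrow> ennreal" where
  "energy M u \<equiv> \<integral>\<^sup>+x. ennreal ((norm (u x))\<^sup>2) \<partial>M"

lemma borel_measurable_cis [measurable (raw)]:
  assumes [measurable]: "f \<in> borel_measurable M"
  shows "(\<lambda>x. cis (f x)) \<in> borel_measurable M"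
  unfolding cis_conv_exp by measurable

lemma borel_measurable_cnj [measurable (raw)]:
  assumes "f \<in> borel_measurable M"
  shows "(\<lambda>x. cnj (f x)) \<in> borel_measurable M"
  using measurable_compose[OF assms borel_measurable_continuous_onI[of cnj]]
  by (auto intro: continuous_intros)

lemma integrable_product_dominated:
  fixes f :: "'a \<times> 'b \<Rightarrow> 'c::{banach, second_countable_topology}" and g h :: "_ \<Rightarrow> real"
  assumes "sigma_finite_measure M" "sigma_finite_measure N"
    and [measurable]: "f \<in> borel_measurable (M \<Otimes>\<^sub>M N)"
    and g: "integrable M g" and h: "integrable N h"
    and b: "\<And>x y. x \<in> space M \<Longrightarrow> y \<in> space N \<Longrightarrow> norm (f (x, y)) \<le> g x * h y"
  shows "integrable (M \<Otimes>\<^sub>M N) f"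
proof (rule integrableI_bounded)
  interpret M: sigma_finite_measure M by fact
  interpret N: sigma_finite_measure N by fact
  interpret pair_sigma_finite M N ..
  have [measurable]: "g \<in> borel_measurable M" "h \<in> borel_measurable N" using g h by auto
  have "(\<integral>\<^sup>+p. ennreal (norm (f p)) \<partial>(M \<Otimes>\<^sub>M N)) \<le> (\<integral>\<^sup>+p. ennreal (norm (g (fst p))) * ennreal (norm (h (snd p))) \<partial>(M \<Otimes>\<^sub>M N))"
  proof (rule nn_integral_mono)
    fix p assume "p \<in> space (M \<Otimes>\<^sub>M N)"
    then have "norm (f p) \<le> g (fst p) * h (snd p)" using b[of "fst p" "snd p"] by (auto simp: space_pair_measure)
    also have "\<dots> \<le> norm (g (fst p)) * norm (h (snd p))" by (metis abs_ge_self abs_mult real_norm_def)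
    finally show "ennreal (norm (f p)) \<le> ennreal (norm (g (fst p))) * ennreal (norm (h (snd p)))"
      by (simp add: ennreal_mult[symmetric] ennreal_leI)
  qed
  also have "\<dots> = (\<integral>\<^sup>+x. \<integral>\<^sup>+y. ennreal (norm (g x)) * ennreal (norm (h y)) \<partial>N \<partial>M)"
    by (subst N.nn_integral_fst[symmetric]) auto
  also have "\<dots> = (\<integral>\<^sup>+x. ennreal (norm (g x)) \<partial>M) * (\<integral>\<^sup>+y. ennreal (norm (h y)) \<partial>N)"
    by (simp add: nn_integral_cmult nn_integral_multc)
  also have "\<dots> < \<infinity>"
    using g h by (auto simp: integrable_iff_bounded ennreal_mult_less_top)
  finally show "(\<integral>\<^sup>+p. ennreal (norm (f p)) \<partial>(M \<Otimes>\<^sub>M N)) < \<infinity>" .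
qed fact

lemma Fubini_dominated:
  fixes f :: "'a \<Rightarrow> 'b \<Rightarrow> 'c::{banach, second_countable_topology}" and g h :: "_ \<Rightarrow> real"
  assumes "sigma_finite_measure M" "sigma_finite_measure N"
    and "case_prod f \<in> borel_measurable (M \<Otimes>\<^sub>M N)"
    and "integrable M g" and "integrable N h"
    and "\<And>x y. x \<in> space M \<Longrightarrow> y \<in> space N \<Longrightarrow> norm (f x y) \<le> g x * h y"
  shows "(\<integral>x. \<integral>y. f x y \<partial>N \<partial>M) = (\<integral>y. \<integral>x. f x y \<partial>M \<partial>N)"
proof -
  interpret M: sigma_finite_measure M by fact
  interpret N: sigma_finite_measure N by fact
  interpret pair_sigma_finite M N ..
  have "integrable (M \<Otimes>\<^sub>M N) (case_prod f)"
    by (rule integrable_product_dominated[OF assms(1,2,3,4,5)]) (use assms(6) in auto)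
  then show ?thesis by (rule Fubini_integral[symmetric])
qed

definition fourier :: "(real \<Rightarrow> complex) \<Rightarrow> real \<Rightarrow> complex" where
  "fourier h t = (\<integral>x. cis (x * t) * h x \<partial>lborel)"

lemma fourier_measurable [measurable]:
  assumes [measurable]: "h \<in> borel_measurable borel"
  shows "fourier h \<in> borel_measurable borel"
  unfolding fourier_def[abs_def] by measurable

lemma norm_fourier_le: "norm (fourier h t) \<le> (\<integral>x. norm (h x) \<partial>lborel)"
  unfolding fourier_def by (rule order_trans[OF integral_norm_bound]) (simp add: norm_mult)

lemma gaussian_fourier:
  "(\<integral>x. of_real (std_normal_density x) * cis (u * x) \<partial>lborel) = of_real (exp (- u\<^sup>2 / 2))"
proof -
  have "char std_normal_distribution u = (\<integral>x. std_normal_density x *\<^sub>R cis (u * x) \<partial>lborel)"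
    unfolding char_def std_normal_density_def cis_conv_exp
    by (subst integral_density) (auto simp: std_normal_density_def)
  then show ?thesis
    unfolding char_std_normal_distribution by (simp add: scaleR_conv_of_real)
qed

lemma gaussian_fourier_scaled:
  assumes "e > 0"
  shows "(\<integral>x. of_real (std_normal_density (e * x)) * cis (u * x) \<partial>lborel) = of_real (exp (- (u/e)\<^sup>2 / 2) / e)"
proof -
  have "(\<integral>x. of_real (std_normal_density x) * cis (u / e * x) \<partial>lborel)
     = \<bar>e\<bar> *\<^sub>R (\<integral>x. of_real (std_normal_density (0 + e * x)) * cis (u / e * (0 + e * x)) \<partial>lborel)"
    using assms by (intro lborel_integral_real_affine) auto
  also have "(\<lambda>x. of_real (std_normal_density (0 + e * x)) * cis (u / e * (0 + e * x)))
     = (\<lambda>x. of_real (std_normal_density (e * x)) * cis (u * x) :: complex)"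
    using assms by (auto simp: fun_eq_iff)
  finally show ?thesis using assms unfolding gaussian_fourier
    by (simp add: scaleR_conv_of_real field_simps)
qed

lemma integrable_std_normal_scaled:
  assumes "e \<noteq> 0" shows "integrable lborel (\<lambda>t. std_normal_density (e * t))"
  using lborel_integrable_real_affine[of std_normal_density e 0] assms integrable_normal_density[of 1 0]
  by (simp add: std_normal_density_def)

lemma integrable_exp_square: "integrable lborel (\<lambda>x::real. exp (- x\<^sup>2 / 2))"
  and integral_exp_square: "(\<integral>x. exp (- x\<^sup>2 / 2) \<partial>(lborel :: real measure)) = sqrt (2 * pi)"
proof -
  have eq: "(\<lambda>x::real. exp (- x\<^sup>2 / 2)) = (\<lambda>x. sqrt (2 * pi) * std_normal_density x)"
    by (auto simp: std_normal_density_def fun_eq_iff)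
  show "integrable lborel (\<lambda>x::real. exp (- x\<^sup>2 / 2))"
    unfolding eq by (intro integrable_mult_right) auto
  show "(\<integral>x. exp (- x\<^sup>2 / 2) \<partial>(lborel :: real measure)) = sqrt (2 * pi)"
    unfolding eq by (simp add: integral_normal_density)
qed

context
  fixes h :: "real \<Rightarrow> complex" and B :: real
  assumes int: "integrable lborel h" and bound: "\<And>x. norm (h x) \<le> B" and cont: "continuous_on UNIV h"
begin

lemma h_measurable [measurable]: "h \<in> borel_measurable borel"
  using int by auto

abbreviation smear :: "real \<Rightarrow> real \<Rightarrow> complex" where
  "smear e x \<equiv> \<integral>y. cnj (h (x + e * y)) * of_real (exp (- y\<^sup>2 / 2)) \<partial>lborel"

text \<open>With a Gaussian factor the square of the transform is absolutely integrable as a triple integral, so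
  the integration over the frequency can be done first. It produces a Gaussian of width \<open>e\<close> in the
  difference of the two remaining variables.\<close>

lemma fourier_gaussian_regularization:
  assumes e: "e > 0"
  shows "(\<integral>t. of_real (std_normal_density (e * t) * (norm (fourier h t))\<^sup>2) \<partial>lborel)
    = (\<integral>x. h x * smear e x \<partial>lborel)"
proof -
  define C where "C = (\<integral>x. norm (h x) \<partial>lborel)"
  have C: "norm (fourier h t) \<le> C" for t unfolding C_def by (rule norm_fourier_le)
  have C0: "C \<ge> 0" using C[of 0] norm_ge_zero order_trans by blast
  let ?\<phi> = "\<lambda>t. complex_of_real (std_normal_density (e * t))"
  have \<phi>: "integrable lborel (\<lambda>t. std_normal_density (e * t))" using e by (intro integrable_std_normal_scaled) simp
  have pos: "std_normal_density t \<ge> 0" for t by (simp add: std_normal_density_def)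
  have "(\<integral>t. of_real (std_normal_density (e * t) * (norm (fourier h t))\<^sup>2) \<partial>lborel)
      = (\<integral>t. (\<integral>x. ?\<phi> t * cnj (fourier h t) * cis (x * t) * h x \<partial>lborel) \<partial>lborel)"
  proof (rule Bochner_Integration.integral_cong[OF refl])
    fix t
    have "of_real (std_normal_density (e * t) * (norm (fourier h t))\<^sup>2) = ?\<phi> t * cnj (fourier h t) * fourier h t"
      unfolding of_real_mult complex_norm_square by (simp only: mult_ac)
    also have "\<dots> = (\<integral>x. ?\<phi> t * cnj (fourier h t) * (cis (x * t) * h x) \<partial>lborel)"
      unfolding fourier_def[of h t] by simp
    finally show "of_real (std_normal_density (e * t) * (norm (fourier h t))\<^sup>2)
       = (\<integral>x. ?\<phi> t * cnj (fourier h t) * cis (x * t) * h x \<partial>lborel)" by (simp add: mult_ac)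
  qed
  also have "\<dots> = (\<integral>x. (\<integral>t. ?\<phi> t * cnj (fourier h t) * cis (x * t) * h x \<partial>lborel) \<partial>lborel)"
  proof (rule Fubini_dominated)
    show "integrable lborel (\<lambda>t. C * std_normal_density (e * t))" using \<phi> by simp
    show "integrable lborel (\<lambda>x. norm (h x))" using int by simp
    fix t x :: real
    have "norm (?\<phi> t * cnj (fourier h t) * cis (x * t) * h x) = std_normal_density (e * t) * norm (fourier h t) * norm (h x)"
      by (simp add: norm_mult pos)
    also have "\<dots> \<le> std_normal_density (e * t) * C * norm (h x)"
      using C[of t] pos by (intro mult_mono mult_left_mono) (auto simp: C0)
    finally show "norm (?\<phi> t * cnj (fourier h t) * cis (x * t) * h x) \<le> C * std_normal_density (e * t) * norm (h x)"
      by (simp add: mult_ac)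
  qed (auto intro: lborel.sigma_finite_measure_axioms)
  also have "\<dots> = (\<integral>x. h x * (\<integral>t. ?\<phi> t * cis (x * t) * cnj (fourier h t) \<partial>lborel) \<partial>lborel)"
  proof (rule Bochner_Integration.integral_cong[OF refl])
    fix x
    have "(\<integral>t. ?\<phi> t * cnj (fourier h t) * cis (x * t) * h x \<partial>lborel)
      = (\<integral>t. h x * (?\<phi> t * cis (x * t) * cnj (fourier h t)) \<partial>lborel)"
      by (simp add: mult_ac)
    then show "(\<integral>t. ?\<phi> t * cnj (fourier h t) * cis (x * t) * h x \<partial>lborel)
      = h x * (\<integral>t. ?\<phi> t * cis (x * t) * cnj (fourier h t) \<partial>lborel)" by simp
  qed
  also have "\<dots> = (\<integral>x. h x * smear e x \<partial>lborel)"
  proof (rule Bochner_Integration.integral_cong[OF refl])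
    fix x
    have "(\<integral>t. ?\<phi> t * cis (x * t) * cnj (fourier h t) \<partial>lborel)
      = (\<integral>t. (\<integral>y. ?\<phi> t * cis ((x - y) * t) * cnj (h y) \<partial>lborel) \<partial>lborel)"
    proof (rule Bochner_Integration.integral_cong[OF refl])
      fix t
      have "cnj (fourier h t) = (\<integral>y. cis (- y * t) * cnj (h y) \<partial>lborel)"
      proof -
        have "cnj (fourier h t) = (\<integral>y. cnj (cis (y * t) * h y) \<partial>lborel)"
          unfolding fourier_def by (rule Bochner_Integration.integral_cnj[symmetric])
        then show ?thesis by (simp only: complex_cnj_mult cis_cnj mult_minus_left)
      qed
      then have "?\<phi> t * cis (x * t) * cnj (fourier h t)
        = (\<integral>y. ?\<phi> t * cis (x * t) * (cis (- y * t) * cnj (h y)) \<partial>lborel)" by simp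
      also have "(\<lambda>y. ?\<phi> t * cis (x * t) * (cis (- y * t) * cnj (h y))) = (\<lambda>y. ?\<phi> t * cis ((x - y) * t) * cnj (h y))"
      proof
        fix y
        have "cis (x * t) * cis (- y * t) = cis ((x - y) * t)" by (simp add: cis_mult algebra_simps)
        then show "?\<phi> t * cis (x * t) * (cis (- y * t) * cnj (h y)) = ?\<phi> t * cis ((x - y) * t) * cnj (h y)"
          by (metis mult.assoc)
      qed
      finally show "?\<phi> t * cis (x * t) * cnj (fourier h t) = (\<integral>y. ?\<phi> t * cis ((x - y) * t) * cnj (h y) \<partial>lborel)" .
    qed
    also have "\<dots> = (\<integral>y. (\<integral>t. ?\<phi> t * cis ((x - y) * t) * cnj (h y) \<partial>lborel) \<partial>lborel)"
    proof (rule Fubini_dominated)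
      show "integrable lborel (\<lambda>t. std_normal_density (e * t))" using \<phi> by simp
      show "integrable lborel (\<lambda>x. norm (h x))" using int by simp
    qed (auto intro: lborel.sigma_finite_measure_axioms simp: norm_mult pos)
    also have "\<dots> = (\<integral>y. of_real (exp (- ((x - y)/e)\<^sup>2 / 2) / e) * cnj (h y) \<partial>lborel)"
      using gaussian_fourier_scaled[OF e] by simp
    also have "\<dots> = \<bar>e\<bar> *\<^sub>R (\<integral>y. of_real (exp (- ((x - (x + e * y))/e)\<^sup>2 / 2) / e) * cnj (h (x + e * y)) \<partial>lborel)"
      using e by (intro lborel_integral_real_affine) auto
    also have "(\<lambda>y. of_real (exp (- ((x - (x + e * y))/e)\<^sup>2 / 2) / e) * cnj (h (x + e * y)))
       = (\<lambda>y. of_real (1/e) * (cnj (h (x + e * y)) * of_real (exp (- y\<^sup>2 / 2))))"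
      using e by (auto simp: fun_eq_iff)
    also have "\<bar>e\<bar> *\<^sub>R (\<integral>y. of_real (1/e) * (cnj (h (x + e * y)) * of_real (exp (- y\<^sup>2 / 2))) \<partial>lborel)
       = smear e x"
      using e by (subst integral_mult_right_zero) (simp add: scaleR_conv_of_real flip: of_real_mult)
    finally show "h x * (\<integral>t. ?\<phi> t * cis (x * t) * cnj (fourier h t) \<partial>lborel)
      = h x * smear e x" by simp
  qed
  finally show ?thesis .
qed

text \<open>As the width tends to \<open>0\<close> the Gaussian average tends to the value of \<open>h\<close> by continuity.\<close>

lemma fourier_regularization_limit:
  assumes e: "e \<longlonglongrightarrow> 0"
  shows "(\<lambda>n. \<integral>x. h x * smear (e n) x \<partial>lborel)
    \<longlonglongrightarrow> of_real (sqrt (2 * pi) * (\<integral>x. (norm (h x))\<^sup>2 \<partial>lborel))"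
proof -
  have B: "B \<ge> 0" using bound[of 0] norm_ge_zero order_trans by blast
  have inner: "(\<lambda>n. smear (e n) x)
      \<longlonglongrightarrow> (\<integral>y. cnj (h x) * of_real (exp (- y\<^sup>2 / 2)) \<partial>lborel)" for x
  proof (rule integral_dominated_convergence[where w = "\<lambda>y. B * exp (- y\<^sup>2 / 2)"])
    show "integrable lborel (\<lambda>y. B * exp (- y\<^sup>2 / 2))" using integrable_exp_square by simp
    show "AE y in lborel. (\<lambda>n. cnj (h (x + e n * y)) * of_real (exp (- y\<^sup>2 / 2))) \<longlonglongrightarrow> cnj (h x) * of_real (exp (- y\<^sup>2 / 2))"
    proof (rule AE_I2)
      fix y
      have "(\<lambda>n. x + e n * y) \<longlonglongrightarrow> x + 0 * y" using e by (intro tendsto_intros)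
      moreover have "isCont h x" using cont by (simp add: continuous_on_eq_continuous_at)
      ultimately have "(\<lambda>n. h (x + e n * y)) \<longlonglongrightarrow> h x"
        using isCont_tendsto_compose[of x h] by simp
      then show "(\<lambda>n. cnj (h (x + e n * y)) * of_real (exp (- y\<^sup>2 / 2))) \<longlonglongrightarrow> cnj (h x) * of_real (exp (- y\<^sup>2 / 2))"
        by (intro tendsto_intros)
    qed
    show "AE y in lborel. norm (cnj (h (x + e n * y)) * of_real (exp (- y\<^sup>2 / 2))) \<le> B * exp (- y\<^sup>2 / 2)" for n
      using bound by (intro AE_I2) (auto simp: norm_mult intro!: mult_right_mono)
  qed auto
  have inner_bound: "norm (smear (e n) x) \<le> B * sqrt (2 * pi)" for x n
  proof -
    have "norm (smear (e n) x) \<le> (\<integral>y. B * exp (- y\<^sup>2 / 2) \<partial>lborel)"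
    proof (rule Bochner_Integration.integral_norm_bound_integral)
      show w: "integrable lborel (\<lambda>y. B * exp (- y\<^sup>2 / 2))" using integrable_exp_square by simp
      show le: "norm (cnj (h (x + e n * y)) * of_real (exp (- y\<^sup>2 / 2))) \<le> B * exp (- y\<^sup>2 / 2)" for y
        using bound by (auto simp: norm_mult intro!: mult_right_mono)
      show "integrable lborel (\<lambda>y. cnj (h (x + e n * y)) * of_real (exp (- y\<^sup>2 / 2)))"
        using order_trans[OF le abs_ge_self] by (intro Bochner_Integration.integrable_bound[OF w]) (auto intro!: AE_I2)
    qed
    then show ?thesis by (simp only: integral_mult_right_zero integral_exp_square)
  qed
  have "(\<lambda>n. \<integral>x. h x * smear (e n) x \<partial>lborel)
    \<longlonglongrightarrow> (\<integral>x. h x * (\<integral>y. cnj (h x) * of_real (exp (- y\<^sup>2 / 2)) \<partial>lborel) \<partial>lborel)"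
  proof (rule integral_dominated_convergence[where w = "\<lambda>x. norm (h x) * (B * sqrt (2 * pi))"])
    show "integrable lborel (\<lambda>x. norm (h x) * (B * sqrt (2 * pi)))" using int by simp
    show "AE x in lborel. (\<lambda>n. h x * smear (e n) x)
        \<longlonglongrightarrow> h x * (\<integral>y. cnj (h x) * of_real (exp (- y\<^sup>2 / 2)) \<partial>lborel)"
      by (intro AE_I2 tendsto_intros inner)
    show "AE x in lborel. norm (h x * smear (e n) x) \<le> norm (h x) * (B * sqrt (2 * pi))" for n
      using inner_bound by (intro AE_I2) (auto simp: norm_mult intro!: mult_left_mono)
  qed auto
  also have "(\<integral>x. h x * (\<integral>y. cnj (h x) * of_real (exp (- y\<^sup>2 / 2)) \<partial>lborel) \<partial>lborel)
     = (\<integral>x. of_real (sqrt (2 * pi) * (norm (h x))\<^sup>2) \<partial>lborel)"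
  proof (rule Bochner_Integration.integral_cong[OF refl])
    fix x
    have "(\<integral>y. cnj (h x) * complex_of_real (exp (- y\<^sup>2 / 2)) \<partial>lborel) = cnj (h x) * of_real (sqrt (2 * pi))"
      by (simp only: integral_mult_right_zero integral_complex_of_real integral_exp_square)
    then show "h x * (\<integral>y. cnj (h x) * of_real (exp (- y\<^sup>2 / 2)) \<partial>lborel) = of_real (sqrt (2 * pi) * (norm (h x))\<^sup>2)"
      unfolding of_real_mult complex_norm_square by (simp only: mult_ac)
  qed
  also have "\<dots> = of_real (sqrt (2 * pi) * (\<integral>x. (norm (h x))\<^sup>2 \<partial>lborel))"
    by (simp only: integral_complex_of_real integral_mult_right_zero)
  finally show ?thesis .
qed

text \<open>For bounded continuous integrable \<open>h\<close>: both sides of the regularized identity converge, the left one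
  monotonically.\<close>

theorem plancherel:
  "energy lborel (fourier h) = ennreal (2 * pi) * energy lborel h"
proof -
  define e where "e = (\<lambda>n. 1 / real (Suc n))"
  have e: "e n > 0" for n by (simp add: e_def)
  have e0: "e \<longlonglongrightarrow> 0" unfolding e_def by real_asymp
  define \<phi> where "\<phi> = (\<lambda>n t. std_normal_density (e n * t) * (norm (fourier h t))\<^sup>2)"
  have [measurable]: "\<phi> n \<in> borel_measurable borel" for n unfolding \<phi>_def by measurable
  have \<phi>0: "\<phi> n t \<ge> 0" for n t by (simp add: \<phi>_def std_normal_density_def)
  define C where "C = (\<integral>x. norm (h x) \<partial>lborel)"
  have C: "norm (fourier h t) \<le> C" for t unfolding C_def by (rule norm_fourier_le)
  have int\<phi>: "integrable lborel (\<phi> n)" for n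
  proof (rule Bochner_Integration.integrable_bound)
    show "integrable lborel (\<lambda>t. std_normal_density (e n * t) * C\<^sup>2)"
      using integrable_std_normal_scaled[of "e n"] e[of n] by simp
    show "AE t in lborel. norm (\<phi> n t) \<le> norm (std_normal_density (e n * t) * C\<^sup>2)"
      using C by (intro AE_I2) (auto simp: \<phi>_def std_normal_density_def abs_mult intro!: mult_left_mono divide_right_mono power_mono)
  qed simp
  have hint: "integrable lborel (\<lambda>x. (norm (h x))\<^sup>2)"
  proof (rule Bochner_Integration.integrable_bound)
    show "integrable lborel (\<lambda>x. B * norm (h x))" using int by simp
    show "AE x in lborel. norm ((norm (h x))\<^sup>2) \<le> norm (B * norm (h x))"
      using bound by (intro AE_I2) (auto simp: power2_eq_square abs_mult intro!: mult_right_mono order_trans[OF bound])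
  qed simp
  have "(\<lambda>n. of_real (\<integral>t. \<phi> n t \<partial>lborel)) \<longlonglongrightarrow> complex_of_real (sqrt (2 * pi) * (\<integral>x. (norm (h x))\<^sup>2 \<partial>lborel))"
    using fourier_regularization_limit[OF e0]
    unfolding fourier_gaussian_regularization[OF e, symmetric] \<phi>_def integral_complex_of_real .
  then have lim: "(\<lambda>n. (\<integral>t. \<phi> n t \<partial>lborel)) \<longlonglongrightarrow> sqrt (2 * pi) * (\<integral>x. (norm (h x))\<^sup>2 \<partial>lborel)"
    by (simp only: tendsto_of_real_iff)
  have lim1: "(\<lambda>n. \<integral>\<^sup>+t. ennreal (\<phi> n t) \<partial>lborel) \<longlonglongrightarrow> (\<integral>\<^sup>+t. ennreal ((norm (fourier h t))\<^sup>2 / sqrt (2 * pi)) \<partial>lborel)"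
  proof (rule nn_integral_LIMSEQ)
    show "incseq (\<lambda>n t. ennreal (\<phi> n t))"
    proof (intro incseq_SucI le_funI ennreal_leI)
      fix n t
      have "(e (Suc n) * t)\<^sup>2 \<le> (e n * t)\<^sup>2"
        unfolding power_mult_distrib e_def by (intro mult_right_mono power_mono divide_left_mono) auto
      then show "\<phi> n t \<le> \<phi> (Suc n) t"
        unfolding \<phi>_def std_normal_density_def by (intro mult_right_mono mult_left_mono) auto
    qed
    show "(\<lambda>n. ennreal (\<phi> n t)) \<longlonglongrightarrow> ennreal ((norm (fourier h t))\<^sup>2 / sqrt (2 * pi))" for t
    proof (rule tendsto_ennrealI)
      have "(\<lambda>n. \<phi> n t) \<longlonglongrightarrow> 1 / sqrt (2 * pi) * exp (- (0 * t)\<^sup>2 / 2) * (norm (fourier h t))\<^sup>2"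
        unfolding \<phi>_def std_normal_density_def by (intro tendsto_intros e0) auto
      then show "(\<lambda>n. \<phi> n t) \<longlonglongrightarrow> (norm (fourier h t))\<^sup>2 / sqrt (2 * pi)" by simp
    qed
  qed auto
  have "(\<lambda>n. \<integral>\<^sup>+t. ennreal (\<phi> n t) \<partial>lborel) \<longlonglongrightarrow> ennreal (sqrt (2 * pi) * (\<integral>x. (norm (h x))\<^sup>2 \<partial>lborel))"
    using tendsto_ennrealI[OF lim] by (simp add: nn_integral_eq_integral[OF int\<phi>] \<phi>0)
  from LIMSEQ_unique[OF lim1 this]
  have 1: "(\<integral>\<^sup>+t. ennreal ((norm (fourier h t))\<^sup>2 / sqrt (2 * pi)) \<partial>lborel) = ennreal (sqrt (2 * pi) * (\<integral>x. (norm (h x))\<^sup>2 \<partial>lborel))" .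
  have "energy lborel (fourier h)
      = (\<integral>\<^sup>+t. ennreal (sqrt (2 * pi)) * ennreal ((norm (fourier h t))\<^sup>2 / sqrt (2 * pi)) \<partial>lborel)"
    by (simp add: ennreal_mult[symmetric])
  also have "\<dots> = ennreal (sqrt (2 * pi)) * ennreal (sqrt (2 * pi) * (\<integral>x. (norm (h x))\<^sup>2 \<partial>lborel))"
    by (subst nn_integral_cmult) (simp_all add: 1)
  also have "\<dots> = ennreal (2 * pi) * ennreal (\<integral>x. (norm (h x))\<^sup>2 \<partial>lborel)"
    by (simp add: ennreal_mult[symmetric] mult.assoc[symmetric])
  also have "ennreal (\<integral>x. (norm (h x))\<^sup>2 \<partial>lborel) = energy lborel h"
    by (rule nn_integral_eq_integral[symmetric]) (use hint in auto)
  finally show ?thesis .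
qed

end

section \<open>Gamma, Laplace and Cauchy integrals\<close>

text \<open>The substitution \<open>u = c x\<^sup>g\<close> in Euler's integral.\<close>

lemma nn_integral_powr_exp:
  fixes a c g :: real
  assumes a: "a > 0" and c: "c > 0" and g: "g > 0"
  shows "(\<integral>\<^sup>+x. ennreal (x powr (a - 1) * exp (- (c * x powr g))) * indicator {0<..} x \<partial>lborel)
    = ennreal (Gamma (a / g) / g * c powr (- (a / g)))"
proof -
  define f where "f = (\<lambda>u::real. u powr (a / g - 1) / exp u)"
  define h where "h = (\<lambda>x::real. c * x powr g)"
  define h' where "h' = (\<lambda>x::real. c * (g * x powr (g - 1)))"
  have ag: "a / g > 0" using a g by simp
  have img: "h ` {0<..} = {0<..}"
  proof (intro equalityI subsetI)
    fix y :: real assume "y \<in> {0<..}"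
    then have "y = h ((y / c) powr (1 / g))" "(y / c) powr (1 / g) > 0"
      using c g by (auto simp: h_def powr_powr)
    then show "y \<in> h ` {0<..}" by blast
  qed (use c in \<open>auto simp: h_def\<close>)
  have inj: "inj_on h {0<..}"
  proof (rule inj_onI)
    fix x y assume "x \<in> {0<..}" "y \<in> {0<..}" "h x = h y"
    then have "(x powr g) powr (1/g) = (y powr g) powr (1/g)" "x > 0" "y > 0" using c by (auto simp: h_def)
    then show "x = y" using g by (simp add: powr_powr)
  qed
  have der: "(h has_field_derivative h' x) (at x within {0<..})" if "x \<in> {0<..}" for x
    using that unfolding h_def h'_def by (auto intro!: derivative_eq_intros)
  have fi: "(f has_integral Gamma (a / g)) {0<..}"
  proof -
    have "((\<lambda>t. if t \<in> {0<..} then f t else 0) has_integral Gamma (a / g)) {0..}"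
      using has_integral_spike[of "{0}" "{0..}" "\<lambda>t. if t \<in> {0<..} then f t else 0" f] Gamma_integral_real[OF ag]
      by (auto simp: f_def)
    then show ?thesis by (subst (asm) has_integral_restrict) auto
  qed
  have fabs: "f absolutely_integrable_on {0<..}"
    by (rule nonnegative_absolutely_integrable_1) (use fi in \<open>auto simp: f_def\<close>)
  have "(\<lambda>x. \<bar>h' x\<bar> * f (h x)) absolutely_integrable_on {0<..} \<and> integral {0<..} (\<lambda>x. \<bar>h' x\<bar> * f (h x)) = Gamma (a / g)"
    using has_absolute_integral_change_of_variables_1'[of "{0<..}" h h' f "Gamma (a / g)", OF _ der inj] fabs fi
    unfolding img by (auto simp: integral_unique)
  then have "((\<lambda>x. \<bar>h' x\<bar> * f (h x)) has_integral Gamma (a / g)) {0<..}"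
    by (metis has_integral_integrable_integral set_lebesgue_integral_eq_integral(1))
  then have "((\<lambda>x. (1 / g * c powr (- (a / g))) * (\<bar>h' x\<bar> * f (h x))) has_integral (1 / g * c powr (- (a / g))) * Gamma (a / g)) {0<..}"
    by (rule has_integral_mult_right)
  then have "((\<lambda>x. x powr (a - 1) * exp (- (c * x powr g))) has_integral (1 / g * c powr (- (a / g))) * Gamma (a / g)) {0<..}"
  proof (rule has_integral_eq[rotated])
    fix x :: real assume "x \<in> {0<..}"
    then have x: "x > 0" by simp
    have "f (h x) = c powr (a / g - 1) * x powr (a - g) / exp (c * x powr g)"
      using x c g by (simp add: f_def h_def powr_mult powr_powr right_diff_distrib)
    moreover have "\<bar>h' x\<bar> = g * c powr 1 * x powr (g - 1)" using c g by (simp add: h'_def abs_mult)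
    ultimately have "(1 / g * c powr (- (a / g))) * (\<bar>h' x\<bar> * f (h x))
       = (c powr (- (a / g)) * c powr 1 * c powr (a / g - 1)) * (x powr (g - 1) * x powr (a - g)) * exp (- (c * x powr g))"
      using g by (simp add: exp_minus field_simps)
    also have "c powr (- (a / g)) * c powr 1 * c powr (a / g - 1) = 1"
      using c by (simp only: powr_add[symmetric]) simp
    also have "x powr (g - 1) * x powr (a - g) = x powr (a - 1)"
      using x by (simp only: powr_add[symmetric]) simp
    finally show "(1 / g * c powr (- (a / g))) * (\<bar>h' x\<bar> * f (h x)) = x powr (a - 1) * exp (- (c * x powr g))" by simp
  qed
  from nn_integral_has_integral_lebesgue[OF _ this]
  have "(\<integral>\<^sup>+x. ennreal (indicator {0<..} x * (x powr (a - 1) * exp (- (c * x powr g)))) \<partial>lborel)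
    = ennreal ((1 / g * c powr (- (a / g))) * Gamma (a / g))" by simp
  moreover have "ennreal (indicator {0<..} x * (x powr (a - 1) * exp (- (c * x powr g))))
     = ennreal (x powr (a - 1) * exp (- (c * x powr g))) * indicator {0<..} x" for x
    by (auto split: split_indicator)
  ultimately show ?thesis by (simp add: mult_ac)
qed

lemma set_integrable_power_exp:
  assumes "c > 0"
  shows "set_integrable lborel {0<..} (\<lambda>x::real. x ^ n * exp (- (c * x)))"
  unfolding set_integrable_def
proof (rule integrableI_bounded)
  have "(\<integral>\<^sup>+x. ennreal (norm (indicat_real {0<..} x *\<^sub>R (x ^ n * exp (- (c * x))))) \<partial>lborel)
    = (\<integral>\<^sup>+x. ennreal (x powr (real (Suc n) - 1) * exp (- (c * x powr 1))) * indicator {0<..} x \<partial>lborel)"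
    by (intro nn_integral_cong) (auto simp: powr_realpow split: split_indicator)
  also have "\<dots> < \<infinity>" using assms by (subst nn_integral_powr_exp) auto
  finally show "(\<integral>\<^sup>+x. ennreal (norm (indicat_real {0<..} x *\<^sub>R (x ^ n * exp (- (c * x))))) \<partial>lborel) < \<infinity>" .
qed simp

lemma borel_measurable_exp_complex [measurable (raw)]:
  assumes "f \<in> borel_measurable M"
  shows "(\<lambda>x. exp (f x) :: complex) \<in> borel_measurable M"
  using measurable_compose[OF assms borel_measurable_continuous_onI[of "exp :: complex \<Rightarrow> complex"]]
  by (simp add: continuous_on_exp)

text \<open>The integral of the derivative of \<open>x\<^sup>n exp (- z x)\<close> gives a recursion in \<open>n\<close>.\<close>

lemma laplace_power:
  fixes z :: complex
  assumes z: "Re z > 0"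
  shows "set_integrable lborel {0<..} (\<lambda>x. of_real x ^ n * exp (- (z * of_real x)))"
    and "(LINT x:{0<..}|lborel. of_real x ^ n * exp (- (z * of_real x))) = fact n / z ^ Suc n"
proof -
  define E where "E = (\<lambda>n x. of_real x ^ n * exp (- (z * of_real x)))"
  have nE: "norm (E n x) = x ^ n * exp (- (Re z * x))" if "x > 0" for n and x :: real
    using that by (simp add: E_def norm_mult norm_power)
  have [measurable]: "E n \<in> borel_measurable borel" for n
    unfolding E_def by measurable
  have I: "set_integrable lborel {0<..} (E n)" for n
    unfolding set_integrable_def
  proof (rule Bochner_Integration.integrable_bound)
    show "integrable lborel (\<lambda>x. indicat_real {0<..} x *\<^sub>R (x ^ n * exp (- (Re z * x))))"
      using set_integrable_power_exp[OF z] unfolding set_integrable_def .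
    show "AE x in lborel. norm (indicat_real {0<..} x *\<^sub>R E n x) \<le> norm (indicat_real {0<..} x *\<^sub>R (x ^ n * exp (- (Re z * x))))"
      using nE by (intro AE_I2) (auto split: split_indicator)
  qed simp
  then show "set_integrable lborel {0<..} (\<lambda>x. of_real x ^ n * exp (- (z * of_real x)))"
    unfolding E_def .
  have lim: "((\<lambda>x. E n x) \<longlongrightarrow> 0) at_top" for n
  proof (rule Lim_null_comparison)
    show "\<forall>\<^sub>F x in at_top. norm (E n x) \<le> x ^ n * exp (- (Re z * x))"
      using eventually_gt_at_top[of 0] by eventually_elim (simp add: nE)
    show "((\<lambda>x. x ^ n * exp (- (Re z * x))) \<longlongrightarrow> 0) at_top" using z by real_asymp
  qed
  have der: "(E n has_vector_derivative (of_nat n * E (n - 1) x - z * E n x)) (at x)" for n x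
  proof -
    have "((\<lambda>w::complex. w ^ n * exp (- (z * w))) has_field_derivative
       (of_nat n * (of_real x ^ (n - 1) * exp (- (z * of_real x))) - z * (of_real x ^ n * exp (- (z * of_real x))))) (at (of_real x))"
      by (auto intro!: derivative_eq_intros simp: algebra_simps)
    from has_vector_derivative_real_field[OF this] show ?thesis unfolding E_def by simp
  qed
  have rec: "(LINT x:{0<..}|lborel. of_nat n * E (n - 1) x - z * E n x) = - E n 0" for n
  proof -
    have cont: "isCont (E n) x" for n x
      unfolding E_def by (intro continuous_intros)
    have "(LBINT x=0..\<infinity>. of_nat n * E (n - 1) x - z * E n x) = 0 - E n 0"
    proof (rule interval_integral_FTC_integrable[where F = "E n"])
      show "set_integrable lborel (einterval 0 \<infinity>) (\<lambda>x. of_nat n * E (n - 1) x - z * E n x)"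
        using I[of n] I[of "n - 1"] by (simp add: zero_ereal_def set_integral_diff(1))
      have "(E n \<longlongrightarrow> E n 0) (at_right 0)"
        using cont[of 0 n] by (simp add: isCont_def filterlim_at_split)
      then show "((E n \<circ> real_of_ereal) \<longlongrightarrow> E n 0) (at_right 0)"
        by (simp add: zero_ereal_def ereal_tendsto_simps)
      show "((E n \<circ> real_of_ereal) \<longlongrightarrow> 0) (at_left \<infinity>)"
        using lim by (simp add: ereal_tendsto_simps)
      show "isCont (\<lambda>x. of_nat n * E (n - 1) x - z * E n x) x" for x
        by (intro continuous_intros cont)
    qed (use der in auto)
    then show ?thesis by (simp add: interval_lebesgue_integral_0_infty)
  qed
  have z0: "z \<noteq> 0" using z by auto
  have step: "of_nat n * (LINT x:{0<..}|lborel. E (n - 1) x) - z * (LINT x:{0<..}|lborel. E n x) = - E n 0" for n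
  proof -
    have "(LINT x:{0<..}|lborel. of_nat n * E (n - 1) x - z * E n x)
      = (LINT x:{0<..}|lborel. of_nat n * E (n - 1) x) - (LINT x:{0<..}|lborel. z * E n x)"
      using I[of n] I[of "n - 1"] by (intro set_integral_diff(2)) auto
    then show ?thesis using rec[of n] by simp
  qed
  have "(LINT x:{0<..}|lborel. E n x) = fact n / z ^ Suc n"
  proof (induction n)
    case 0
    show ?case using step[of 0] z0 by (simp add: E_def field_simps)
  next
    case (Suc n)
    have "E (Suc n) 0 = 0" by (simp add: E_def)
    then have "z * (LINT x:{0<..}|lborel. E (Suc n) x) = of_nat (Suc n) * (fact n / z ^ Suc n)"
      using step[of "Suc n"] by (simp add: Suc)
    then show ?case using z0 by (simp add: field_simps)
  qed
  then show "(LINT x:{0<..}|lborel. of_real x ^ n * exp (- (z * of_real x))) = fact n / z ^ Suc n"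
    unfolding E_def .
qed

lemma integral_cis_period:
  "(LINT t:{0..<2*pi}|lborel. cis (of_int m * t)) = (if m = 0 then of_real (2 * pi) else 0)"
proof -
  have AE: "AE t in lborel. indicator {0..<2*pi} t *\<^sub>R cis (of_int m * t) = indicator {0..2*pi} t *\<^sub>R cis (of_int m * t)"
    using AE_lborel_singleton[of "2 * pi"] by eventually_elim (auto split: split_indicator)
  have [measurable]: "(\<lambda>t. indicator A t *\<^sub>R cis (of_int m * t)) \<in> borel_measurable lborel" if "A \<in> sets borel" for A :: "real set"
    using that by measurable
  have eq: "(LINT t:{0..<2*pi}|lborel. cis (of_int m * t)) = (\<integral>t. indicator {0..2*pi} t *\<^sub>R cis (of_int m * t) \<partial>lborel)"
    unfolding set_lebesgue_integral_def by (rule integral_cong_AE) (use AE in auto)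
  show ?thesis
  proof (cases "m = 0")
    case True
    then show ?thesis unfolding eq by (simp add: scaleR_conv_of_real)
  next
    case False
    have "(\<integral>t. indicator {0..2*pi} t *\<^sub>R cis (of_int m * t) \<partial>lborel)
      = cis (of_int m * (2 * pi)) / (\<i> * of_int m) - cis (of_int m * 0) / (\<i> * of_int m)"
    proof (rule integral_FTC_Icc)
      fix x :: real
      have "((\<lambda>w. exp (\<i> * (of_int m * w)) / (\<i> * of_int m)) has_field_derivative exp (\<i> * (of_int m * of_real x))) (at (of_real x))"
        using False by (auto intro!: derivative_eq_intros simp: mult.left_commute[of \<i>] mult.commute[of _ \<i>])
      from has_vector_derivative_real_field[OF this]
      show "((\<lambda>t. cis (of_int m * t) / (\<i> * of_int m)) has_vector_derivative cis (of_int m * x)) (at x within {0..2*pi})"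
        unfolding cis_conv_exp by (simp add: has_vector_derivative_at_within)
    next
      show "continuous_on {0..2*pi} (\<lambda>t. cis (of_int m * t))"
        by (intro continuous_intros)
    qed simp
    also have "cis (of_int m * (2 * pi)) = 1"
      using cis_multiple_2pi[of "of_int m"] by (simp add: mult_ac)
    finally show ?thesis using False unfolding eq by simp
  qed
qed

text \<open>The integrand is \<open>A\<^sup>-\<^sup>2\<close> times a power series in \<open>(B/A) e\<^sup>-\<^sup>i\<^sup>t\<close>; the factor \<open>e\<^sup>i\<^sup>k\<^sup>t\<close> selects
  its \<open>k\<close>-th term.\<close>

lemma integral_cis_pole:
  assumes "norm B < norm (A :: complex)"
  shows "(LINT t:{0..<2*pi}|lborel. cis (real k * t) / (A - B * cis (- t))\<^sup>2) = of_real (2 * pi) * (of_nat (Suc k) * B ^ k / A ^ (k + 2))"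
proof -
  define b where "b = B / A"
  have A0: "A \<noteq> 0" using assms by auto
  have b: "norm b < 1" using assms A0 by (simp add: b_def norm_divide divide_simps)
  define f where "f = (\<lambda>n t. indicator {0..<2*pi} t *\<^sub>R (of_nat (Suc n) * b ^ n * cis (of_int (int k - int n) * t)))"
  have nf: "norm (f n t) = indicator {0..<2*pi} t * (real (Suc n) * norm b ^ n)" for n t
    by (simp add: f_def norm_mult norm_power del: of_nat_Suc)
  have sb: "summable (\<lambda>n. real (Suc n) * norm b ^ n)"
    using geometric_deriv_sums[of "norm b"] b by (auto dest: sums_summable)
  have ii: "integrable lborel (\<lambda>t. indicator {0..<2*pi} t :: real)"
    by simp
  have [measurable]: "f n \<in> borel_measurable borel" for n unfolding f_def by measurable
  have s: "(\<lambda>n. f n t) sums (A\<^sup>2 * (indicator {0..<2*pi} t *\<^sub>R (cis (real k * t) / (A - B * cis (- t))\<^sup>2)))" for t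
  proof -
    have "norm (b * cis (- t)) < 1" using b by (simp add: norm_mult)
    from sums_mult[OF geometric_deriv_sums[OF this], of "indicator {0..<2*pi} t *\<^sub>R cis (real k * t)"]
    have "(\<lambda>n. indicator {0..<2*pi} t *\<^sub>R cis (real k * t) * (of_nat (Suc n) * (b * cis (- t)) ^ n)) sums
       (indicator {0..<2*pi} t *\<^sub>R cis (real k * t) * (1 / (1 - b * cis (- t))\<^sup>2))" .
    moreover have "indicator {0..<2*pi} t *\<^sub>R cis (real k * t) * (of_nat (Suc n) * (b * cis (- t)) ^ n) = f n t" for n
    proof -
      have "cis (real k * t) * cis (- t) ^ n = cis (of_int (int k - int n) * t)"
        by (subst Complex.DeMoivre, subst cis_mult) (simp add: algebra_simps)
      then show ?thesis by (simp add: f_def power_mult_distrib)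
    qed
    moreover have "1 / (1 - b * cis (- t))\<^sup>2 = A\<^sup>2 / (A - B * cis (- t))\<^sup>2"
    proof -
      have "A - B * cis (- t) = A * (1 - b * cis (- t))" using A0 by (simp add: b_def algebra_simps)
      then show ?thesis using A0 by (simp add: power_mult_distrib)
    qed
    ultimately show ?thesis by (cases "t \<in> {0..<2*pi}") (simp_all add: mult_ac)
  qed
  have "(\<lambda>n. \<integral>t. f n t \<partial>lborel) sums (\<integral>t. (\<Sum>n. f n t) \<partial>lborel)"
  proof (rule sums_integral)
    show "integrable lborel (f n)" for n
      by (rule Bochner_Integration.integrable_bound[OF integrable_mult_left[of "real (Suc n) * norm b ^ n", OF ii]])
        (auto simp: nf)
    show "AE t in lborel. summable (\<lambda>n. norm (f n t))"
      unfolding nf using sb by (intro AE_I2 summable_mult)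
    show "summable (\<lambda>n. \<integral>t. norm (f n t) \<partial>lborel)"
      unfolding nf using summable_mult[OF sb, of "2 * pi"] by simp
  qed
  also have "(\<lambda>t. \<Sum>n. f n t) = (\<lambda>t. A\<^sup>2 * (indicator {0..<2*pi} t *\<^sub>R (cis (real k * t) / (A - B * cis (- t))\<^sup>2)))"
    using s by (auto simp: sums_iff)
  also have "(\<integral>t. A\<^sup>2 * (indicator {0..<2*pi} t *\<^sub>R (cis (real k * t) / (A - B * cis (- t))\<^sup>2)) \<partial>lborel)
     = A\<^sup>2 * (LINT t:{0..<2*pi}|lborel. cis (real k * t) / (A - B * cis (- t))\<^sup>2)"
    unfolding set_lebesgue_integral_def by (rule integral_mult_right_zero)
  also have "(\<lambda>n. \<integral>t. f n t \<partial>lborel) = (\<lambda>n. if n = k then of_nat (Suc k) * b ^ k * of_real (2 * pi) else 0)"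
  proof
    fix n
    have "(\<integral>t. f n t \<partial>lborel) = of_nat (Suc n) * b ^ n * (LINT t:{0..<2*pi}|lborel. cis (of_int (int k - int n) * t))"
      unfolding f_def set_lebesgue_integral_def
      by (subst integral_mult_right_zero[symmetric]) (simp add: mult_ac)
    then show "(\<integral>t. f n t \<partial>lborel) = (if n = k then of_nat (Suc k) * b ^ k * of_real (2 * pi) else 0)"
      unfolding integral_cis_period by auto
  qed
  finally have "A\<^sup>2 * (LINT t:{0..<2*pi}|lborel. cis (real k * t) / (A - B * cis (- t))\<^sup>2) = of_nat (Suc k) * b ^ k * of_real (2 * pi)"
    by (rule sums_unique2) (rule sums_single)
  then show ?thesis using A0 by (simp add: b_def power_divide power_add power2_eq_square field_simps)
qed

text \<open>Integrate \<open>2 |f g| \<le> l f\<^sup>2 + g\<^sup>2/l\<close> and choose the best \<open>l\<close>.\<close>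

lemma nn_integral_cauchy_schwarz:
  fixes f g :: "'a \<Rightarrow> real"
  assumes [measurable]: "f \<in> borel_measurable M" "g \<in> borel_measurable M"
  shows "(\<integral>\<^sup>+x. ennreal \<bar>f x * g x\<bar> \<partial>M)\<^sup>2 \<le> (\<integral>\<^sup>+x. ennreal ((f x)\<^sup>2) \<partial>M) * (\<integral>\<^sup>+x. ennreal ((g x)\<^sup>2) \<partial>M)"
proof -
  define X where "X = (\<integral>\<^sup>+x. ennreal ((f x)\<^sup>2) \<partial>M)"
  define Y where "Y = (\<integral>\<^sup>+x. ennreal ((g x)\<^sup>2) \<partial>M)"
  define Z where "Z = (\<integral>\<^sup>+x. ennreal \<bar>f x * g x\<bar> \<partial>M)"
  have zero: "Z = 0" if "X = 0 \<or> Y = 0"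
  proof -
    have "AE x in M. f x * g x = 0"
    proof (cases "X = 0")
      case True
      then have "AE x in M. ennreal ((f x)\<^sup>2) = 0" unfolding X_def by (subst (asm) nn_integral_0_iff_AE) auto
      then show ?thesis by eventually_elim simp
    next
      case False
      then have "Y = 0" using that by simp
      then have "AE x in M. ennreal ((g x)\<^sup>2) = 0" unfolding Y_def by (subst (asm) nn_integral_0_iff_AE) auto
      then show ?thesis by eventually_elim simp
    qed
    then show ?thesis unfolding Z_def by (subst nn_integral_0_iff_AE) auto
  qed
  \<comment> \<open>The square of \<open>sqrt l |f| - |g| / sqrt l\<close> is nonnegative.\<close>
  have main: "ennreal 2 * Z \<le> ennreal l * X + ennreal (1/l) * Y" if l: "l > 0" for l
  proof -
    have "2 * \<bar>f x * g x\<bar> \<le> l * (f x)\<^sup>2 + 1/l * (g x)\<^sup>2" for x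
    proof -
      have "0 \<le> (sqrt l * \<bar>f x\<bar> - \<bar>g x\<bar> / sqrt l)\<^sup>2" by simp
      also have "\<dots> = l * (f x)\<^sup>2 + 1/l * (g x)\<^sup>2 - 2 * \<bar>f x * g x\<bar>"
        using l by (simp add: power2_diff power_mult_distrib power_divide abs_mult)
      finally show ?thesis by simp
    qed
    then have "(\<integral>\<^sup>+x. ennreal (2 * \<bar>f x * g x\<bar>) \<partial>M) \<le> (\<integral>\<^sup>+x. ennreal (l * (f x)\<^sup>2 + 1/l * (g x)\<^sup>2) \<partial>M)"
      by (intro nn_integral_mono ennreal_leI) auto
    also have "\<dots> = (\<integral>\<^sup>+x. ennreal l * ennreal ((f x)\<^sup>2) + ennreal (1/l) * ennreal ((g x)\<^sup>2) \<partial>M)"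
      using l by (intro nn_integral_cong) (simp add: ennreal_plus ennreal_mult[symmetric] del: ennreal_plus flip: ennreal_plus)
    also have "\<dots> = ennreal l * X + ennreal (1/l) * Y"
      unfolding X_def Y_def by (subst nn_integral_add) (auto simp: nn_integral_cmult)
    also have "(\<integral>\<^sup>+x. ennreal (2 * \<bar>f x * g x\<bar>) \<partial>M) = ennreal 2 * Z"
      unfolding Z_def by (subst nn_integral_cmult[symmetric]) (auto simp: ennreal_mult)
    finally show ?thesis .
  qed
  show ?thesis unfolding X_def[symmetric] Y_def[symmetric] Z_def[symmetric]
  proof (cases "X = 0 \<or> Y = 0 \<or> X = \<infinity> \<or> Y = \<infinity>")
    case True
    then show "Z\<^sup>2 \<le> X * Y" using zero by (auto simp: ennreal_top_mult ennreal_mult_top)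
  next
    case False
    then obtain x y where x: "X = ennreal x" "x > 0" and y: "Y = ennreal y" "y > 0"
      by (cases X; cases Y) (auto simp: less_le)
    define l where "l = sqrt (y / x)"
    have l: "l > 0" using x y by (simp add: l_def)
    have "l * x = sqrt (x * y)" "1 / l * y = sqrt (x * y)"
    proof -
      have "sqrt x * sqrt x = x" "sqrt y * sqrt y = y" "sqrt x > 0" "sqrt y > 0" using x y by auto
      then show "l * x = sqrt (x * y)" "1 / l * y = sqrt (x * y)"
        unfolding l_def real_sqrt_divide real_sqrt_mult by (auto simp: field_simps)
    qed
    then have "ennreal 2 * Z \<le> ennreal (2 * sqrt (x * y))"
      using main[OF l] x y l by (simp add: ennreal_mult[symmetric] ennreal_plus[symmetric] del: ennreal_plus)
    then have "ennreal 2 * Z \<le> ennreal 2 * ennreal (sqrt (x * y))"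
      using x y by (simp add: ennreal_mult)
    then have "Z \<le> ennreal (sqrt (x * y))"
      by (simp add: ennreal_mult_le_mult_iff)
    then have "Z\<^sup>2 \<le> (ennreal (sqrt (x * y)))\<^sup>2" by (intro power_mono) auto
    also have "\<dots> = X * Y" using x y by (simp add: ennreal_power ennreal_mult[symmetric])
    finally show "Z\<^sup>2 \<le> X * Y" .
  qed
qed

section \<open>Smooth functions with compact support\<close>

text \<open>The family of all \<open>P(1/x) exp (- 1/x)\<close>, extended by \<open>0\<close>, is closed under differentiation;
  \<open>P = 1\<close> is the standard smooth function that vanishes on the negative axis.\<close>

definition bump :: "real poly \<Rightarrow> real \<Rightarrow> real" where
  "bump P x = (if x > 0 then poly P (1 / x) * exp (- (1 / x)) else 0)"

definition bump_deriv :: "real poly \<Rightarrow> real poly" where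
  "bump_deriv P = [:0, 0, 1:] * (P - pderiv P)"

lemma poly_times_exp_minus_tendsto_0:
  "((\<lambda>y. poly P y * exp (- y :: real)) \<longlongrightarrow> 0) at_top"
proof -
  have "((\<lambda>y. \<Sum>i\<le>degree P. coeff P i * (y ^ i / exp y)) \<longlongrightarrow> (\<Sum>i\<le>degree P. coeff P i * 0)) at_top"
    by (intro tendsto_sum tendsto_mult tendsto_const tendsto_power_div_exp_0)
  moreover have "(\<Sum>i\<le>degree P. coeff P i * (y ^ i / exp y)) = poly P y * exp (- y)" for y
    by (simp add: poly_altdef sum_distrib_right exp_minus field_simps sum_divide_distrib)
  ultimately show ?thesis by simp
qed

lemma bump_has_derivative: "(bump P has_real_derivative bump (bump_deriv P) x) (at x)"
proof -
  consider "x > 0" | "x < 0" | "x = 0" by linarith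
  then show ?thesis
  proof cases
    case 1
    have "((\<lambda>x. poly P (1 / x) * exp (- (1 / x))) has_real_derivative bump (bump_deriv P) x) (at x)"
      using 1 by (auto intro!: derivative_eq_intros poly_DERIV[THEN DERIV_chain2]
          simp: bump_def bump_deriv_def field_simps power2_eq_square)
    then show ?thesis
      by (rule has_field_derivative_transform_within_open[where S = "{0<..}"]) (use 1 in \<open>auto simp: bump_def\<close>)
  next
    case 2
    have "((\<lambda>x. 0) has_real_derivative bump (bump_deriv P) x) (at x)"
      using 2 by (auto simp: bump_def)
    then show ?thesis
      by (rule has_field_derivative_transform_within_open[where S = "{..<0}"]) (use 2 in \<open>auto simp: bump_def\<close>)
  next
    case 3
    have "((\<lambda>h. bump P h / h) \<longlongrightarrow> 0) (at_right 0)"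
    proof -
      have "((\<lambda>y. poly (pCons 0 P) y * exp (- y :: real)) \<longlongrightarrow> 0) at_top"
        by (rule poly_times_exp_minus_tendsto_0)
      then have "((\<lambda>h. poly (pCons 0 P) (inverse h) * exp (- inverse h)) \<longlongrightarrow> 0) (at_right (0::real))"
        by (rule filterlim_compose[OF _ filterlim_inverse_at_top_right])
      then show ?thesis
        by (rule Lim_transform_eventually)
          (use eventually_at_right_less[of 0] in eventually_elim, auto simp: bump_def field_simps)
    qed
    moreover have "((\<lambda>h. bump P h / h) \<longlongrightarrow> 0) (at_left 0)"
    proof (rule tendsto_eventually)
      show "\<forall>\<^sub>F h in at_left 0. bump P h / h = 0"
        using eventually_at_left_real[of "-1" "0::real"] by (auto elim!: eventually_mono simp: bump_def)
    qed
    ultimately have "((\<lambda>h. bump P h / h) \<longlongrightarrow> 0) (at 0)" by (simp add: filterlim_at_split)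
    then show ?thesis unfolding 3 has_field_derivative_iff by (simp add: bump_def)
  qed
qed

text \<open>A class of functions on the chart \<open>(\<zeta>\<^sub>1, Re \<zeta>\<^sub>2)\<close> that is closed under directional derivatives away from
  \<open>\<zeta>\<^sub>1 = 0\<close>. Smoothness of its members then follows by induction on the order.\<close>

inductive smooth_gen :: "(complex \<times> real \<Rightarrow> complex) \<Rightarrow> bool" where
  const: "smooth_gen (\<lambda>_. c)"
| linear: "bounded_linear l \<Longrightarrow> smooth_gen l"
| norm_powr: "smooth_gen (\<lambda>x. of_real (norm (fst x) powr a))"
| add: "smooth_gen g \<Longrightarrow> smooth_gen h \<Longrightarrow> smooth_gen (\<lambda>x. g x + h x)"
| mult: "smooth_gen g \<Longrightarrow> smooth_gen h \<Longrightarrow> smooth_gen (\<lambda>x. g x * h x)"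
| exp: "smooth_gen g \<Longrightarrow> smooth_gen (\<lambda>x. exp (g x))"
| bump: "smooth_gen (\<lambda>x. of_real (u x)) \<Longrightarrow> smooth_gen (\<lambda>x. of_real (bump P (u x)))"

lemma smooth_gen_power: "smooth_gen g \<Longrightarrow> smooth_gen (\<lambda>x. g x ^ n)"
  by (induction n) (auto intro: smooth_gen.intros)

abbreviation punctured :: "(complex \<times> real) set" where
  "punctured \<equiv> (- {0}) \<times> UNIV"

lemma open_punctured: "open punctured"
  by (intro open_Times) auto

lemma smooth_gen_derivative:
  assumes "smooth_gen g"
  shows "\<exists>g'. (\<forall>x\<in>punctured. (g has_derivative g' x) (at x)) \<and> (\<forall>v. smooth_gen (\<lambda>x. g' x v))"
  using assms
proof (induction rule: smooth_gen.induct)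
  case (const c)
  show ?case by (rule exI[of _ "\<lambda>_ _. 0"]) (auto intro: smooth_gen.intros)
next
  case (linear l)
  then show ?case
    by (intro exI[of _ "\<lambda>_. l"]) (auto intro: smooth_gen.intros bounded_linear_imp_has_derivative)
next
  case (norm_powr a)
  define g' where "g' = (\<lambda>(x :: complex \<times> real) (v :: complex \<times> real).
     complex_of_real (a * norm (fst x) powr (a - 2) * (fst x \<bullet> fst v)))"
  have "((\<lambda>x. of_real (norm (fst x) powr a)) has_derivative g' x) (at x)" if "x \<in> punctured" for x
  proof -
    have nz: "fst x \<noteq> 0" using that by auto
    have f: "(fst has_derivative fst) (at x)" by (rule bounded_linear_imp_has_derivative[OF bounded_linear_fst])
    show ?thesis unfolding g'_def
      by (intro has_derivative_of_real has_derivative_compose[OF f norm_powr_has_derivative[OF nz, of a]])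
  qed
  moreover have "smooth_gen (\<lambda>x. g' x v)" for v
  proof -
    have "smooth_gen (\<lambda>x. of_real (fst x \<bullet> fst v))"
      by (intro smooth_gen.linear bounded_linear_compose[OF bounded_linear_of_real]
          bounded_linear_compose[OF bounded_linear_inner_left] bounded_linear_fst)
    then have "smooth_gen (\<lambda>x. (of_real a * of_real (norm (fst x) powr (a - 2))) * of_real (fst x \<bullet> fst v))"
      by (intro smooth_gen.mult smooth_gen.const smooth_gen.norm_powr)
    then show ?thesis by (simp add: g'_def)
  qed
  ultimately show ?case by blast
next
  case (add g h)
  then obtain g' h' where "\<forall>x\<in>punctured. (g has_derivative g' x) (at x)" "\<forall>v. smooth_gen (\<lambda>x. g' x v)"
    "\<forall>x\<in>punctured. (h has_derivative h' x) (at x)" "\<forall>v. smooth_gen (\<lambda>x. h' x v)" by blast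
  then show ?case
    by (intro exI[of _ "\<lambda>x v. g' x v + h' x v"]) (auto intro: smooth_gen.intros has_derivative_add)
next
  case (mult g h)
  then obtain g' h' where d: "\<forall>x\<in>punctured. (g has_derivative g' x) (at x)" "\<forall>v. smooth_gen (\<lambda>x. g' x v)"
    "\<forall>x\<in>punctured. (h has_derivative h' x) (at x)" "\<forall>v. smooth_gen (\<lambda>x. h' x v)" by blast
  have "smooth_gen (\<lambda>x. g x * h' x v + g' x v * h x)" for v
    using d(2)[rule_format, of v] d(4)[rule_format, of v] mult.hyps
    by (intro smooth_gen.add smooth_gen.mult)
  moreover have "((\<lambda>x. g x * h x) has_derivative (\<lambda>v. g x * h' x v + g' x v * h x)) (at x)"
    if "x \<in> punctured" for x
    using d that by (intro has_derivative_mult) auto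
  ultimately show ?case
    by (intro exI[of _ "\<lambda>x v. g x * h' x v + g' x v * h x"]) simp
next
  case (exp g)
  then obtain g' where d: "\<forall>x\<in>punctured. (g has_derivative g' x) (at x)" "\<forall>v. smooth_gen (\<lambda>x. g' x v)" by blast
  have "((\<lambda>x. exp (g x)) has_derivative (\<lambda>v. exp (g x) * g' x v)) (at x)" if "x \<in> punctured" for x
    using has_derivative_compose[OF bspec[OF d(1) that], of exp "(*) (exp (g x))"]
    by (simp add: DERIV_exp[unfolded has_field_derivative_def])
  moreover have "smooth_gen (\<lambda>x. exp (g x) * g' x v)" for v
    using d(2)[rule_format, of v] exp.hyps by (intro smooth_gen.mult smooth_gen.exp)
  ultimately show ?case
    by (intro exI[of _ "\<lambda>x v. exp (g x) * g' x v"]) simp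
next
  case (bump u P)
  then obtain g' where d: "\<forall>x\<in>punctured. ((\<lambda>x. complex_of_real (u x)) has_derivative g' x) (at x)"
    "\<forall>v. smooth_gen (\<lambda>x. g' x v)" by blast
  have D: "((\<lambda>x. of_real (bump P (u x))) has_derivative (\<lambda>v. of_real (bump (bump_deriv P) (u x)) * g' x v)) (at x)"
    if x: "x \<in> punctured" for x
  proof -
    have u: "(u has_derivative (\<lambda>v. Re (g' x v))) (at x)"
      using has_derivative_Re[OF bspec[OF d(1) x]] by simp
    have "((\<lambda>x. complex_of_real (u x)) has_derivative (\<lambda>v. of_real (Re (g' x v)))) (at x)"
      using u by (rule has_derivative_of_real)
    then have eq: "g' x = (\<lambda>v. of_real (Re (g' x v)))"
      using bspec[OF d(1) x] has_derivative_unique by blast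
    have "((\<lambda>x. bump P (u x)) has_derivative (\<lambda>v. bump (bump_deriv P) (u x) * Re (g' x v))) (at x)"
      using has_derivative_compose[OF u bump_has_derivative[unfolded has_field_derivative_def]] .
    then have "((\<lambda>x. complex_of_real (bump P (u x))) has_derivative (\<lambda>v. of_real (bump (bump_deriv P) (u x) * Re (g' x v)))) (at x)"
      by (rule has_derivative_of_real)
    then show ?thesis by (subst eq) simp
  qed
  have "smooth_gen (\<lambda>x. of_real (bump (bump_deriv P) (u x)) * g' x v)" for v
    using d(2)[rule_format, of v] bump.hyps by (intro smooth_gen.mult smooth_gen.bump)
  with D show ?case
    by (intro exI[of _ "\<lambda>x v. of_real (bump (bump_deriv P) (u x)) * g' x v"]) simp
qed

text \<open>The derivatives of members of the class agree with members of the class only on the punctured chart.\<close>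

lemma Ck_on_cong:
  assumes "open S" "Ck_on n S f" "\<And>x. x \<in> S \<Longrightarrow> f x = g x"
  shows "Ck_on n S g"
  using assms(2,3)
proof (induction n arbitrary: f g)
  case 0
  then show ?case by (simp cong: continuous_on_cong)
next
  case (Suc n)
  have D: "(g has_derivative frechet_derivative f (at x)) (at x)" if "x \<in> S" for x
  proof (rule has_derivative_transform_within_open[OF _ \<open>open S\<close> that])
    show "(f has_derivative frechet_derivative f (at x)) (at x)"
      using Suc.prems that by (simp add: frechet_derivative_works)
  qed (use Suc.prems in auto)
  have eq: "frechet_derivative f (at x) = frechet_derivative g (at x)" if "x \<in> S" for x
    using frechet_derivative_at[OF D[OF that]] .
  show ?case
  proof (simp, intro conjI ballI allI)
    show "g differentiable at x" if "x \<in> S" for x using D[OF that] by (auto simp: differentiable_def)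
    show "Ck_on n S (\<lambda>x. frechet_derivative g (at x) v)" for v
      using Suc.IH[of "\<lambda>x. frechet_derivative f (at x) v"] Suc.prems eq by simp
  qed
qed

lemma smooth_gen_smooth:
  assumes "smooth_gen g"
  shows "smooth_fun_on punctured g"
  unfolding smooth_fun_on_def
proof
  fix n
  show "Ck_on n punctured g"
    using assms
  proof (induction n arbitrary: g)
    case 0
    then obtain g' where "\<forall>x\<in>punctured. (g has_derivative g' x) (at x)" using smooth_gen_derivative by blast
    then show ?case
      by (auto intro!: continuous_at_imp_continuous_on dest!: bspec has_derivative_continuous)
  next
    case (Suc n)
    then obtain g' where d: "\<forall>x\<in>punctured. (g has_derivative g' x) (at x)" "\<forall>v. smooth_gen (\<lambda>x. g' x v)"
      using smooth_gen_derivative by blast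
    have "Ck_on n punctured (\<lambda>x. frechet_derivative g (at x) v)" for v
    proof (rule Ck_on_cong[OF open_punctured])
      show "Ck_on n punctured (\<lambda>x. g' x v)" using Suc.IH d by blast
      show "g' x v = frechet_derivative g (at x) v" if "x \<in> punctured" for x
        using frechet_derivative_at bspec[OF d(1) that] by metis
    qed
    moreover have "\<forall>x\<in>punctured. g differentiable (at x)"
      using d(1) unfolding differentiable_def by blast
    ultimately show ?case by simp
  qed
qed

section \<open>Boundary values of the Leray transform on one Fourier mode\<close>

lemma integral_triple_dominated:
  fixes H :: "real \<times> real \<times> real \<Rightarrow> complex" and a b c :: "real \<Rightarrow> real"
  assumes [measurable]: "H \<in> borel_measurable borel"
    and a: "integrable lborel a" and b: "integrable lborel b" and c: "integrable lborel c"
    and le: "\<And>r \<theta> s. norm (H (r, \<theta>, s)) \<le> a r * b \<theta> * c s"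
  shows "(\<integral>p. H p \<partial>lborel) = (\<integral>q. (\<integral>\<theta>. H (fst q, \<theta>, snd q) \<partial>lborel) \<partial>lborel)"
proof -
  note sf = lborel.sigma_finite_measure_axioms
  have [measurable]: "a \<in> borel_measurable borel" "b \<in> borel_measurable borel" "c \<in> borel_measurable borel"
    using a b c by auto
  have [measurable]: "H \<in> borel_measurable (lborel \<Otimes>\<^sub>M (lborel \<Otimes>\<^sub>M lborel))"
    by (simp add: lborel_prod)
  have bc: "integrable (lborel \<Otimes>\<^sub>M lborel) (\<lambda>q. \<bar>b (fst q) * c (snd q)\<bar>)"
    by (rule integrable_product_dominated[OF sf sf, where g = "\<lambda>x. \<bar>b x\<bar>" and h = "\<lambda>x. \<bar>c x\<bar>"])
      (use b c in \<open>auto simp: abs_mult\<close>)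
  have le': "norm (H (r, \<theta>, s)) \<le> \<bar>a r\<bar> * \<bar>b \<theta>\<bar> * \<bar>c s\<bar>" for r \<theta> s
    using le[of r \<theta> s] abs_ge_self[of "a r * b \<theta> * c s"] by (simp add: abs_mult)
  have I: "integrable (lborel \<Otimes>\<^sub>M (lborel \<Otimes>\<^sub>M lborel)) H"
    by (rule integrable_product_dominated[OF sf _ _ _ bc, where g = "\<lambda>x. \<bar>a x\<bar>"])
      (use a le' in \<open>auto simp: lborel_prod abs_mult mult.assoc intro: lborel.sigma_finite_measure_axioms\<close>)
  have "(\<integral>p. H p \<partial>lborel) = (\<integral>p. H p \<partial>(lborel \<Otimes>\<^sub>M (lborel \<Otimes>\<^sub>M lborel)))"
    by (simp add: lborel_prod)
  also have "\<dots> = (\<integral>r. \<integral>q. H (r, q) \<partial>(lborel \<Otimes>\<^sub>M lborel) \<partial>lborel)"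
    using I unfolding lborel_prod[where ?'a = real and ?'b = real]
    by (rule lborel_pair.integral_fst'[symmetric])
  also have "\<dots> = (\<integral>r. \<integral>s. \<integral>\<theta>. H (r, \<theta>, s) \<partial>lborel \<partial>lborel \<partial>lborel)"
  proof (rule Bochner_Integration.integral_cong[OF refl])
    fix r
    have "integrable (lborel \<Otimes>\<^sub>M lborel) (\<lambda>q. H (r, q))"
      by (rule integrable_product_dominated[OF sf sf, where g = "\<lambda>x. \<bar>a r\<bar> * \<bar>b x\<bar>" and h = "\<lambda>x. \<bar>c x\<bar>"])
        (use b c le' in auto)
    then have "(\<integral>q. H (r, q) \<partial>(lborel \<Otimes>\<^sub>M lborel)) = (\<integral>\<theta>. \<integral>s. H (r, \<theta>, s) \<partial>lborel \<partial>lborel)"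
      by (rule lborel_pair.integral_fst'[symmetric])
    also have "\<dots> = (\<integral>s. \<integral>\<theta>. H (r, \<theta>, s) \<partial>lborel \<partial>lborel)"
      by (rule Fubini_dominated[OF sf sf, where g = "\<lambda>x. \<bar>a r\<bar> * \<bar>b x\<bar>" and h = "\<lambda>x. \<bar>c x\<bar>"])
        (use b c le' in auto)
    finally show "(\<integral>q. H (r, q) \<partial>(lborel \<Otimes>\<^sub>M lborel)) = (\<integral>s. \<integral>\<theta>. H (r, \<theta>, s) \<partial>lborel \<partial>lborel)" .
  qed
  also have "\<dots> = (\<integral>q. (\<integral>\<theta>. H (fst q, \<theta>, snd q) \<partial>lborel) \<partial>(lborel \<Otimes>\<^sub>M lborel))"
  proof -
    have "integrable (lborel \<Otimes>\<^sub>M lborel) (\<lambda>q. (\<integral>\<theta>. H (fst q, \<theta>, snd q) \<partial>lborel))"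
    proof (rule integrable_product_dominated[OF sf sf, where g = "\<lambda>x. \<bar>a x\<bar> * (\<integral>\<theta>. \<bar>b \<theta>\<bar> \<partial>lborel)" and h = "\<lambda>x. \<bar>c x\<bar>"])
      fix r s :: real
      have "norm (\<integral>\<theta>. H (r, \<theta>, s) \<partial>lborel) \<le> (\<integral>\<theta>. \<bar>a r\<bar> * \<bar>b \<theta>\<bar> * \<bar>c s\<bar> \<partial>lborel)"
      proof (rule Bochner_Integration.integral_norm_bound_integral)
        show i: "integrable lborel (\<lambda>\<theta>. \<bar>a r\<bar> * \<bar>b \<theta>\<bar> * \<bar>c s\<bar>)" using b by auto
        show "integrable lborel (\<lambda>\<theta>. H (r, \<theta>, s))"
          using le' by (intro Bochner_Integration.integrable_bound[OF i]) (auto simp: abs_mult)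
      qed (use le' in auto)
      then show "norm (\<integral>\<theta>. H (fst (r, s), \<theta>, snd (r, s)) \<partial>lborel) \<le> \<bar>a r\<bar> * (\<integral>\<theta>. \<bar>b \<theta>\<bar> \<partial>lborel) * \<bar>c s\<bar>"
        by (simp add: mult_ac)
    qed (use a c in auto)
    from lborel_pair.integral_fst'[OF this] show ?thesis by simp
  qed
  finally show ?thesis by (simp add: lborel_prod)
qed

lemma integrable_indicator_Icc: "integrable lborel (indicator {a..b} :: real \<Rightarrow> real)"
  by (intro integrable_real_indicator) (auto simp: emeasure_lborel_Icc_eq)

text \<open>Young's inequality keeps the denominator of the Leray kernel away from \<open>0\<close> inside the domain: it
  says that the angular part is dominated by the real part of the rest.\<close>

lemma Young_powr:
  fixes r \<rho> \<gamma> :: real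
  assumes "\<gamma> > 1" "r > 0" "\<rho> \<ge> 0"
  shows "\<gamma> * (r powr (\<gamma> - 1) * \<rho>) \<le> (\<gamma> - 1) * r powr \<gamma> + \<rho> powr \<gamma>"
proof -
  have "\<rho> * r powr (\<gamma> - 1) \<le> \<rho> powr \<gamma> / \<gamma> + (r powr (\<gamma> - 1)) powr (\<gamma> / (\<gamma> - 1)) / (\<gamma> / (\<gamma> - 1))"
    using assms by (intro Youngs_inequality) (auto simp: field_simps)
  also have "(r powr (\<gamma> - 1)) powr (\<gamma> / (\<gamma> - 1)) = r powr \<gamma>"
    using assms by (simp add: powr_powr)
  finally show ?thesis using assms by (simp add: field_simps)
qed

text \<open>The exponent of \<open>r\<close> in the kernel for the mode \<open>k\<close>.\<close>

abbreviation wexp :: "real \<Rightarrow> nat \<Rightarrow> real" where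
  "wexp \<gamma> k \<equiv> (\<gamma> - 1) * real (k + 1)"

text \<open>With \<open>max \<xi> 0\<close> in place of \<open>\<xi>\<close> the integrals below converge for all real \<open>\<xi>\<close> and depend
  continuously on it; negative frequencies drop out through a factor \<open>(max \<xi> 0)\<^sup>k\<^sup>+\<^sup>1\<close>.\<close>

abbreviation damping :: "real \<Rightarrow> real \<Rightarrow> real \<Rightarrow> real" where
  "damping \<gamma> \<xi> r \<equiv> exp (- (max \<xi> 0 * ((\<gamma> - 1) * r powr \<gamma>)))"

text \<open>The rank one operator at the frequency \<open>\<xi>\<close> is the product of \<open>profile\<close>, which is an inner product of
  the Fourier transform of \<open>F\<close> in \<open>s\<close> with a fixed function of \<open>r\<close>, and of a fixed function of \<open>\<rho>\<close>.
  The product of both is \<open>leray_density\<close>.\<close>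

definition profile :: "real \<Rightarrow> nat \<Rightarrow> (real \<times> real \<Rightarrow> complex) \<Rightarrow> real \<Rightarrow> complex" where
  "profile \<gamma> k F \<xi> = (\<integral>p. F p * of_real (fst p powr (wexp \<gamma> k))
      * of_real (damping \<gamma> \<xi> (fst p)) * cis (- (\<xi> * snd p)) \<partial>lborel)"

definition leray_density :: "real \<Rightarrow> nat \<Rightarrow> (real \<times> real \<Rightarrow> complex) \<Rightarrow> real \<Rightarrow> real \<Rightarrow> complex" where
  "leray_density \<gamma> k F \<rho> \<xi> =
     of_real (max \<xi> 0 ^ (k + 1) * exp (- (max \<xi> 0 * \<rho> powr \<gamma>))) * profile \<gamma> k F \<xi>"

text \<open>In this locale \<open>F(r, s) e\<^sup>i\<^sup>k\<^sup>\<theta>\<close> stands for the \<open>k\<close>-th Fourier component of a test function. Its support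
  avoids \<open>r = 0\<close>, which bounds the kernel up to the boundary.\<close>

locale compact_profile =
  fixes \<gamma> :: real and k :: nat and F :: "real \<times> real \<Rightarrow> complex" and r0 r1 S :: real
  assumes gamma: "\<gamma> > 1" and r0: "0 < r0"
    and cont: "continuous_on UNIV F"
    and supp: "\<And>r s. F (r, s) \<noteq> 0 \<Longrightarrow> r0 \<le> r \<and> r \<le> r1 \<and> \<bar>s\<bar> \<le> S"
begin

lemma F_measurable [measurable]: "F \<in> borel_measurable borel"
  using cont by (rule borel_measurable_continuous_onI)

lemma F_zero: "r < r0 \<Longrightarrow> F (r, s) = 0" "r > r1 \<Longrightarrow> F (r, s) = 0" "\<bar>s\<bar> > S \<Longrightarrow> F (r, s) = 0"
  using supp[of r s] by (auto simp: not_le)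

lemma F_bounded: "\<exists>M\<ge>0. \<forall>p. norm (F p) \<le> M"
proof -
  have "compact (F ` ({r0..r1} \<times> {-S..S}))"
    by (intro compact_continuous_image compact_Times continuous_on_subset[OF cont]) auto
  then obtain M where "\<forall>x \<in> F ` ({r0..r1} \<times> {-S..S}). norm x \<le> M"
    using compact_imp_bounded bounded_iff by metis
  then have M: "\<And>p. p \<in> {r0..r1} \<times> {-S..S} \<Longrightarrow> norm (F p) \<le> M" by blast
  have "norm (F p) \<le> max M 0" for p
  proof (cases "F p = 0")
    case False
    then have "p \<in> {r0..r1} \<times> {-S..S}" using supp[of "fst p" "snd p"] by (auto simp: mem_Times_iff abs_le_iff)
    then show ?thesis using M[of p] by simp
  qed simp
  then show ?thesis by (intro exI[of _ "max M 0"]) auto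
qed

definition \<Phi> :: "real \<times> real \<Rightarrow> complex" where
  "\<Phi> p = F p * of_real (fst p powr (wexp \<gamma> k))"

lemma \<Phi>_measurable [measurable]: "\<Phi> \<in> borel_measurable borel"
proof -
  have [measurable]: "F \<in> borel_measurable (borel \<Otimes>\<^sub>M borel)" by (simp add: borel_prod)
  show ?thesis unfolding \<Phi>_def[abs_def] borel_prod[symmetric] by measurable
qed

lemma \<Phi>_zero: "\<Phi> p \<noteq> 0 \<Longrightarrow> r0 \<le> fst p"
  using supp[of "fst p" "snd p"] by (auto simp: \<Phi>_def)

lemma weighted_F_dominated: "\<exists>M\<ge>0. \<forall>r s. norm (F (r, s)) * (1 + r powr (wexp \<gamma> k) + r powr (\<gamma> - 1)) \<le>
    M * indicator {r0..r1} r * indicator {-S..S} s"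
proof -
  obtain M where M: "M \<ge> 0" "\<And>p. norm (F p) \<le> M" using F_bounded by blast
  \<comment> \<open>The three summands cover the factors of \<open>F\<close> that occur below.\<close>
  define m where "m = 1 + r1 powr (wexp \<gamma> k) + r1 powr (\<gamma> - 1)"
  have m: "m \<ge> 0" by (simp add: m_def add_nonneg_nonneg)
  show ?thesis
  proof (intro exI[of _ "M * m"] conjI allI)
    fix r s
    show "norm (F (r, s)) * (1 + r powr (wexp \<gamma> k) + r powr (\<gamma> - 1)) \<le>
      M * m * indicator {r0..r1} r * indicator {-S..S} s"
    proof (cases "F (r, s) = 0")
      case True
      then show ?thesis using M m by (simp add: mult_nonneg_nonneg)
    next
      case False
      then have rs: "r0 \<le> r" "r \<le> r1" "\<bar>s\<bar> \<le> S" using supp by auto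
      have "r powr (wexp \<gamma> k) \<le> r1 powr (wexp \<gamma> k)" "r powr (\<gamma> - 1) \<le> r1 powr (\<gamma> - 1)"
        using rs r0 gamma by (auto intro!: powr_mono2)
      then have "norm (F (r, s)) * (1 + r powr (wexp \<gamma> k) + r powr (\<gamma> - 1)) \<le> M * m"
        unfolding m_def using M by (intro mult_mono add_mono) auto
      then show ?thesis using rs by (simp add: abs_le_iff)
    qed
  qed (use M m in simp)
qed

lemma integrable_box: "integrable lborel (\<lambda>p. indicator {r0..r1} (fst p) * indicator {-S..S} (snd p) :: real)"
proof -
  have "integrable (lborel \<Otimes>\<^sub>M lborel) (\<lambda>p. indicator {r0..r1} (fst p) * indicator {-S..S} (snd p) :: real)"
    by (rule integrable_product_dominated[OF lborel.sigma_finite_measure_axioms lborel.sigma_finite_measure_axioms,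
          where g = "indicator {r0..r1}" and h = "indicator {-S..S}"]) (auto simp: integrable_indicator_Icc)
  then show ?thesis by (simp add: lborel_prod)
qed

lemma \<Phi>_integrable: "integrable lborel \<Phi>"
proof -
  obtain M where M: "M \<ge> 0" "\<And>r s. norm (F (r, s)) * (1 + r powr (wexp \<gamma> k) + r powr (\<gamma> - 1)) \<le>
    M * indicator {r0..r1} r * indicator {-S..S} s" using weighted_F_dominated by blast
  show ?thesis
  proof (rule Bochner_Integration.integrable_bound[OF integrable_mult_right[of M, OF integrable_box]])
    show "AE p in lborel. norm (\<Phi> p) \<le> norm (M * (indicator {r0..r1} (fst p) * indicator {-S..S} (snd p)))"
    proof (rule AE_I2)
      fix p :: "real \<times> real"
      have "norm (\<Phi> p) = norm (F p) * (fst p powr (wexp \<gamma> k))"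
        by (simp add: \<Phi>_def norm_mult)
      also have "\<dots> \<le> norm (F p) * (1 + fst p powr (wexp \<gamma> k) + fst p powr (\<gamma> - 1))"
        by (intro mult_left_mono) auto
      also have "\<dots> \<le> M * indicator {r0..r1} (fst p) * indicator {-S..S} (snd p)"
        using M(2)[of "fst p" "snd p"] by simp
      finally show "norm (\<Phi> p) \<le> norm (M * (indicator {r0..r1} (fst p) * indicator {-S..S} (snd p)))"
        using M(1) by (simp add: abs_mult mult.assoc)
    qed
  qed simp
qed

definition base :: "real \<Rightarrow> real \<Rightarrow> real" where
  "base \<rho> r = (\<gamma> - 1) * r powr \<gamma> + \<rho> powr \<gamma>"

text \<open>Inside the domain the denominator is bounded below, so the integration in \<open>\<theta>\<close> can be carried out
  first; it leaves the \<open>k\<close>-th term of the expansion of the kernel.\<close>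

lemma leray_off_boundary:
  assumes f: "\<And>r \<theta> s. r > 0 \<Longrightarrow> 0 \<le> \<theta> \<Longrightarrow> \<theta> < 2 * pi \<Longrightarrow> f (param \<gamma> (r, \<theta>, s)) = F (r, s) * cis (real k * \<theta>)"
    and \<epsilon>: "\<epsilon> > 0" and \<rho>: "\<rho> \<ge> 0"
  shows "leray \<gamma> f (of_real \<rho> * cis \<phi>, Complex t (\<rho> powr \<gamma>) + \<i> * of_real \<epsilon>) =
    of_real (\<gamma> ^ (k + 2) * real (k + 1) / (2 * pi) * \<rho> ^ k) * cis (real k * \<phi>) *
      (\<integral>p. \<Phi> p / Complex (base \<rho> (fst p) + \<epsilon>) (snd p - t) ^ (k + 2) \<partial>lborel)"
proof -
  define A where "A = (\<lambda>r s. Complex (base \<rho> r + \<epsilon>) (s - t) / 2)"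
  define B where "B = (\<lambda>r. of_real (\<gamma> / 2 * r powr (\<gamma> - 1) * \<rho>) * cis \<phi>)"
  define H where "H = (\<lambda>(r, \<theta>, s). F (r, s) * of_real (r powr (\<gamma> - 1)) * (indicator {0..<2*pi} \<theta> *\<^sub>R (cis (real k * \<theta>) / (A r s - B r * cis (- \<theta>))\<^sup>2)))"
  have AB: "norm (B r) + \<epsilon> / 2 \<le> norm (A r s)" if "r > 0" for r s
  proof -
    have "norm (B r) = \<gamma> * (r powr (\<gamma> - 1) * \<rho>) / 2" using gamma \<rho> by (simp add: B_def norm_mult)
    also have "\<dots> \<le> base \<rho> r / 2" unfolding base_def using Young_powr[OF gamma that \<rho>] by simp
    finally have "norm (B r) + \<epsilon> / 2 \<le> Re (A r s)" by (simp add: A_def)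
    also have "\<dots> \<le> norm (A r s)" by (rule complex_Re_le_cmod)
    finally show ?thesis .
  qed
  have D: "\<epsilon> / 2 \<le> norm (A r s - B r * cis (- \<theta>))" if "r > 0" for r s \<theta>
    using norm_triangle_ineq2[of "A r s" "B r * cis (- \<theta>)"] AB[OF that, of s] by (simp add: norm_mult)
  obtain M where M: "M \<ge> 0" "\<And>r s. norm (F (r, s)) * (1 + r powr (wexp \<gamma> k) + r powr (\<gamma> - 1)) \<le>
    M * indicator {r0..r1} r * indicator {-S..S} s" using weighted_F_dominated by blast
  have [measurable]: "H \<in> borel_measurable borel"
    unfolding H_def A_def B_def Complex_eq base_def borel_prod[symmetric] by measurable
  have "(\<integral>p. H p \<partial>lborel) = (\<integral>q. (\<integral>\<theta>. H (fst q, \<theta>, snd q) \<partial>lborel) \<partial>lborel)"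
  proof (rule integral_triple_dominated)
    show "integrable lborel (\<lambda>r. M / (\<epsilon> / 2)\<^sup>2 * indicator {r0..r1} r)" "integrable lborel (indicator {0..<2*pi} :: real \<Rightarrow> real)"
      "integrable lborel (indicator {-S..S} :: real \<Rightarrow> real)"
      using integrable_mult_right[of "M / (\<epsilon> / 2)\<^sup>2", OF integrable_indicator_Icc[of r0 r1]]
      by (auto simp: integrable_indicator_Icc)
    fix r \<theta> s
    show "norm (H (r, \<theta>, s)) \<le> M / (\<epsilon> / 2)\<^sup>2 * indicator {r0..r1} r * indicator {0..<2*pi} \<theta> * indicator {-S..S} s"
    proof (cases "F (r, s) = 0")
      case True
      then show ?thesis using M(1) by (simp add: H_def)
    next
      case False
      then have r: "r > 0" using supp[of r s] r0 by auto
      have "norm (H (r, \<theta>, s)) = norm (F (r, s)) * r powr (\<gamma> - 1) * indicator {0..<2*pi} \<theta> / (norm (A r s - B r * cis (- \<theta>)))\<^sup>2"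
        by (simp add: H_def norm_mult norm_divide norm_power split: split_indicator)
      also have "\<dots> \<le> norm (F (r, s)) * r powr (\<gamma> - 1) * indicator {0..<2*pi} \<theta> / (\<epsilon> / 2)\<^sup>2"
      proof -
        have "0 < norm (A r s - B r * cis (- \<theta>))" using D[OF r, of s \<theta>] \<epsilon> by linarith
        then show ?thesis using D[OF r, of s \<theta>] \<epsilon>
          by (intro divide_left_mono power_mono mult_nonneg_nonneg mult_pos_pos zero_less_power) auto
      qed
      also have "\<dots> \<le> (norm (F (r, s)) * (1 + r powr (wexp \<gamma> k) + r powr (\<gamma> - 1))) * indicator {0..<2*pi} \<theta> / (\<epsilon> / 2)\<^sup>2"
        by (intro divide_right_mono mult_right_mono mult_left_mono) auto
      also have "\<dots> \<le> M * indicator {r0..r1} r * indicator {-S..S} s * indicator {0..<2*pi} \<theta> / (\<epsilon> / 2)\<^sup>2"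
        by (intro divide_right_mono mult_right_mono M) auto
      finally show ?thesis by (simp add: mult_ac)
    qed
  qed simp
  also have "\<dots> = (\<integral>q. of_real (2 * pi * real (k + 1) * (\<gamma> / 2) ^ k * 2 ^ (k + 2) * \<rho> ^ k) * cis (real k * \<phi>) *
      (\<Phi> q / Complex (base \<rho> (fst q) + \<epsilon>) (snd q - t) ^ (k + 2)) \<partial>lborel)"
  proof (rule Bochner_Integration.integral_cong[OF refl])
    fix q :: "real \<times> real"
    obtain r s where q: "q = (r, s)" by (cases q)
    have "(\<integral>\<theta>. H (r, \<theta>, s) \<partial>lborel) = of_real (2 * pi * real (k + 1) * (\<gamma> / 2) ^ k * 2 ^ (k + 2) * \<rho> ^ k) * cis (real k * \<phi>) *
      (\<Phi> (r, s) / Complex (base \<rho> r + \<epsilon>) (s - t) ^ (k + 2))"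
    proof (cases "F (r, s) = 0")
      case True
      then show ?thesis by (simp add: H_def \<Phi>_def)
    next
      case False
      then have r: "r > 0" using supp[of r s] r0 by auto
      have lt: "norm (B r) < norm (A r s)" using AB[OF r, of s] \<epsilon> by simp
      have "(\<integral>\<theta>. H (r, \<theta>, s) \<partial>lborel) = F (r, s) * of_real (r powr (\<gamma> - 1)) *
          (LINT \<theta>:{0..<2*pi}|lborel. cis (real k * \<theta>) / (A r s - B r * cis (- \<theta>))\<^sup>2)"
        unfolding H_def prod.case set_lebesgue_integral_def by (rule integral_mult_right_zero)
      also have "\<dots> = F (r, s) * of_real (r powr (\<gamma> - 1)) * (of_real (2 * pi) * (of_nat (Suc k) * B r ^ k / A r s ^ (k + 2)))"
        unfolding integral_cis_pole[OF lt] ..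
      also have "B r ^ k = of_real ((\<gamma> / 2) ^ k * (r powr (\<gamma> - 1)) ^ k * \<rho> ^ k) * cis (real k * \<phi>)"
        unfolding B_def power_mult_distrib of_real_power[symmetric] by (simp add: Complex.DeMoivre power_mult_distrib)
      also have "A r s ^ (k + 2) = Complex (base \<rho> r + \<epsilon>) (s - t) ^ (k + 2) / 2 ^ (k + 2)"
        unfolding A_def by (rule power_divide)
      also have "F (r, s) * of_real (r powr (\<gamma> - 1)) * (of_real (2 * pi) * (of_nat (Suc k) *
          (of_real ((\<gamma> / 2) ^ k * (r powr (\<gamma> - 1)) ^ k * \<rho> ^ k) * cis (real k * \<phi>)) /
          (Complex (base \<rho> r + \<epsilon>) (s - t) ^ (k + 2) / 2 ^ (k + 2))))
        = of_real (2 * pi * real (k + 1) * (\<gamma> / 2) ^ k * 2 ^ (k + 2) * \<rho> ^ k) * cis (real k * \<phi>) *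
          (F (r, s) * of_real (r powr (\<gamma> - 1) * (r powr (\<gamma> - 1)) ^ k) / Complex (base \<rho> r + \<epsilon>) (s - t) ^ (k + 2))"
        by simp
      also have "r powr (\<gamma> - 1) * (r powr (\<gamma> - 1)) ^ k = r powr (wexp \<gamma> k)"
        using r by (simp add: powr_power powr_add[symmetric] algebra_simps)
      finally show ?thesis by (simp add: \<Phi>_def)
    qed
    then show "(\<integral>\<theta>. H (fst q, \<theta>, snd q) \<partial>lborel) = of_real (2 * pi * real (k + 1) * (\<gamma> / 2) ^ k * 2 ^ (k + 2) * \<rho> ^ k) * cis (real k * \<phi>) *
      (\<Phi> q / Complex (base \<rho> (fst q) + \<epsilon>) (snd q - t) ^ (k + 2))" by (simp add: q)
  qed
  also have "\<dots> = of_real (2 * pi * real (k + 1) * (\<gamma> / 2) ^ k * 2 ^ (k + 2) * \<rho> ^ k) * cis (real k * \<phi>) *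
      (\<integral>q. \<Phi> q / Complex (base \<rho> (fst q) + \<epsilon>) (snd q - t) ^ (k + 2) \<partial>lborel)"
    by (rule integral_mult_right_zero)
  finally have HI: "(\<integral>p. H p \<partial>lborel) = \<dots>" .
  have "leray \<gamma> f (of_real \<rho> * cis \<phi>, Complex t (\<rho> powr \<gamma>) + \<i> * of_real \<epsilon>)
     = of_real (\<gamma>\<^sup>2 / (16 * pi\<^sup>2)) * (\<integral>p. H p \<partial>lborel)"
    unfolding leray_in_coordinates set_lebesgue_integral_def
  proof (rule arg_cong[where f = "\<lambda>x. of_real (\<gamma>\<^sup>2 / (16 * pi\<^sup>2)) * x"], rule Bochner_Integration.integral_cong[OF refl])
    fix p :: "real \<times> real \<times> real"
    obtain r \<theta> s where p: "p = (r, \<theta>, s)" by (cases p)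
    have den: "of_real (\<gamma> / 2) * (of_real (r powr \<gamma>) - of_real (r powr (\<gamma> - 1)) * cis (- \<theta>) * fst (of_real \<rho> * cis \<phi>, Complex t (\<rho> powr \<gamma>) + \<i> * of_real \<epsilon>))
           + \<i> / 2 * (of_real s + \<i> * of_real (r powr \<gamma>) - snd (of_real \<rho> * cis \<phi>, Complex t (\<rho> powr \<gamma>) + \<i> * of_real \<epsilon>))
       = A r s - B r * cis (- \<theta>)" (is "?d = _")
    proof -
      have "A r s = of_real (\<gamma> / 2) * of_real (r powr \<gamma>) + \<i> / 2 * (of_real s + \<i> * of_real (r powr \<gamma>) - (Complex t (\<rho> powr \<gamma>) + \<i> * of_real \<epsilon>))"
        by (simp add: A_def base_def complex_eq_iff field_simps)
      then show ?thesis by (simp add: B_def algebra_simps)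
    qed
    show "indicator param_dom p *\<^sub>R (case p of (r, \<theta>, s) \<Rightarrow> f (param \<gamma> (r, \<theta>, s)) * of_real (r powr (\<gamma> - 1)) /
          (of_real (\<gamma> / 2) * (of_real (r powr \<gamma>) - of_real (r powr (\<gamma> - 1)) * cis (- \<theta>) * fst (of_real \<rho> * cis \<phi>, Complex t (\<rho> powr \<gamma>) + \<i> * of_real \<epsilon>))
           + \<i> / 2 * (of_real s + \<i> * of_real (r powr \<gamma>) - snd (of_real \<rho> * cis \<phi>, Complex t (\<rho> powr \<gamma>) + \<i> * of_real \<epsilon>)))\<^sup>2) = H p"
    proof (cases "r > 0 \<and> 0 \<le> \<theta> \<and> \<theta> < 2 * pi")
      case True
      then have "p \<in> param_dom" by (simp add: p param_dom_def)
      then show ?thesis unfolding p prod.case den f[OF conjunct1[OF True] conjunct1[OF conjunct2[OF True]] conjunct2[OF conjunct2[OF True]]]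
        using True by (simp add: H_def mult_ac)
    next
      case False
      then have "p \<notin> param_dom" by (auto simp: p param_dom_def)
      moreover have "H p = 0" using False F_zero(1)[of r s] r0 by (auto simp: p H_def)
      ultimately show ?thesis by simp
    qed
  qed
  also have "\<dots> = of_real (\<gamma>\<^sup>2 / (16 * pi\<^sup>2)) * (of_real (2 * pi * real (k + 1) * (\<gamma> / 2) ^ k * 2 ^ (k + 2) * \<rho> ^ k)) * cis (real k * \<phi>) *
      (\<integral>q. \<Phi> q / Complex (base \<rho> (fst q) + \<epsilon>) (snd q - t) ^ (k + 2) \<partial>lborel)"
    unfolding HI by (simp only: mult.assoc)
  also have "of_real (\<gamma>\<^sup>2 / (16 * pi\<^sup>2)) * (of_real (2 * pi * real (k + 1) * (\<gamma> / 2) ^ k * 2 ^ (k + 2) * \<rho> ^ k))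
      = complex_of_real (\<gamma> ^ (k + 2) * real (k + 1) / (2 * pi) * \<rho> ^ k)"
    unfolding of_real_mult[symmetric]
    by (rule arg_cong[where f = of_real]) (simp add: power_divide power2_eq_square field_simps)
  finally show ?thesis .
qed

end

lemma power_exp_bounded:
  fixes c :: real assumes "c > 0" "x \<ge> 0"
  shows "x ^ n * exp (- (x * c)) \<le> fact n / c ^ n"
proof -
  have "(\<Sum>i\<in>{n}. (x * c) ^ i /\<^sub>R fact i) \<le> (\<Sum>i. (x * c) ^ i /\<^sub>R fact i)"
    using assms by (intro sum_le_suminf summable_exp_generic) auto
  then have "(x * c) ^ n / fact n \<le> exp (x * c)" by (simp add: exp_def divide_inverse_commute)
  then show ?thesis using assms by (simp add: exp_minus field_simps power_mult_distrib)
qed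

context compact_profile
begin

abbreviation "prof \<equiv> profile \<gamma> k F"
abbreviation "dens \<equiv> leray_density \<gamma> k F"

definition \<beta> :: real where "\<beta> = (\<gamma> - 1) * r0 powr \<gamma>"

lemma \<beta>_pos: "\<beta> > 0" using gamma r0 by (simp add: \<beta>_def)

lemma base_ge: "r0 \<le> r \<Longrightarrow> \<beta> \<le> base \<rho> r"
  unfolding \<beta>_def base_def using gamma r0
  by (intro add_increasing2 mult_left_mono powr_mono2) auto

lemma kernel_bound:
  assumes "\<epsilon> \<ge> 0"
  shows "norm (\<Phi> p / Complex (base \<rho> (fst p) + \<epsilon>) y ^ n) \<le> norm (\<Phi> p) / \<beta> ^ n"
proof (cases "\<Phi> p = 0")
  case False
  then have "\<beta> \<le> Re (Complex (base \<rho> (fst p) + \<epsilon>) y)" using base_ge[OF \<Phi>_zero] assms by (simp add: add_increasing2)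
  also have "\<dots> \<le> norm (Complex (base \<rho> (fst p) + \<epsilon>) y)" by (rule complex_Re_le_cmod)
  finally have "\<beta> ^ n \<le> norm (Complex (base \<rho> (fst p) + \<epsilon>) y) ^ n" using \<beta>_pos by (intro power_mono) auto
  moreover have "\<beta> ^ n > 0" using \<beta>_pos by simp
  ultimately show ?thesis unfolding norm_divide norm_power
    by (intro divide_left_mono) (auto intro!: mult_pos_pos simp del: norm_Pair1 intro: less_le_trans)
qed simp

text \<open>On the support of \<open>F\<close> the real part of the denominator is at least \<open>\<beta>\<close>, so no singular integral
  arises in the boundary limit.\<close>

lemma kernel_tendsto:
  "((\<lambda>\<epsilon>. \<integral>p. \<Phi> p / Complex (base \<rho> (fst p) + \<epsilon>) (snd p - t) ^ (k + 2) \<partial>lborel) \<longlongrightarrow>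
    (\<integral>p. \<Phi> p / Complex (base \<rho> (fst p)) (snd p - t) ^ (k + 2) \<partial>lborel)) (at_right 0)"
  unfolding tendsto_at_iff_sequentially
proof (intro allI impI)
  fix X :: "nat \<Rightarrow> real"
  assume X: "\<forall>i. X i \<in> {0<..} - {0}" "X \<longlonglongrightarrow> 0"
  have [measurable]: "\<Phi> \<in> borel_measurable (borel \<Otimes>\<^sub>M borel)" by (simp add: borel_prod)
  have meas: "(\<lambda>p. \<Phi> p / Complex (base \<rho> (fst p) + e) (snd p - t) ^ (k + 2)) \<in> borel_measurable borel" for e
    unfolding Complex_eq base_def borel_prod[symmetric] by measurable
  have "(\<lambda>i. \<integral>p. \<Phi> p / Complex (base \<rho> (fst p) + X i) (snd p - t) ^ (k + 2) \<partial>lborel) \<longlonglongrightarrow>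
      (\<integral>p. \<Phi> p / Complex (base \<rho> (fst p)) (snd p - t) ^ (k + 2) \<partial>lborel)"
  proof (rule integral_dominated_convergence[where w = "\<lambda>p. norm (\<Phi> p) / \<beta> ^ (k + 2)"])
    show "integrable lborel (\<lambda>p. norm (\<Phi> p) / \<beta> ^ (k + 2))" using \<Phi>_integrable by simp
    show "AE p in lborel. norm (\<Phi> p / Complex (base \<rho> (fst p) + X i) (snd p - t) ^ (k + 2)) \<le> norm (\<Phi> p) / \<beta> ^ (k + 2)" for i
      using X(1) by (intro AE_I2 kernel_bound) (auto intro: less_imp_le)
    show "AE p in lborel. (\<lambda>i. \<Phi> p / Complex (base \<rho> (fst p) + X i) (snd p - t) ^ (k + 2)) \<longlonglongrightarrow>
        \<Phi> p / Complex (base \<rho> (fst p)) (snd p - t) ^ (k + 2)"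
    proof (rule AE_I2)
      fix p
      show "(\<lambda>i. \<Phi> p / Complex (base \<rho> (fst p) + X i) (snd p - t) ^ (k + 2)) \<longlonglongrightarrow>
        \<Phi> p / Complex (base \<rho> (fst p)) (snd p - t) ^ (k + 2)"
      proof (cases "\<Phi> p = 0")
        case False
        then have "base \<rho> (fst p) > 0" using base_ge[OF \<Phi>_zero, of p \<rho>] \<beta>_pos by linarith
        then have "Complex (base \<rho> (fst p)) (snd p - t) \<noteq> 0" by (simp add: complex_eq_iff)
        then have nz: "Complex (base \<rho> (fst p)) (snd p - t) ^ (k + 2) \<noteq> 0" by (rule power_not_zero)
        have "(\<lambda>i. base \<rho> (fst p) + X i) \<longlonglongrightarrow> base \<rho> (fst p) + 0" using X(2) by (intro tendsto_intros)
        then show ?thesis using nz by (intro tendsto_intros) auto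
      qed simp
    qed
  qed (use meas[of "X _"] meas[of 0] in auto)
  then show "((\<lambda>\<epsilon>. \<integral>p. \<Phi> p / Complex (base \<rho> (fst p) + \<epsilon>) (snd p - t) ^ (k + 2) \<partial>lborel) \<circ> X) \<longlonglongrightarrow>
      (\<integral>p. \<Phi> p / Complex (base \<rho> (fst p)) (snd p - t) ^ (k + 2) \<partial>lborel)"
    by (simp add: o_def)
qed

text \<open>Write the power of the denominator as a Laplace integral over \<open>\<xi>\<close> and integrate in \<open>(r, s)\<close> first:
  the exponential of \<open>base \<rho> r\<close> factors into a function of \<open>r\<close> and a function of \<open>\<rho>\<close>.\<close>

lemma kernel_eq_fourier:
  "(\<integral>p. \<Phi> p / Complex (base \<rho> (fst p)) (snd p - t) ^ (k + 2) \<partial>lborel)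
     = fourier (dens \<rho>) t / fact (k + 1)"
proof -
  define z where "z = (\<lambda>p :: real \<times> real. Complex (base \<rho> (fst p)) (snd p - t))"
  define G where "G = (\<lambda>p \<xi>. \<Phi> p * (indicator {0<..} \<xi> *\<^sub>R (of_real \<xi> ^ (k + 1) * exp (- (z p * of_real \<xi>)))))"
  have [measurable]: "\<Phi> \<in> borel_measurable (borel \<Otimes>\<^sub>M borel)" by (simp add: borel_prod)
  have zm [measurable]: "z \<in> borel_measurable (borel \<Otimes>\<^sub>M borel)"
    unfolding z_def Complex_eq base_def by measurable
  have "(\<integral>p. \<Phi> p / Complex (base \<rho> (fst p)) (snd p - t) ^ (k + 2) \<partial>lborel)
     = (\<integral>p. (\<integral>\<xi>. G p \<xi> \<partial>lborel) / fact (k + 1) \<partial>lborel)"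
  proof (rule Bochner_Integration.integral_cong[OF refl])
    fix p
    have "(\<integral>\<xi>. G p \<xi> \<partial>lborel) = \<Phi> p * (fact (k + 1) / z p ^ (k + 2))"
    proof (cases "\<Phi> p = 0")
      case False
      then have "Re (z p) > 0" using base_ge[OF \<Phi>_zero, of p \<rho>] \<beta>_pos by (simp add: z_def)
      note laplace_power(2)[OF this, of "k + 1", unfolded set_lebesgue_integral_def]
      moreover have "(\<integral>\<xi>. G p \<xi> \<partial>lborel) = \<Phi> p * (\<integral>\<xi>. indicator {0<..} \<xi> *\<^sub>R (of_real \<xi> ^ (k + 1) * exp (- (z p * of_real \<xi>))) \<partial>lborel)"
        unfolding G_def by (rule integral_mult_right_zero)
      ultimately show ?thesis by simp
    qed (simp add: G_def)
    then show "\<Phi> p / Complex (base \<rho> (fst p)) (snd p - t) ^ (k + 2) = (\<integral>\<xi>. G p \<xi> \<partial>lborel) / fact (k + 1)"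
      by (simp add: z_def del: fact_Suc)
  qed
  also have "\<dots> = (\<integral>p. (\<integral>\<xi>. G p \<xi> \<partial>lborel) \<partial>lborel) / fact (k + 1)"
    by (rule integral_divide_zero)
  also have "(\<integral>p. (\<integral>\<xi>. G p \<xi> \<partial>lborel) \<partial>lborel) = (\<integral>\<xi>. (\<integral>p. G p \<xi> \<partial>lborel) \<partial>lborel)"
  proof (rule Fubini_dominated)
    show "case_prod G \<in> borel_measurable (lborel \<Otimes>\<^sub>M lborel)"
      unfolding G_def case_prod_beta' lborel_prod[symmetric] by measurable
    show "integrable lborel (\<lambda>p. norm (\<Phi> p))" using \<Phi>_integrable by simp
    show "integrable lborel (\<lambda>\<xi>. indicator {0<..} \<xi> *\<^sub>R (\<xi> ^ (k + 1) * exp (- (\<beta> * \<xi>))))"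
      using set_integrable_power_exp[OF \<beta>_pos] unfolding set_integrable_def .
    fix p \<xi>
    show "norm (G p \<xi>) \<le> norm (\<Phi> p) * (indicator {0<..} \<xi> *\<^sub>R (\<xi> ^ (k + 1) * exp (- (\<beta> * \<xi>))))"
    proof (cases "\<Phi> p = 0 \<or> \<xi> \<le> 0")
      case False
      then have "\<beta> * \<xi> \<le> Re (z p) * \<xi>" using base_ge[OF \<Phi>_zero, of p \<rho>] by (intro mult_right_mono) (auto simp: z_def)
      then show ?thesis using False
        by (auto simp: G_def norm_mult norm_power intro!: mult_left_mono)
    qed (auto simp: G_def)
  qed (auto intro: lborel.sigma_finite_measure_axioms)
  also have "\<dots> = fourier (dens \<rho>) t"
    unfolding fourier_def
  proof (rule Bochner_Integration.integral_cong[OF refl])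
    fix \<xi>
    show "(\<integral>p. G p \<xi> \<partial>lborel) = cis (\<xi> * t) * dens \<rho> \<xi>"
    proof (cases "\<xi> > 0")
      case True
      have "G p \<xi> = (cis (\<xi> * t) * of_real (\<xi> ^ (k + 1) * exp (- (\<xi> * \<rho> powr \<gamma>)))) * (F p * of_real (fst p powr (wexp \<gamma> k))
      * of_real (damping \<gamma> \<xi> (fst p)) * cis (- (\<xi> * snd p)))" for p
      proof -
        have "exp (- (z p * of_real \<xi>)) = of_real (exp (- (base \<rho> (fst p) * \<xi>))) * cis (- ((snd p - t) * \<xi>))"
          unfolding exp_eq_polar by (simp add: z_def)
        also have "exp (- (base \<rho> (fst p) * \<xi>)) = exp (- (\<xi> * ((\<gamma> - 1) * fst p powr \<gamma>))) * exp (- (\<xi> * \<rho> powr \<gamma>))"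
          by (simp add: base_def exp_add[symmetric] algebra_simps)
        also have "cis (- ((snd p - t) * \<xi>)) = cis (- (\<xi> * snd p)) * cis (\<xi> * t)"
          by (simp add: cis_mult algebra_simps)
        finally show ?thesis using True by (simp add: G_def \<Phi>_def max_def mult_ac)
      qed
      then have "(\<integral>p. G p \<xi> \<partial>lborel) = (cis (\<xi> * t) * of_real (\<xi> ^ (k + 1) * exp (- (\<xi> * \<rho> powr \<gamma>)))) * prof \<xi>"
        unfolding profile_def by (simp only: integral_mult_right_zero)
      then show ?thesis using True by (simp add: leray_density_def max_def mult_ac)
    next
      case False
      then have "G p \<xi> = 0" for p by (simp add: G_def)
      then show ?thesis using False by (simp add: leray_density_def max_def)
    qed
  qed
  finally show ?thesis .
qed

text \<open>The constant is \<open>\<gamma>\<^sup>k\<^sup>+\<^sup>2 (k + 1) / (2 \<pi>)\<close> from the angular integral, divided by \<open>(k + 1)!\<close> from the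
  Laplace integral.\<close>

lemma leray_bdry_eq_fourier:
  assumes f: "\<And>r \<theta> s. r > 0 \<Longrightarrow> 0 \<le> \<theta> \<Longrightarrow> \<theta> < 2 * pi \<Longrightarrow> f (param \<gamma> (r, \<theta>, s)) = F (r, s) * cis (real k * \<theta>)"
    and \<rho>: "\<rho> \<ge> 0"
  shows "leray_bdry \<gamma> f (param \<gamma> (\<rho>, \<phi>, t)) =
    of_real (\<gamma> ^ (k + 2) / (2 * pi * fact k) * \<rho> ^ k) * cis (real k * \<phi>) * fourier (dens \<rho>) t"
proof -
  define c where "c = complex_of_real (\<gamma> ^ (k + 2) * real (k + 1) / (2 * pi) * \<rho> ^ k) * cis (real k * \<phi>)"
  define V where "V = (\<integral>p. \<Phi> p / Complex (base \<rho> (fst p)) (snd p - t) ^ (k + 2) \<partial>lborel)"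
  have "((\<lambda>\<epsilon>. c * (\<integral>p. \<Phi> p / Complex (base \<rho> (fst p) + \<epsilon>) (snd p - t) ^ (k + 2) \<partial>lborel)) \<longlongrightarrow> c * V) (at_right 0)"
    unfolding V_def by (intro tendsto_mult tendsto_const kernel_tendsto)
  then have "((\<lambda>\<epsilon>. leray \<gamma> f (of_real \<rho> * cis \<phi>, Complex t (\<rho> powr \<gamma>) + \<i> * of_real \<epsilon>)) \<longlongrightarrow> c * V) (at_right 0)"
  proof (rule Lim_transform_eventually)
    show "\<forall>\<^sub>F \<epsilon> in at_right 0. c * (\<integral>p. \<Phi> p / Complex (base \<rho> (fst p) + \<epsilon>) (snd p - t) ^ (k + 2) \<partial>lborel)
       = leray \<gamma> f (of_real \<rho> * cis \<phi>, Complex t (\<rho> powr \<gamma>) + \<i> * of_real \<epsilon>)"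
      using eventually_at_right_less[of "0::real"]
      by eventually_elim (use leray_off_boundary[OF f _ \<rho>] in \<open>auto simp: c_def\<close>)
  qed
  then have "leray_bdry \<gamma> f (param \<gamma> (\<rho>, \<phi>, t)) = c * V"
    unfolding leray_bdry_def param_def by (intro tendsto_Lim) auto
  also have "\<dots> = of_real (\<gamma> ^ (k + 2) / (2 * pi * fact k) * \<rho> ^ k) * cis (real k * \<phi>) * fourier (dens \<rho>) t"
  proof -
    have "fact (k + 1) = real (k + 1) * fact k" by simp
    then have "real (k + 1) / fact (k + 1) = 1 / fact k"
      using nonzero_divide_mult_cancel_left[of "real (k + 1)" "fact k"] by simp
    moreover have "\<gamma> ^ (k + 2) * real (k + 1) / (2 * pi) * \<rho> ^ k / fact (k + 1)
        = \<gamma> ^ (k + 2) / (2 * pi) * \<rho> ^ k * (real (k + 1) / fact (k + 1))"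
      by (simp del: fact_Suc)
    ultimately have "\<gamma> ^ (k + 2) * real (k + 1) / (2 * pi) * \<rho> ^ k / fact (k + 1) = \<gamma> ^ (k + 2) / (2 * pi * fact k) * \<rho> ^ k"
      by (simp del: fact_Suc)
    then have "complex_of_real (\<gamma> ^ (k + 2) * real (k + 1) / (2 * pi) * \<rho> ^ k) / fact (k + 1) = of_real (\<gamma> ^ (k + 2) / (2 * pi * fact k) * \<rho> ^ k)"
      by (metis of_real_divide of_real_fact)
    moreover have "x * y * (v / n) = (x / n) * y * v" for x y v n :: complex by simp
    ultimately show ?thesis unfolding V_def kernel_eq_fourier c_def by (simp only:)
  qed
  finally show ?thesis .
qed

lemma profile_alt: "prof \<xi> = (\<integral>p. \<Phi> p * (of_real (damping \<gamma> \<xi> (fst p)) * cis (- (\<xi> * snd p))) \<partial>lborel)"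
  by (simp add: profile_def \<Phi>_def mult.assoc)

lemma profile_factor_bound:
  "norm (of_real (damping \<gamma> \<xi> r) * cis (- (\<xi> * s))) \<le> 1"
  using gamma by (simp add: norm_mult)

lemma profile_bound: "norm (prof \<xi>) \<le> (\<integral>p. norm (\<Phi> p) \<partial>lborel)"
  unfolding profile_alt
proof (rule order_trans[OF integral_norm_bound integral_mono'])
  fix p
  show "norm (\<Phi> p * (of_real (damping \<gamma> \<xi> (fst p)) * cis (- (\<xi> * snd p)))) \<le> norm (\<Phi> p)"
    using mult_left_mono[OF profile_factor_bound[of \<xi> "fst p" "snd p"], of "norm (\<Phi> p)"] by (simp only: norm_mult norm_ge_zero mult_1_right)
qed (use \<Phi>_integrable in auto)

lemma profile_continuous: "continuous_on UNIV (prof)"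
proof (rule continuous_at_imp_continuous_on, rule ballI)
  fix \<xi> :: real
  have [measurable]: "\<Phi> \<in> borel_measurable (borel \<Otimes>\<^sub>M borel)" by (simp add: borel_prod)
  have meas: "(\<lambda>p. \<Phi> p * (of_real (damping \<gamma> x (fst p)) * cis (- (x * snd p)))) \<in> borel_measurable borel" for x
    unfolding borel_prod[symmetric] by measurable
  show "isCont (prof) \<xi>"
    unfolding continuous_at_sequentially
  proof (intro allI impI)
    fix X :: "nat \<Rightarrow> real" assume X: "X \<longlonglongrightarrow> \<xi>"
    have "(\<lambda>i. prof (X i)) \<longlonglongrightarrow> prof \<xi>"
      unfolding profile_alt
    proof (rule integral_dominated_convergence[where w = "\<lambda>p. norm (\<Phi> p)"])
      show "AE p in lborel. (\<lambda>i. \<Phi> p * (of_real (damping \<gamma> (X i) (fst p)) * cis (- (X i * snd p))))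
         \<longlonglongrightarrow> \<Phi> p * (of_real (damping \<gamma> \<xi> (fst p)) * cis (- (\<xi> * snd p)))"
        unfolding cis_conv_exp by (intro AE_I2 tendsto_intros X)
      show "AE p in lborel. norm (\<Phi> p * (of_real (damping \<gamma> (X i) (fst p)) * cis (- (X i * snd p)))) \<le> norm (\<Phi> p)" for i
        using mult_left_mono[OF profile_factor_bound[of "X i"], of "norm (\<Phi> _)"] by (intro AE_I2) (simp only: norm_mult norm_ge_zero mult_1_right)
    qed (use \<Phi>_integrable meas in auto)
    then show "(prof \<circ> X) \<longlonglongrightarrow> prof \<xi>" by (simp add: o_def)
  qed
qed

lemma leray_density_plancherel_hyps:
  assumes \<rho>: "\<rho> > 0"
  shows "integrable lborel (dens \<rho>)" "\<exists>B. \<forall>\<xi>. norm (dens \<rho> \<xi>) \<le> B"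
    "continuous_on UNIV (dens \<rho>)"
proof -
  define C where "C = (\<integral>p. norm (\<Phi> p) \<partial>lborel)"
  have C: "norm (prof \<xi>) \<le> C" for \<xi> unfolding C_def by (rule profile_bound)
  have C0: "C \<ge> 0" using C[of 0] norm_ge_zero order_trans by blast
  show cont: "continuous_on UNIV (dens \<rho>)"
    unfolding leray_density_def[abs_def] by (intro continuous_intros profile_continuous)
  have [measurable]: "dens \<rho> \<in> borel_measurable borel"
    by (rule borel_measurable_continuous_onI[OF cont])
  have nrm: "norm (dens \<rho> \<xi>) \<le> (max \<xi> 0 ^ (k + 1) * exp (- (max \<xi> 0 * \<rho> powr \<gamma>))) * C" for \<xi>
    unfolding leray_density_def norm_mult norm_of_real
    by (intro mult_mono C) (auto simp: abs_mult)
  have "norm (dens \<rho> \<xi>) \<le> fact (k + 1) / (\<rho> powr \<gamma>) ^ (k + 1) * C" for \<xi>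
    using power_exp_bounded[of "\<rho> powr \<gamma>" "max \<xi> 0" "k + 1"] \<rho>
    by (intro order_trans[OF nrm] mult_right_mono C0) auto
  then show "\<exists>B. \<forall>\<xi>. norm (dens \<rho> \<xi>) \<le> B" by blast
  have i: "integrable lborel (\<lambda>\<xi>. (indicator {0<..} \<xi> *\<^sub>R (\<xi> ^ (k + 1) * exp (- (\<rho> powr \<gamma> * \<xi>)))) * C)"
    using set_integrable_power_exp[of "\<rho> powr \<gamma>" "k + 1"] \<rho> unfolding set_integrable_def
    by (intro integrable_mult_left) auto
  show "integrable lborel (dens \<rho>)"
  proof (rule Bochner_Integration.integrable_bound[OF i])
    show "AE \<xi> in lborel. norm (dens \<rho> \<xi>) \<le> norm ((indicator {0<..} \<xi> *\<^sub>R (\<xi> ^ (k + 1) * exp (- (\<rho> powr \<gamma> * \<xi>)))) * C)"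
    proof (rule AE_I2)
      fix \<xi>
      show "norm (dens \<rho> \<xi>) \<le> norm ((indicator {0<..} \<xi> *\<^sub>R (\<xi> ^ (k + 1) * exp (- (\<rho> powr \<gamma> * \<xi>)))) * C)"
      proof (cases "\<xi> > 0")
        case True
        then show ?thesis using nrm[of \<xi>] C0 by (simp add: max_def abs_mult mult.commute)
      next
        case False
        then show ?thesis by (simp add: leray_density_def max_def)
      qed
    qed
  qed simp
qed

end

section \<open>Energies of boundary values\<close>

lemma hypersurface_param:
  assumes "fst \<zeta> \<noteq> 0" "Im (snd \<zeta>) = norm (fst \<zeta>) powr \<gamma>"
  obtains r \<theta> s where "r > 0" "0 \<le> \<theta>" "\<theta> < 2 * pi" "\<zeta> = param \<gamma> (r, \<theta>, s)"
proof
  show "norm (fst \<zeta>) > 0" "0 \<le> Arg2pi (fst \<zeta>)" "Arg2pi (fst \<zeta>) < 2 * pi"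
    using assms Arg2pi[of "fst \<zeta>"] by auto
  have "fst \<zeta> = of_real (norm (fst \<zeta>)) * cis (Arg2pi (fst \<zeta>))"
    using Arg2pi[of "fst \<zeta>"] unfolding is_Arg_def cis_conv_exp by blast
  then show "\<zeta> = param \<gamma> (norm (fst \<zeta>), Arg2pi (fst \<zeta>), Re (snd \<zeta>))"
    using assms(2) by (simp add: param_def prod_eq_iff complex_eq_iff)
qed

lemma AE_hyp_measure: "AE \<zeta> in hyp_measure \<gamma> d. fst \<zeta> \<noteq> 0 \<and> Im (snd \<zeta>) = norm (fst \<zeta>) powr \<gamma>"
proof -
  have [measurable]: "param_dom \<in> sets borel"
    unfolding param_dom_def by (auto simp: borel_prod[symmetric])
  have "{\<zeta> \<in> space (borel \<Otimes>\<^sub>M borel :: (complex \<times> complex) measure). fst \<zeta> \<noteq> 0 \<and> Im (snd \<zeta>) = norm (fst \<zeta>) powr \<gamma>} \<in> sets (borel \<Otimes>\<^sub>M borel)"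
    by measurable
  then have S: "{\<zeta> \<in> space borel. fst \<zeta> \<noteq> 0 \<and> Im (snd \<zeta>) = norm (fst \<zeta>) powr \<gamma>} \<in> sets (borel :: (complex \<times> complex) measure)"
    unfolding borel_prod by simp
  have dm: "(\<lambda>p :: real \<times> real \<times> real. ennreal (fst p powr d)) \<in> borel_measurable (restrict_space lborel param_dom)"
    by (intro measurable_restrict_space1) (simp add: borel_prod[symmetric])
  have "AE p in density (restrict_space lborel param_dom) (\<lambda>p. ennreal (fst p powr d)).
      fst (param \<gamma> p) \<noteq> 0 \<and> Im (snd (param \<gamma> p)) = norm (fst (param \<gamma> p)) powr \<gamma>"
    unfolding AE_density[OF dm]
    by (rule AE_I2) (auto simp: space_restrict_space param_dom_def param_def norm_mult)
  moreover have "param \<gamma> \<in> measurable (density (restrict_space lborel param_dom) (\<lambda>p. ennreal (fst p powr d))) borel"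
    unfolding measurable_density_eq1 by (intro measurable_restrict_space1) simp
  ultimately show ?thesis
    unfolding hyp_measure_def case_prod_unfold by (subst AE_distr_iff[OF _ S]) auto
qed

abbreviation circle_integral :: "(complex \<times> real \<Rightarrow> ennreal) \<Rightarrow> real \<Rightarrow> ennreal" where
  "circle_integral g r \<equiv>
     \<integral>\<^sup>+\<theta>. indicator {0..<2*pi} \<theta> * (\<integral>\<^sup>+s. g (of_real r * cis \<theta>, s) \<partial>lborel) \<partial>lborel"

abbreviation polar_integral :: "real \<Rightarrow> (complex \<times> real \<Rightarrow> ennreal) \<Rightarrow> ennreal" where
  "polar_integral d g \<equiv>
     \<integral>\<^sup>+r. ennreal (r powr d) * indicator {0<..} r * circle_integral g r \<partial>lborel"

text \<open>The integrand \<open>u\<close> may be arbitrary off the hypersurface; only its expression \<open>g\<close> in the chart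
  \<open>(\<zeta>\<^sub>1, Re \<zeta>\<^sub>2)\<close> has to be measurable.\<close>

lemma nn_integral_hyp_measure_iterated:
  fixes u :: "complex \<times> complex \<Rightarrow> ennreal" and g :: "complex \<times> real \<Rightarrow> ennreal"
  assumes g: "g \<in> borel_measurable borel"
    and u: "\<And>r \<theta> s. r > 0 \<Longrightarrow> 0 \<le> \<theta> \<Longrightarrow> \<theta> < 2 * pi \<Longrightarrow> u (param \<gamma> (r, \<theta>, s)) = g (of_real r * cis \<theta>, s)"
  shows "(\<integral>\<^sup>+\<zeta>. u \<zeta> \<partial>hyp_measure \<gamma> d) =
    polar_integral d g"
proof -
  have g' [measurable]: "g \<in> borel_measurable (borel \<Otimes>\<^sub>M borel)" using g by (simp add: borel_prod)
  define G where "G = (\<lambda>\<zeta> :: complex \<times> complex. g (fst \<zeta>, Re (snd \<zeta>)))"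
  have "G \<in> borel_measurable (borel \<Otimes>\<^sub>M borel)" unfolding G_def by measurable
  then have Gm: "G \<in> borel_measurable borel" by (simp add: borel_prod)
  have uG: "u (param \<gamma> (r, \<theta>, s)) = G (param \<gamma> (r, \<theta>, s))" if "r > 0" "0 \<le> \<theta>" "\<theta> < 2 * pi" for r \<theta> s
    using u[OF that] by (simp add: G_def param_def)
  have "(\<integral>\<^sup>+\<zeta>. u \<zeta> \<partial>hyp_measure \<gamma> d) = (\<integral>\<^sup>+\<zeta>. G \<zeta> \<partial>hyp_measure \<gamma> d)"
  proof (rule nn_integral_cong_AE)
    show "AE \<zeta> in hyp_measure \<gamma> d. u \<zeta> = G \<zeta>"
      using AE_hyp_measure[of \<gamma> d]
    proof eventually_elim
      case (elim \<zeta>)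
      then obtain r \<theta> s where "r > 0" "0 \<le> \<theta>" "\<theta> < 2 * pi" "\<zeta> = param \<gamma> (r, \<theta>, s)"
        using hypersurface_param by blast
      then show ?case using uG by simp
    qed
  qed
  also have "\<dots> = (\<integral>\<^sup>+p. ennreal (fst p powr d) * G (param \<gamma> p) * indicator param_dom p \<partial>lborel)"
    by (rule nn_integral_hyp_measure[OF Gm])
  also have "\<dots> = (\<integral>\<^sup>+p. (ennreal (fst p powr d) * indicator {0<..} (fst p)) *
      (indicator {0..<2*pi} (fst (snd p)) * g (of_real (fst p) * cis (fst (snd p)), snd (snd p)))
      \<partial>(lborel \<Otimes>\<^sub>M (lborel \<Otimes>\<^sub>M lborel)))"
    unfolding lborel_prod
    by (intro nn_integral_cong) (auto simp: G_def param_def param_dom_def split: split_indicator)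
  also have "\<dots> = (\<integral>\<^sup>+r. \<integral>\<^sup>+q. (ennreal (r powr d) * indicator {0<..} r) *
      (indicator {0..<2*pi} (fst q) * g (of_real r * cis (fst q), snd q)) \<partial>(lborel \<Otimes>\<^sub>M lborel) \<partial>lborel)"
  proof -
    have "sigma_finite_measure (lborel \<Otimes>\<^sub>M lborel :: (real \<times> real) measure)"
      unfolding lborel_prod by (rule lborel.sigma_finite_measure_axioms)
    then show ?thesis by (subst sigma_finite_measure.nn_integral_fst[symmetric]) simp_all
  qed
  also have "\<dots> = (\<integral>\<^sup>+r. (ennreal (r powr d) * indicator {0<..} r) * (\<integral>\<^sup>+q.
      (indicator {0..<2*pi} (fst q) * g (of_real r * cis (fst q), snd q)) \<partial>(lborel \<Otimes>\<^sub>M lborel)) \<partial>lborel)"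
    by (intro nn_integral_cong nn_integral_cmult) measurable
  also have "\<dots> = (\<integral>\<^sup>+r. (ennreal (r powr d) * indicator {0<..} r) * (\<integral>\<^sup>+\<theta>. \<integral>\<^sup>+s.
      (indicator {0..<2*pi} \<theta> * g (of_real r * cis \<theta>, s)) \<partial>lborel \<partial>lborel) \<partial>lborel)"
    by (subst lborel.nn_integral_fst[symmetric]) simp_all
  also have "\<dots> = (\<integral>\<^sup>+r. (ennreal (r powr d) * indicator {0<..} r) * (\<integral>\<^sup>+\<theta>.
      (indicator {0..<2*pi} \<theta> * (\<integral>\<^sup>+s. g (of_real r * cis \<theta>, s) \<partial>lborel)) \<partial>lborel) \<partial>lborel)"
    by (subst nn_integral_cmult) simp_all
  finally show ?thesis .
qed

lemma ennreal_mult_regroup: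
  assumes "0 \<le> a" "0 \<le> b" "0 \<le> c" "0 \<le> e"
  shows "ennreal a * (ennreal b * (ennreal c * (ennreal e * X))) = ennreal (a * (b * (c * e))) * X"
  using assms by (simp add: ennreal_mult mult.assoc)

lemma norm_integral_le_nn_integral:
  "ennreal (norm (\<integral>x. f x \<partial>M)) \<le> (\<integral>\<^sup>+x. ennreal (norm (f x)) \<partial>M)"
  by (cases "integrable M f") (simp_all add: integral_norm_bound_ennreal not_integrable_integral_eq)

lemma nn_integral_period_const:
  "(\<integral>\<^sup>+\<theta>. indicator {0..<2*pi} \<theta> * c \<partial>lborel) = ennreal (2 * pi) * c"
  by (subst nn_integral_multc) auto

text \<open>The squared norm in \<open>L\<^sup>2(\<rho>\<^sup>d d\<rho>)\<close> of the factor in \<open>\<rho>\<close> of the rank one operator, with its constants;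
  \<open>dual_weight\<close> is that of the factor in \<open>r\<close>. Both depend on \<open>\<xi>\<close>, with opposite powers.\<close>

definition symbol_weight :: "real \<Rightarrow> real \<Rightarrow> nat \<Rightarrow> real \<Rightarrow> real" where
  "symbol_weight d \<gamma> k \<xi> = (\<gamma> ^ (k + 2) / fact k)\<^sup>2 * \<xi> ^ (2 * k + 2) *
     (Gamma ((2 * real k + 1 + d) / \<gamma>) / \<gamma> * (2 * \<xi>) powr (- ((2 * real k + 1 + d) / \<gamma>)))"

definition dual_weight :: "real \<Rightarrow> real \<Rightarrow> nat \<Rightarrow> real \<Rightarrow> real" where
  "dual_weight d \<gamma> k \<xi> = Gamma (2 * real k + 2 - (2 * real k + 1 + d) / \<gamma>) / \<gamma> *
     (2 * \<xi> * (\<gamma> - 1)) powr (- (2 * real k + 2 - (2 * real k + 1 + d) / \<gamma>))"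

lemma symbol_weight_times_dual_weight:
  assumes "\<gamma> > 1" "\<xi> > 0"
  shows "symbol_weight d \<gamma> k \<xi> * dual_weight d \<gamma> k \<xi> = leray_symbol d \<gamma> k"
proof -
  define x where "x = (2 * real k + 1 + d) / \<gamma>"
  define y where "y = 2 * real k + 2 - x"
  have xy: "(2 * \<xi>) powr (- x) * (2 * \<xi>) powr (- y) = 1 / (2 * \<xi>) ^ (2 * k + 2)"
  proof -
    have "(2 * \<xi>) powr (- x) * (2 * \<xi>) powr (- y) = (2 * \<xi>) powr (- real (2 * k + 2))"
      unfolding powr_add[symmetric] by (rule arg_cong[where f = "(powr) (2 * \<xi>)"]) (simp add: y_def)
    also have "\<dots> = 1 / (2 * \<xi>) ^ (2 * k + 2)"
      using assms by (simp only: powr_minus_divide powr_realpow mult_pos_pos zero_less_numeral)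
    finally show ?thesis .
  qed
  have "(2 * \<xi> * (\<gamma> - 1)) powr (- y) = (2 * \<xi>) powr (- y) * (\<gamma> - 1) powr (- y)"
    using assms by (simp add: powr_mult)
  then have "symbol_weight d \<gamma> k \<xi> * dual_weight d \<gamma> k \<xi>
    = (\<gamma> ^ (k + 2) / fact k)\<^sup>2 * \<xi> ^ (2 * k + 2) * (Gamma x * Gamma y / \<gamma>\<^sup>2) * (\<gamma> - 1) powr (- y) *
      ((2 * \<xi>) powr (- x) * (2 * \<xi>) powr (- y))"
    unfolding symbol_weight_def dual_weight_def x_def[symmetric] y_def[symmetric]
    by (simp add: power2_eq_square)
  also have "\<dots> = Gamma x * Gamma y / (fact k)\<^sup>2 * (\<gamma> / 2) ^ (2 * k + 2) * (\<gamma> - 1) powr (- y)"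
  proof -
    have "(\<gamma> ^ (k + 2))\<^sup>2 = \<gamma> ^ (2 * k + 2) * \<gamma>\<^sup>2" by (simp add: power_mult[symmetric] power_add[symmetric] algebra_simps)
    moreover have "(2 * \<xi>) ^ (2 * k + 2) = 2 ^ (2 * k + 2) * \<xi> ^ (2 * k + 2)" by (rule power_mult_distrib)
    moreover have "(\<gamma> / 2) ^ (2 * k + 2) = \<gamma> ^ (2 * k + 2) / 2 ^ (2 * k + 2)" by (rule power_divide)
    ultimately show ?thesis unfolding xy power_divide[of "\<gamma> ^ (k + 2)"] using assms by simp
  qed
  finally show ?thesis unfolding leray_symbol_def x_def[symmetric] y_def[symmetric]
    by (simp add: Gamma_fact add.commute)
qed

context compact_profile
begin

lemma profile_measurable [measurable]: "prof \<in> borel_measurable borel"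
  by (rule borel_measurable_continuous_onI[OF profile_continuous])

text \<open>Plancherel in \<open>t\<close> for fixed \<open>\<rho>\<close>, followed by the integration in \<open>\<rho>\<close>, which is a Gamma integral for
  each frequency.\<close>

lemma norm_leray_bdry_eq:
  assumes f: "\<And>r \<theta> s. r > 0 \<Longrightarrow> 0 \<le> \<theta> \<Longrightarrow> \<theta> < 2 * pi \<Longrightarrow> f (param \<gamma> (r, \<theta>, s)) = F (r, s) * cis (real k * \<theta>)"
    and d: "d > -1"
  shows "energy (hyp_measure \<gamma> d) (leray_bdry \<gamma> f) =
    (\<integral>\<^sup>+\<xi>. indicator {0<..} \<xi> * ennreal (symbol_weight d \<gamma> k \<xi>) * ennreal ((norm (prof \<xi>))\<^sup>2) \<partial>lborel)"
proof -
  define c where "c = \<gamma> ^ (k + 2) / (2 * pi * fact k)"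
  define g where "g = (\<lambda>q :: complex \<times> real. ennreal ((c * norm (fst q) ^ k * norm (fourier (dens (norm (fst q))) (snd q)))\<^sup>2))"
  have dens [measurable]: "(\<lambda>p. dens (fst p) (snd p)) \<in> borel_measurable (borel \<Otimes>\<^sub>M borel)"
    unfolding leray_density_def by measurable
  have "g \<in> borel_measurable (borel \<Otimes>\<^sub>M borel)"
    unfolding g_def fourier_def leray_density_def by measurable
  then have gm: "g \<in> borel_measurable borel" by (simp add: borel_prod)
  have dens' [measurable]: "(\<lambda>p. dens (snd p) (fst p)) \<in> borel_measurable (borel \<Otimes>\<^sub>M borel)"
    unfolding leray_density_def by measurable
  have "energy (hyp_measure \<gamma> d) (leray_bdry \<gamma> f) =
    polar_integral d g"
  proof (rule nn_integral_hyp_measure_iterated[OF gm])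
    fix r \<theta> s :: real assume r: "r > 0"
    have "norm (leray_bdry \<gamma> f (param \<gamma> (r, \<theta>, s))) = c * r ^ k * norm (fourier (dens r) s)"
      using leray_bdry_eq_fourier[OF f less_imp_le[OF r], of \<theta> s] gamma r
      by (simp add: norm_mult norm_divide norm_power c_def)
    then show "ennreal ((norm (leray_bdry \<gamma> f (param \<gamma> (r, \<theta>, s))))\<^sup>2) = g (of_real r * cis \<theta>, s)"
      using r by (simp add: g_def norm_mult)
  qed
  also have "\<dots> = (\<integral>\<^sup>+r. (\<integral>\<^sup>+\<xi>. indicator {0<..} r * (ennreal (r powr d * (\<gamma> ^ (k + 2) / fact k)\<^sup>2 * r ^ (2 * k)) * ennreal ((norm (dens r \<xi>))\<^sup>2)) \<partial>lborel) \<partial>lborel)"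
  proof (rule nn_integral_cong)
    fix r :: real
    show "ennreal (r powr d) * indicator {0<..} r * circle_integral g r
       = (\<integral>\<^sup>+\<xi>. indicator {0<..} r * (ennreal (r powr d * (\<gamma> ^ (k + 2) / fact k)\<^sup>2 * r ^ (2 * k)) * ennreal ((norm (dens r \<xi>))\<^sup>2)) \<partial>lborel)"
    proof (cases "r > 0")
      case True
      obtain B where B: "\<And>\<xi>. norm (dens r \<xi>) \<le> B"
        using leray_density_plancherel_hyps(2)[OF True] by blast
      note hyps = leray_density_plancherel_hyps(1)[OF True] B leray_density_plancherel_hyps(3)[OF True]
      have [measurable]: "dens r \<in> borel_measurable borel" using hyps(1) by auto
      have gs: "g (of_real r * cis \<theta>, s) = ennreal (c\<^sup>2 * r ^ (2 * k)) * ennreal ((norm (fourier (dens r) s))\<^sup>2)" for \<theta> s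
        using True by (simp add: g_def norm_mult power_mult_distrib ennreal_mult[symmetric] power_mult[symmetric] mult.commute[of k])
      have "(\<integral>\<^sup>+s. g (of_real r * cis \<theta>, s) \<partial>lborel) = ennreal (c\<^sup>2 * r ^ (2 * k)) * (ennreal (2 * pi) * energy lborel (dens r))" for \<theta>
        unfolding gs plancherel[OF hyps, symmetric] by (rule nn_integral_cmult) measurable
      then have "ennreal (r powr d) * indicator {0<..} r * circle_integral g r
        = ennreal (r powr d) * (ennreal (2 * pi) * (ennreal (c\<^sup>2 * r ^ (2 * k)) * (ennreal (2 * pi) * energy lborel (dens r))))"
        using True by (simp only: nn_integral_period_const) simp
      also have "\<dots> = ennreal (r powr d * (2 * pi * (c\<^sup>2 * r ^ (2 * k) * (2 * pi)))) * energy lborel (dens r)"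
        by (rule ennreal_mult_regroup) (use True in auto)
      also have "r powr d * (2 * pi * (c\<^sup>2 * r ^ (2 * k) * (2 * pi))) = r powr d * (\<gamma> ^ (k + 2) / fact k)\<^sup>2 * r ^ (2 * k)"
        by (simp add: c_def power2_eq_square)
      finally show ?thesis using True by (simp add: nn_integral_cmult)
    qed simp
  qed
  also have "\<dots> = (\<integral>\<^sup>+\<xi>. (\<integral>\<^sup>+r. indicator {0<..} r * (ennreal (r powr d * (\<gamma> ^ (k + 2) / fact k)\<^sup>2 * r ^ (2 * k)) * ennreal ((norm (dens r \<xi>))\<^sup>2)) \<partial>lborel) \<partial>lborel)"
    by (rule lborel_pair.Fubini') (use dens in measurable)
  also have "\<dots> = (\<integral>\<^sup>+\<xi>. indicator {0<..} \<xi> * ennreal (symbol_weight d \<gamma> k \<xi>) * ennreal ((norm (prof \<xi>))\<^sup>2) \<partial>lborel)"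
  proof (rule nn_integral_cong)
    fix \<xi> :: real
    show "(\<integral>\<^sup>+r. indicator {0<..} r * (ennreal (r powr d * (\<gamma> ^ (k + 2) / fact k)\<^sup>2 * r ^ (2 * k)) * ennreal ((norm (dens r \<xi>))\<^sup>2)) \<partial>lborel)
       = indicator {0<..} \<xi> * ennreal (symbol_weight d \<gamma> k \<xi>) * ennreal ((norm (prof \<xi>))\<^sup>2)"
    proof (cases "\<xi> > 0")
      case True
      define a where "a = 2 * real k + 1 + d"
      have a: "a > 0" using d by (simp add: a_def)
      define C where "C = (\<gamma> ^ (k + 2) / fact k)\<^sup>2 * \<xi> ^ (2 * k + 2) * (norm (prof \<xi>))\<^sup>2"
      have C: "C \<ge> 0" using True by (simp add: C_def)
      have "(\<integral>\<^sup>+r. indicator {0<..} r * (ennreal (r powr d * (\<gamma> ^ (k + 2) / fact k)\<^sup>2 * r ^ (2 * k)) * ennreal ((norm (dens r \<xi>))\<^sup>2)) \<partial>lborel)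
        = (\<integral>\<^sup>+r. ennreal C * (ennreal (r powr (a - 1) * exp (- (2 * \<xi> * r powr \<gamma>))) * indicator {0<..} r) \<partial>lborel)"
      proof (rule nn_integral_cong)
        fix r :: real
        show "indicator {0<..} r * (ennreal (r powr d * (\<gamma> ^ (k + 2) / fact k)\<^sup>2 * r ^ (2 * k)) * ennreal ((norm (dens r \<xi>))\<^sup>2))
          = ennreal C * (ennreal (r powr (a - 1) * exp (- (2 * \<xi> * r powr \<gamma>))) * indicator {0<..} r)"
        proof (cases "r > 0")
          case r: True
          have "(norm (dens r \<xi>))\<^sup>2 = (\<xi> ^ (k + 1))\<^sup>2 * (exp (- (\<xi> * r powr \<gamma>)))\<^sup>2 * (norm (prof \<xi>))\<^sup>2"
            using True by (simp add: leray_density_def norm_mult norm_power power_mult_distrib)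
          also have "(\<xi> ^ (k + 1))\<^sup>2 = \<xi> ^ (2 * k + 2)"
            unfolding power_mult[symmetric] by (rule arg_cong[where f = "power \<xi>"]) simp
          also have "(exp (- (\<xi> * r powr \<gamma>)))\<^sup>2 = exp (- (2 * \<xi> * r powr \<gamma>))"
            by (simp add: exp_double[symmetric])
          finally have n: "(norm (dens r \<xi>))\<^sup>2 = \<xi> ^ (2 * k + 2) * exp (- (2 * \<xi> * r powr \<gamma>)) * (norm (prof \<xi>))\<^sup>2" .
          have pw: "r powr d * r ^ (2 * k) = r powr (a - 1)"
          proof -
            have "r ^ (2 * k) = r powr (real (2 * k))" using r by (rule powr_realpow[symmetric])
            then show ?thesis by (simp add: powr_add[symmetric] a_def add.commute)
          qed
          have "(r powr d * (\<gamma> ^ (k + 2) / fact k)\<^sup>2 * r ^ (2 * k)) * (norm (dens r \<xi>))\<^sup>2 = C * (r powr (a - 1) * exp (- (2 * \<xi> * r powr \<gamma>)))"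
            unfolding n C_def pw[symmetric] by (simp only: mult_ac)
          then show ?thesis using r C by (simp add: ennreal_mult[symmetric])
        qed simp
      qed
      also have "\<dots> = ennreal C * ennreal (Gamma (a / \<gamma>) / \<gamma> * (2 * \<xi>) powr (- (a / \<gamma>)))"
        using a True gamma by (subst nn_integral_cmult) (auto simp: nn_integral_powr_exp)
      also have "\<dots> = ennreal (C * (Gamma (a / \<gamma>) / \<gamma> * (2 * \<xi>) powr (- (a / \<gamma>))))"
        using C by (rule ennreal_mult'[symmetric])
      also have "C * (Gamma (a / \<gamma>) / \<gamma> * (2 * \<xi>) powr (- (a / \<gamma>))) = symbol_weight d \<gamma> k \<xi> * (norm (prof \<xi>))\<^sup>2"
        unfolding C_def symbol_weight_def a_def by (simp only: mult_ac)
      finally show ?thesis using True by (simp add: ennreal_mult'')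
    next
      case False
      then show ?thesis by (simp add: leray_density_def max_def)
    qed
  qed
  finally show ?thesis .
qed

definition slice :: "real \<Rightarrow> real \<Rightarrow> complex" where "slice r s = F (r, s)"

lemma slice_plancherel_hyps:
  "integrable lborel (slice r)" "\<exists>B. \<forall>s. norm (slice r s) \<le> B" "continuous_on UNIV (slice r)"
proof -
  obtain M where M: "M \<ge> 0" "\<And>p. norm (F p) \<le> M" using F_bounded by blast
  then show "\<exists>B. \<forall>s. norm (slice r s) \<le> B" unfolding slice_def by blast
  show c: "continuous_on UNIV (slice r)" unfolding slice_def
    by (rule continuous_on_compose2[OF cont]) (auto intro!: continuous_intros)
  show "integrable lborel (slice r)"
  proof (rule Bochner_Integration.integrable_bound[OF integrable_mult_right[of M, OF integrable_indicator_Icc[of "-S" S]]])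
    show "AE s in lborel. norm (slice r s) \<le> norm (M * indicator {-S..S} s)"
    proof (rule AE_I2)
      fix s show "norm (slice r s) \<le> norm (M * indicator {-S..S} s)"
        using M F_zero(3)[of s r] by (cases "\<bar>s\<bar> \<le> S") (auto simp: slice_def abs_le_iff)
    qed
  qed (use borel_measurable_continuous_onI[OF c] in simp)
qed

lemma slice_joint_measurable [measurable]: "(\<lambda>p. slice (fst p) (snd p)) \<in> borel_measurable (borel \<Otimes>\<^sub>M borel)"
  unfolding slice_def by (simp add: borel_prod)

lemma slice_fourier_measurable [measurable]: "(\<lambda>p. fourier (slice (fst p)) (snd p)) \<in> borel_measurable (borel \<Otimes>\<^sub>M borel)"
proof -
  have [measurable]: "F \<in> borel_measurable (borel \<Otimes>\<^sub>M borel)" by (simp add: borel_prod)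
  show ?thesis unfolding fourier_def slice_def by measurable
qed

lemma profile_eq_slices:
  "prof \<xi> = (\<integral>r. of_real (r powr (wexp \<gamma> k) * damping \<gamma> \<xi> r) * fourier (slice r) (- \<xi>) \<partial>lborel)"
proof -
  define h where "h = (\<lambda>p. \<Phi> p * (of_real (damping \<gamma> \<xi> (fst p)) * cis (- (\<xi> * snd p))))"
  have [measurable]: "\<Phi> \<in> borel_measurable (borel \<Otimes>\<^sub>M borel)" by (simp add: borel_prod)
  have hm: "h \<in> borel_measurable (borel \<Otimes>\<^sub>M borel)" unfolding h_def by measurable
  have "integrable lborel h"
  proof (rule Bochner_Integration.integrable_bound[OF \<Phi>_integrable])
    show "h \<in> borel_measurable lborel" using hm by (simp add: borel_prod)
    show "AE p in lborel. norm (h p) \<le> norm (\<Phi> p)"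
      unfolding h_def using mult_left_mono[OF profile_factor_bound[of \<xi>], of "norm (\<Phi> _)"]
      by (intro AE_I2) (simp only: norm_mult norm_ge_zero mult_1_right)
  qed
  then have "(\<integral>r. \<integral>s. h (r, s) \<partial>lborel \<partial>lborel) = (\<integral>p. h p \<partial>lborel)"
    unfolding lborel_prod[where ?'a = real and ?'b = real, symmetric] by (rule lborel_pair.integral_fst')
  moreover have "(\<integral>s. h (r, s) \<partial>lborel) = of_real (r powr (wexp \<gamma> k) * damping \<gamma> \<xi> r) * fourier (slice r) (- \<xi>)" for r
  proof -
    have "h (r, s) = of_real (r powr (wexp \<gamma> k) * damping \<gamma> \<xi> r) * (cis (s * - \<xi>) * slice r s)" for s
      by (simp add: h_def \<Phi>_def slice_def mult_ac)
    then show ?thesis unfolding fourier_def by (simp only: integral_mult_right_zero)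
  qed
  ultimately show ?thesis unfolding profile_alt h_def[symmetric] by simp
qed

text \<open>Cauchy-Schwarz in \<open>r\<close>, with the density \<open>r\<^sup>d\<close> divided between the two factors.\<close>

lemma norm_profile_le:
  assumes \<xi>: "\<xi> > 0" and d: "d < 2 * \<gamma> - 1"
  shows "ennreal ((norm (prof \<xi>))\<^sup>2) \<le> ennreal (dual_weight d \<gamma> k \<xi>) *
    (\<integral>\<^sup>+r. indicator {0<..} r * ennreal (r powr d) * ennreal ((norm (fourier (slice r) (- \<xi>)))\<^sup>2) \<partial>lborel)"
proof -
  define m where "m = wexp \<gamma> k"
  define u where "u = (\<lambda>r. indicator {0<..} r * (r powr (m - d / 2) * exp (- (\<xi> * ((\<gamma> - 1) * r powr \<gamma>)))))"
  define v where "v = (\<lambda>r. indicator {0<..} r * (r powr (d / 2) * norm (fourier (slice r) (- \<xi>))))"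
  have [measurable]: "(\<lambda>r. fourier (slice r) (- \<xi>)) \<in> borel_measurable borel"
    using measurable_compose[OF _ slice_fourier_measurable, of "\<lambda>r. (r, - \<xi>)" borel] by simp
  have [measurable]: "u \<in> borel_measurable borel" "v \<in> borel_measurable borel"
    unfolding u_def v_def by measurable
  have uv: "norm (of_real (r powr m * damping \<gamma> \<xi> r) * fourier (slice r) (- \<xi>)) = \<bar>u r * v r\<bar>" for r
  proof (cases "r > 0")
    case True
    have "r powr m = r powr (m - d / 2) * r powr (d / 2)" using True by (simp add: powr_add[symmetric])
    then show ?thesis using True \<xi> by (simp add: u_def v_def norm_mult abs_mult)
  next
    case False
    then have "slice r = (\<lambda>s. 0)" using F_zero(1)[of r] r0 by (auto simp: slice_def)
    then show ?thesis using False by (simp add: u_def fourier_def)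
  qed
  have "ennreal (norm (prof \<xi>)) \<le> (\<integral>\<^sup>+r. ennreal \<bar>u r * v r\<bar> \<partial>lborel)"
    unfolding profile_eq_slices m_def[symmetric] uv[symmetric]
    by (rule norm_integral_le_nn_integral)
  then have "(ennreal (norm (prof \<xi>)))\<^sup>2 \<le> (\<integral>\<^sup>+r. ennreal \<bar>u r * v r\<bar> \<partial>lborel)\<^sup>2"
    by (intro power_mono) auto
  also have "\<dots> \<le> (\<integral>\<^sup>+r. ennreal ((u r)\<^sup>2) \<partial>lborel) * (\<integral>\<^sup>+r. ennreal ((v r)\<^sup>2) \<partial>lborel)"
    by (rule nn_integral_cauchy_schwarz) simp_all
  also have "(\<integral>\<^sup>+r. ennreal ((u r)\<^sup>2) \<partial>lborel) = ennreal (dual_weight d \<gamma> k \<xi>)"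
  proof -
    define a where "a = \<gamma> * (2 * real k + 2) - (2 * real k + 1 + d)"
    have "a = (\<gamma> - 1) * (2 * real k) + (2 * \<gamma> - 1 - d)"
      by (simp add: a_def algebra_simps)
    moreover have "(\<gamma> - 1) * (2 * real k) \<ge> 0" using gamma by simp
    ultimately have a: "a > 0" using d by linarith
    have ag: "a / \<gamma> = 2 * real k + 2 - (2 * real k + 1 + d) / \<gamma>" using gamma by (simp add: a_def diff_divide_distrib)
    have "(\<integral>\<^sup>+r. ennreal ((u r)\<^sup>2) \<partial>lborel) = (\<integral>\<^sup>+r. ennreal (r powr (a - 1) * exp (- ((2 * \<xi> * (\<gamma> - 1)) * r powr \<gamma>))) * indicator {0<..} r \<partial>lborel)"
    proof (rule nn_integral_cong)
      fix r :: real
      show "ennreal ((u r)\<^sup>2) = ennreal (r powr (a - 1) * exp (- ((2 * \<xi> * (\<gamma> - 1)) * r powr \<gamma>))) * indicator {0<..} r"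
      proof (cases "r > 0")
        case True
        have "(r powr (m - d / 2))\<^sup>2 = r powr (a - 1)"
          using True by (simp add: powr_power m_def a_def algebra_simps)
        moreover have "(exp (- (\<xi> * ((\<gamma> - 1) * r powr \<gamma>))))\<^sup>2 = exp (- ((2 * \<xi> * (\<gamma> - 1)) * r powr \<gamma>))"
          by (simp add: exp_double[symmetric] mult_ac)
        ultimately show ?thesis using True by (simp add: u_def power_mult_distrib)
      qed (simp add: u_def)
    qed
    also have "\<dots> = ennreal (Gamma (a / \<gamma>) / \<gamma> * (2 * \<xi> * (\<gamma> - 1)) powr (- (a / \<gamma>)))"
      using a \<xi> gamma by (intro nn_integral_powr_exp) auto
    finally show ?thesis unfolding dual_weight_def ag .
  qed
  also have "(\<integral>\<^sup>+r. ennreal ((v r)\<^sup>2) \<partial>lborel) = (\<integral>\<^sup>+r. indicator {0<..} r * ennreal (r powr d) * ennreal ((norm (fourier (slice r) (- \<xi>)))\<^sup>2) \<partial>lborel)"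
  proof (rule nn_integral_cong)
    fix r :: real
    show "ennreal ((v r)\<^sup>2) = indicator {0<..} r * ennreal (r powr d) * ennreal ((norm (fourier (slice r) (- \<xi>)))\<^sup>2)"
    proof (cases "r > 0")
      case True
      have "(r powr (d / 2))\<^sup>2 = r powr d" using True by (simp add: powr_power)
      then show ?thesis using True by (simp add: v_def power_mult_distrib ennreal_mult[symmetric])
    qed (simp add: v_def)
  qed
  finally show ?thesis by (simp add: ennreal_power)
qed

text \<open>The product of the two weights is the symbol for every \<open>\<xi> > 0\<close>. Plancherel in \<open>s\<close> for each fixed \<open>r\<close>
  turns the remaining integral back into the norm of \<open>F\<close>.\<close>

theorem norm_leray_bdry_le:
  assumes f: "\<And>r \<theta> s. r > 0 \<Longrightarrow> 0 \<le> \<theta> \<Longrightarrow> \<theta> < 2 * pi \<Longrightarrow> f (param \<gamma> (r, \<theta>, s)) = F (r, s) * cis (real k * \<theta>)"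
    and d: "-1 < d" "d < 2 * \<gamma> - 1" and J: "leray_symbol d \<gamma> k \<ge> 0"
  shows "energy (hyp_measure \<gamma> d) (leray_bdry \<gamma> f) \<le> ennreal (leray_symbol d \<gamma> k) *
    (\<integral>\<^sup>+r. ennreal (r powr d) * indicator {0<..} r * (\<integral>\<^sup>+s. ennreal (2 * pi) * ennreal ((norm (F (r, s)))\<^sup>2) \<partial>lborel) \<partial>lborel)"
proof -
  let ?h = "\<lambda>r \<xi>. indicator {0<..} r * ennreal (r powr d) * ennreal ((norm (fourier (slice r) (- \<xi>)))\<^sup>2)"
  have hm [measurable]: "(\<lambda>p. fourier (slice (fst p)) (- snd p)) \<in> borel_measurable (borel \<Otimes>\<^sub>M borel)"
    using measurable_compose[OF _ slice_fourier_measurable, of "\<lambda>p. (fst p, - snd p)" "borel \<Otimes>\<^sub>M borel"] by simp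
  have hm' [measurable]: "(\<lambda>p. fourier (slice (snd p)) (- fst p)) \<in> borel_measurable (borel \<Otimes>\<^sub>M borel)"
    using measurable_compose[OF _ slice_fourier_measurable, of "\<lambda>p. (snd p, - fst p)" "borel \<Otimes>\<^sub>M borel"] by simp
  have "energy (hyp_measure \<gamma> d) (leray_bdry \<gamma> f)
    = (\<integral>\<^sup>+\<xi>. indicator {0<..} \<xi> * ennreal (symbol_weight d \<gamma> k \<xi>) * ennreal ((norm (prof \<xi>))\<^sup>2) \<partial>lborel)"
    by (rule norm_leray_bdry_eq[OF f d(1)])
  also have "\<dots> \<le> (\<integral>\<^sup>+\<xi>. ennreal (leray_symbol d \<gamma> k) * (\<integral>\<^sup>+r. ?h r \<xi> \<partial>lborel) \<partial>lborel)"
  proof (rule nn_integral_mono)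
    fix \<xi> :: real
    show "indicator {0<..} \<xi> * ennreal (symbol_weight d \<gamma> k \<xi>) * ennreal ((norm (prof \<xi>))\<^sup>2)
       \<le> ennreal (leray_symbol d \<gamma> k) * (\<integral>\<^sup>+r. ?h r \<xi> \<partial>lborel)"
    proof (cases "\<xi> > 0")
      case True
      have nn: "symbol_weight d \<gamma> k \<xi> \<ge> 0"
        using d(1) gamma True unfolding symbol_weight_def by (auto intro!: mult_nonneg_nonneg divide_nonneg_pos Gamma_real_nonneg less_imp_le[OF Gamma_real_pos])
      have "ennreal (symbol_weight d \<gamma> k \<xi>) * ennreal ((norm (prof \<xi>))\<^sup>2)
        \<le> ennreal (symbol_weight d \<gamma> k \<xi>) * (ennreal (dual_weight d \<gamma> k \<xi>) * (\<integral>\<^sup>+r. ?h r \<xi> \<partial>lborel))"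
        by (intro mult_left_mono norm_profile_le True d) simp
      also have "\<dots> = ennreal (symbol_weight d \<gamma> k \<xi> * dual_weight d \<gamma> k \<xi>) * (\<integral>\<^sup>+r. ?h r \<xi> \<partial>lborel)"
        using nn by (simp add: ennreal_mult' mult.assoc)
      finally show ?thesis using True unfolding symbol_weight_times_dual_weight[OF gamma True] by simp
    qed simp
  qed
  also have "\<dots> = ennreal (leray_symbol d \<gamma> k) * (\<integral>\<^sup>+\<xi>. (\<integral>\<^sup>+r. ?h r \<xi> \<partial>lborel) \<partial>lborel)"
    by (rule nn_integral_cmult) measurable
  also have "(\<integral>\<^sup>+\<xi>. (\<integral>\<^sup>+r. ?h r \<xi> \<partial>lborel) \<partial>lborel) = (\<integral>\<^sup>+r. (\<integral>\<^sup>+\<xi>. ?h r \<xi> \<partial>lborel) \<partial>lborel)"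
    by (rule lborel_pair.Fubini'[symmetric]) (use hm in measurable)
  also have "\<dots> = (\<integral>\<^sup>+r. ennreal (r powr d) * indicator {0<..} r * (\<integral>\<^sup>+s. ennreal (2 * pi) * ennreal ((norm (F (r, s)))\<^sup>2) \<partial>lborel) \<partial>lborel)"
  proof (rule nn_integral_cong)
    fix r :: real
    obtain B where B: "\<And>s. norm (slice r s) \<le> B" using slice_plancherel_hyps(2)[of r] by blast
    note hyps = slice_plancherel_hyps(1)[of r] B slice_plancherel_hyps(3)[of r]
    have [measurable]: "slice r \<in> borel_measurable borel" using hyps(1) by auto
    have "energy lborel (\<lambda>\<xi>. fourier (slice r) (- \<xi>)) = energy lborel (fourier (slice r))"
      using nn_integral_real_affine[of "\<lambda>\<xi>. ennreal ((norm (fourier (slice r) \<xi>))\<^sup>2)" "-1" 0] by simp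
    also have "\<dots> = (\<integral>\<^sup>+s. ennreal (2 * pi) * ennreal ((norm (F (r, s)))\<^sup>2) \<partial>lborel)"
      unfolding plancherel[OF hyps] by (simp add: slice_def[symmetric] nn_integral_cmult)
    finally show "(\<integral>\<^sup>+\<xi>. ?h r \<xi> \<partial>lborel) = ennreal (r powr d) * indicator {0<..} r * (\<integral>\<^sup>+s. ennreal (2 * pi) * ennreal ((norm (F (r, s)))\<^sup>2) \<partial>lborel)"
      by (simp add: nn_integral_cmult mult_ac)
  qed
  finally show ?thesis .
qed

end

section \<open>The upper bound for the norms\<close>

text \<open>If \<open>f\<close> has norm \<open>0\<close> so has \<open>u\<close>, and \<open>0 / 0 = 0\<close> in the extended reals; if \<open>f\<close> has infinite norm
  the quotient is \<open>0\<close>.\<close>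

lemma L2_norm_on_quotient_le:
  assumes "energy M u \<le> ennreal J * energy M f" and J: "J \<ge> 0"
  shows "L2_norm_on M u / L2_norm_on M f \<le> ennreal (sqrt J)"
proof -
  define U where "U = energy M u"
  define V where "V = energy M f"
  have UV: "U \<le> ennreal J * V" using assms(1) by (simp add: U_def V_def)
  have eq: "L2_norm_on M u = (if U = \<infinity> then \<infinity> else ennreal (sqrt (enn2real U)))"
    "L2_norm_on M f = (if V = \<infinity> then \<infinity> else ennreal (sqrt (enn2real V)))"
    by (simp_all add: L2_norm_on_def U_def V_def)
  show ?thesis
  proof (cases V)
    case (real v)
    then have v: "V = ennreal v" "v \<ge> 0" by auto
    then have "U \<le> ennreal (J * v)" using UV J by (simp add: ennreal_mult)
    then obtain w where w: "U = ennreal w" "w \<ge> 0" "w \<le> J * v"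
      using J v by (cases U) (auto simp: top_unique ennreal_le_iff)
    have le: "sqrt w \<le> sqrt J * sqrt v" using w by (simp add: real_sqrt_mult[symmetric])
    show ?thesis
    proof (cases "v = 0")
      case True
      then have "w = 0" using w by simp
      then show ?thesis unfolding eq using v w by simp
    next
      case False
      then have "sqrt w / sqrt v \<le> sqrt J" using le v by (simp add: field_simps)
      then show ?thesis unfolding eq using v w False by (simp add: divide_ennreal ennreal_leI)
    qed
  next
    case top
    then show ?thesis unfolding eq by (simp add: divide_ennreal_def)
  qed
qed

lemma L2_norm_on_quotient_ge:
  assumes "energy M u \<ge> ennreal c * energy M f" and c: "c \<ge> 0"
    and pos: "0 < energy M f" and fin: "energy M f < \<infinity>"
  shows "L2_norm_on M u / L2_norm_on M f \<ge> ennreal (sqrt c)"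
proof -
  define U where "U = energy M u"
  define V where "V = energy M f"
  have UV: "U \<ge> ennreal c * V" using assms(1) by (simp add: U_def V_def)
  have eq: "L2_norm_on M u = (if U = \<infinity> then \<infinity> else ennreal (sqrt (enn2real U)))"
    "L2_norm_on M f = (if V = \<infinity> then \<infinity> else ennreal (sqrt (enn2real V)))"
    by (simp_all add: L2_norm_on_def U_def V_def)
  obtain v where v: "V = ennreal v" "v > 0"
    using pos fin unfolding V_def[symmetric] by (cases V) auto
  show ?thesis
  proof (cases U)
    case (real w)
    then have w: "U = ennreal w" "w \<ge> 0" by auto
    then have "c * v \<le> w" using UV v c by (simp add: ennreal_mult[symmetric] ennreal_le_iff)
    then have "sqrt c * sqrt v \<le> sqrt w" by (simp add: real_sqrt_mult[symmetric])
    then have "sqrt c \<le> sqrt w / sqrt v" using v by (simp add: field_simps)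
    then show ?thesis unfolding eq using v w by (simp add: divide_ennreal ennreal_leI)
  next
    case top
    then show ?thesis unfolding eq using v by (simp add: ennreal_top_divide)
  qed
qed

lemma cis_real_mult_Arg:
  assumes "r > 0" shows "cis (real k * Arg (of_real r * cis \<theta>)) = cis (real k * \<theta>)"
proof -
  have "cis (Arg (of_real r * cis \<theta>)) = sgn (of_real r * cis \<theta>)"
    using assms by (intro cis_Arg) simp
  also have "\<dots> = cis \<theta>" using assms by (simp add: sgn_mult sgn_of_real)
  finally have "cis (Arg (of_real r * cis \<theta>)) ^ k = cis \<theta> ^ k" by simp
  then show ?thesis unfolding Complex.DeMoivre .
qed

lemma fourier_component_param:
  assumes "r > 0"
  shows "fourier_component \<gamma> k f (param \<gamma> (r, \<theta>, s)) = fourier_coeff \<gamma> k f r s * cis (real k * \<theta>)"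
  using assms cis_real_mult_Arg[OF assms, of k \<theta>] by (simp add: fourier_component_def param_def norm_mult)

lemma test_fun_bounds:
  assumes "test_fun \<gamma> f"
  obtains r0 r1 S M where "r0 > 0" "M \<ge> 0"
    "\<And>r \<theta> s. r > 0 \<Longrightarrow> f (param \<gamma> (r, \<theta>, s)) \<noteq> 0 \<Longrightarrow> r0 \<le> r \<and> r \<le> r1 \<and> \<bar>s\<bar> \<le> S"
    "\<And>r \<theta> s. r > 0 \<Longrightarrow> norm (f (param \<gamma> (r, \<theta>, s))) \<le> M"
proof -
  define h where "h = (\<lambda>(w :: complex, s :: real). f (w, Complex s (norm w powr \<gamma>)))"
  from assms obtain K where K: "compact K" "K \<subseteq> hypersurface \<gamma> \<inter> {\<zeta>. fst \<zeta> \<noteq> 0}"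
      "\<And>\<zeta>. \<zeta> \<in> hypersurface \<gamma> - K \<Longrightarrow> f \<zeta> = 0" and "smooth_fun_on punctured h"
    unfolding test_fun_def h_def by blast
  then have hc: "continuous_on punctured h"
    unfolding smooth_fun_on_def using Ck_on.simps(1)[of punctured h] by blast
  have on: "param \<gamma> (r, \<theta>, s) \<in> K" if "r > 0" "f (param \<gamma> (r, \<theta>, s)) \<noteq> 0" for r \<theta> s
    using K(3)[of "param \<gamma> (r, \<theta>, s)"] that by (auto simp: hypersurface_def param_def norm_mult)
  have nf: "norm (fst (param \<gamma> (r, \<theta>, s))) = r" "Re (snd (param \<gamma> (r, \<theta>, s))) = s" if "r > 0" for r \<theta> s
    using that by (simp_all add: param_def norm_mult)
  have "\<exists>r0>0. \<forall>\<zeta>\<in>K. r0 \<le> norm (fst \<zeta>)"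
  proof (cases "K = {}")
    case False
    have "continuous_on K (\<lambda>\<zeta>. norm (fst \<zeta>))" by (intro continuous_intros)
    from continuous_attains_inf[OF K(1) False this] obtain \<zeta>0 where "\<zeta>0 \<in> K" "\<forall>\<zeta>\<in>K. norm (fst \<zeta>0) \<le> norm (fst \<zeta>)" by blast
    then show ?thesis using K(2) by (intro exI[of _ "norm (fst \<zeta>0)"]) auto
  qed (auto intro: exI[of _ 1])
  then obtain r0 where r0: "r0 > 0" "\<And>\<zeta>. \<zeta> \<in> K \<Longrightarrow> r0 \<le> norm (fst \<zeta>)" by blast
  obtain b where b: "\<And>\<zeta>. \<zeta> \<in> K \<Longrightarrow> norm \<zeta> \<le> b" using compact_imp_bounded[OF K(1)] bounded_iff by metis
  have "compact ((\<lambda>\<zeta>. h (fst \<zeta>, Re (snd \<zeta>))) ` K)"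
    by (intro compact_continuous_image K(1) continuous_on_compose2[OF hc])
      (use K(2) in \<open>auto intro!: continuous_intros\<close>)
  then obtain M where M: "\<forall>x \<in> (\<lambda>\<zeta>. h (fst \<zeta>, Re (snd \<zeta>))) ` K. norm x \<le> M"
    using compact_imp_bounded bounded_iff by metis
  show ?thesis
  proof (rule that[of r0 "max M 0" b b])
    fix r \<theta> s :: real assume r: "r > 0"
    {
      assume nz: "f (param \<gamma> (r, \<theta>, s)) \<noteq> 0"
      have "norm (fst (param \<gamma> (r, \<theta>, s))) \<le> b" "\<bar>Re (snd (param \<gamma> (r, \<theta>, s)))\<bar> \<le> b"
        using b[OF on[OF r nz]] norm_fst_le[of "fst (param \<gamma> (r, \<theta>, s))" "snd (param \<gamma> (r, \<theta>, s))"]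
          norm_snd_le[of "snd (param \<gamma> (r, \<theta>, s))" "fst (param \<gamma> (r, \<theta>, s))", unfolded prod.collapse]
          abs_Re_le_cmod[of "snd (param \<gamma> (r, \<theta>, s))"]
        unfolding prod.collapse by linarith+
      then show "r0 \<le> r \<and> r \<le> b \<and> \<bar>s\<bar> \<le> b" using r0(2)[OF on[OF r nz]] nf[OF r] by simp
    }
    show "norm (f (param \<gamma> (r, \<theta>, s))) \<le> max M 0"
    proof (cases "f (param \<gamma> (r, \<theta>, s)) = 0")
      case False
      have "f (param \<gamma> (r, \<theta>, s)) = h (fst (param \<gamma> (r, \<theta>, s)), Re (snd (param \<gamma> (r, \<theta>, s))))"
        using r by (simp add: h_def param_def norm_mult)
      then show ?thesis using M on[OF r False] by (auto intro: le_max_iff_disj[THEN iffD2])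
    qed simp
  qed (use r0 in auto)
qed

text \<open>A test function is continuous as a function on the chart \<open>(\<zeta>\<^sub>1, Re \<zeta>\<^sub>2)\<close>, \<open>\<zeta>\<^sub>1 \<noteq> 0\<close>. Its values off the
  hypersurface are arbitrary, so measurability has to be taken from the chart.\<close>

definition chart :: "real \<Rightarrow> (complex \<times> complex \<Rightarrow> complex) \<Rightarrow> complex \<times> real \<Rightarrow> complex" where
  "chart \<gamma> f = (\<lambda>(w, s). f (w, Complex s (norm w powr \<gamma>)))"

lemma chart_param: "r > 0 \<Longrightarrow> f (param \<gamma> (r, \<theta>, s)) = chart \<gamma> f (of_real r * cis \<theta>, s)"
  by (simp add: chart_def param_def norm_mult)

lemma chart_continuous: "test_fun \<gamma> f \<Longrightarrow> continuous_on punctured (chart \<gamma> f)"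
  unfolding test_fun_def smooth_fun_on_def chart_def using Ck_on.simps(1) by blast

definition radial_coeff :: "real \<Rightarrow> nat \<Rightarrow> (complex \<times> complex \<Rightarrow> complex) \<Rightarrow> real \<times> real \<Rightarrow> complex" where
  "radial_coeff \<gamma> k f = (\<lambda>(r, s). if r > 0 then fourier_coeff \<gamma> k f r s else 0)"

lemma radial_coeff_compact_profile:
  assumes g: "\<gamma> > 1" and f: "test_fun \<gamma> f"
  obtains r0 r1 S where "compact_profile \<gamma> (radial_coeff \<gamma> k f) r0 r1 S"
proof -
  obtain r0 r1 S M where b: "r0 > 0" "M \<ge> 0"
    "\<And>r \<theta> s. r > 0 \<Longrightarrow> f (param \<gamma> (r, \<theta>, s)) \<noteq> 0 \<Longrightarrow> r0 \<le> r \<and> r \<le> r1 \<and> \<bar>s\<bar> \<le> S"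
    "\<And>r \<theta> s. r > 0 \<Longrightarrow> norm (f (param \<gamma> (r, \<theta>, s))) \<le> M"
    using test_fun_bounds[OF f] by metis
  define G where "G = (\<lambda>\<phi> p. if fst p > 0 then f (param \<gamma> (fst p, \<phi>, snd p)) else 0 :: complex)"
  have GM: "norm (G \<phi> p) \<le> M" for \<phi> p using b by (auto simp: G_def)
  have Gc: "continuous_on UNIV (G \<phi>)" for \<phi>
  proof -
    have "continuous_on ({0<..} \<times> UNIV) (\<lambda>p. chart \<gamma> f (of_real (fst p) * cis \<phi>, snd p))"
      by (rule continuous_on_compose2[OF chart_continuous[OF f]]) (auto intro!: continuous_intros)
    then have 1: "continuous_on ({0<..} \<times> UNIV) (G \<phi>)"
      by (rule continuous_on_eq) (auto simp: G_def chart_param)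
    have 2: "continuous_on ({..<r0} \<times> UNIV) (G \<phi>)"
    proof (rule continuous_on_eq[of _ "\<lambda>_. 0"])
      fix p assume "p \<in> {..<r0} \<times> (UNIV :: real set)"
      then have lt: "fst p < r0" by auto
      show "0 = G \<phi> p"
      proof (rule ccontr)
        assume "0 \<noteq> G \<phi> p"
        then have "fst p > 0" "f (param \<gamma> (fst p, \<phi>, snd p)) \<noteq> 0" by (auto simp: G_def split: if_splits)
        then show False using b(3) lt by force
      qed
    qed simp
    have "{0<..} \<times> UNIV \<union> {..<r0} \<times> UNIV = (UNIV :: (real \<times> real) set)" using b(1) by auto
    then show ?thesis using continuous_on_open_Un[OF _ _ 1 2] by (simp add: open_Times)
  qed
  have Gm [measurable]: "(\<lambda>\<phi>. G \<phi> p) \<in> borel_measurable borel" for p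
  proof (cases "fst p > 0")
    case True
    have "continuous_on UNIV (\<lambda>\<phi>. chart \<gamma> f (of_real (fst p) * cis \<phi>, snd p))"
      by (rule continuous_on_compose2[OF chart_continuous[OF f]]) (use True in \<open>auto intro!: continuous_intros\<close>)
    then have "continuous_on UNIV (\<lambda>\<phi>. G \<phi> p)" using True by (simp add: G_def chart_param)
    then show ?thesis by (rule borel_measurable_continuous_onI)
  qed (simp add: G_def)
  have eq: "radial_coeff \<gamma> k f p = 1 / (2 * of_real pi) * (\<integral>\<phi>. indicator {0..2*pi} \<phi> *\<^sub>R (G \<phi> p * cis (- real k * \<phi>)) \<partial>lborel)" for p
    by (cases p) (auto simp: radial_coeff_def fourier_coeff_def G_def set_lebesgue_integral_def)
  have "continuous_on UNIV (radial_coeff \<gamma> k f)"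
  proof (rule continuous_at_imp_continuous_on, rule ballI)
    fix p
    show "isCont (radial_coeff \<gamma> k f) p"
      unfolding continuous_at_sequentially
    proof (intro allI impI)
      fix X assume X: "X \<longlonglongrightarrow> p"
      have "(\<lambda>i. \<integral>\<phi>. indicator {0..2*pi} \<phi> *\<^sub>R (G \<phi> (X i) * cis (- real k * \<phi>)) \<partial>lborel)
        \<longlonglongrightarrow> (\<integral>\<phi>. indicator {0..2*pi} \<phi> *\<^sub>R (G \<phi> p * cis (- real k * \<phi>)) \<partial>lborel)"
      proof (rule integral_dominated_convergence[where w = "\<lambda>\<phi>. M * indicator {0..2*pi} \<phi>"])
        show "integrable lborel (\<lambda>\<phi>. M * indicator {0..2*pi} \<phi>)"
          by (rule integrable_mult_right[OF integrable_indicator_Icc])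
        show "AE \<phi> in lborel. (\<lambda>i. indicator {0..2*pi} \<phi> *\<^sub>R (G \<phi> (X i) * cis (- real k * \<phi>)))
           \<longlonglongrightarrow> indicator {0..2*pi} \<phi> *\<^sub>R (G \<phi> p * cis (- real k * \<phi>))"
        proof (intro AE_I2 tendsto_scaleR tendsto_mult tendsto_const)
          fix \<phi>
          have "isCont (G \<phi>) p" using Gc[of \<phi>] continuous_on_eq_continuous_at open_UNIV UNIV_I by metis
          then show "(\<lambda>i. G \<phi> (X i)) \<longlonglongrightarrow> G \<phi> p" using X by (rule isCont_tendsto_compose)
        qed
        show "AE \<phi> in lborel. norm (indicator {0..2*pi} \<phi> *\<^sub>R (G \<phi> (X i) * cis (- real k * \<phi>))) \<le> M * indicator {0..2*pi} \<phi>" for i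
          using GM by (intro AE_I2) (auto simp: norm_mult split: split_indicator)
      qed auto
      then show "(radial_coeff \<gamma> k f \<circ> X) \<longlonglongrightarrow> radial_coeff \<gamma> k f p"
        unfolding o_def eq by (intro tendsto_mult tendsto_const)
    qed
  qed
  moreover have "r0 \<le> r \<and> r \<le> r1 \<and> \<bar>s\<bar> \<le> S" if nz: "radial_coeff \<gamma> k f (r, s) \<noteq> 0" for r s
  proof -
    have "r > 0" using nz by (auto simp: radial_coeff_def split: if_splits)
    moreover have "\<exists>\<phi>. G \<phi> (r, s) \<noteq> 0" using nz unfolding eq by (rule contrapos_np) simp
    ultimately show ?thesis using b(3) by (auto simp: G_def)
  qed
  ultimately show ?thesis using that[of r0 r1 S] g b(1) by (simp add: compact_profile_def)
qed

text \<open>Bessel's inequality for one Fourier coefficient in \<open>\<theta>\<close>.\<close>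

lemma norm_radial_coeff_le:
  assumes f: "test_fun \<gamma> f" and r: "r > 0"
  shows "ennreal (2 * pi) * ennreal ((norm (radial_coeff \<gamma> k f (r, s)))\<^sup>2)
    \<le> (\<integral>\<^sup>+\<theta>. indicator {0..<2*pi} \<theta> * ennreal ((norm (chart \<gamma> f (of_real r * cis \<theta>, s)))\<^sup>2) \<partial>lborel)"
proof -
  define u where "u = (\<lambda>\<theta>. chart \<gamma> f (of_real r * cis \<theta>, s))"
  have "continuous_on UNIV u" unfolding u_def
    by (rule continuous_on_compose2[OF chart_continuous[OF f]]) (use r in \<open>auto intro!: continuous_intros\<close>)
  then have [measurable]: "u \<in> borel_measurable borel" by (rule borel_measurable_continuous_onI)
  define I where "I = (\<integral>\<phi>. indicator {0..2*pi} \<phi> *\<^sub>R (u \<phi> * cis (- real k * \<phi>)) \<partial>lborel)"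
  have eq: "radial_coeff \<gamma> k f (r, s) = 1 / (2 * of_real pi) * I"
    using r by (simp add: radial_coeff_def fourier_coeff_def I_def set_lebesgue_integral_def u_def chart_param)
  have "ennreal (norm I) \<le> (\<integral>\<^sup>+\<phi>. ennreal \<bar>indicator {0..2*pi} \<phi> * (indicator {0..2*pi} \<phi> * norm (u \<phi>))\<bar> \<partial>lborel)"
    unfolding I_def by (rule order_trans[OF norm_integral_le_nn_integral])
      (auto intro!: nn_integral_mono simp: norm_mult split: split_indicator)
  then have "(ennreal (norm I))\<^sup>2 \<le> (\<integral>\<^sup>+\<phi>. ennreal \<bar>indicator {0..2*pi} \<phi> * (indicator {0..2*pi} \<phi> * norm (u \<phi>))\<bar> \<partial>lborel)\<^sup>2"
    by (intro power_mono) auto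
  also have "\<dots> \<le> (\<integral>\<^sup>+\<phi>. ennreal ((indicator {0..2*pi} \<phi>)\<^sup>2) \<partial>lborel) * (\<integral>\<^sup>+\<phi>. ennreal ((indicator {0..2*pi} \<phi> * norm (u \<phi>))\<^sup>2) \<partial>lborel)"
    by (rule nn_integral_cauchy_schwarz) auto
  also have "(\<integral>\<^sup>+\<phi>. ennreal ((indicator {0..2*pi} \<phi>)\<^sup>2) \<partial>lborel) = (\<integral>\<^sup>+\<phi>. indicator {0..2*pi} \<phi> \<partial>lborel)"
    by (intro nn_integral_cong) (auto split: split_indicator)
  also have "\<dots> = ennreal (2 * pi)" by simp
  also have "(\<integral>\<^sup>+\<phi>. ennreal ((indicator {0..2*pi} \<phi> * norm (u \<phi>))\<^sup>2) \<partial>lborel) = (\<integral>\<^sup>+\<theta>. indicator {0..<2*pi} \<theta> * ennreal ((norm (u \<theta>))\<^sup>2) \<partial>lborel)"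
  proof (rule nn_integral_cong_AE)
    show "AE \<theta> in lborel. ennreal ((indicator {0..2*pi} \<theta> * norm (u \<theta>))\<^sup>2) = indicator {0..<2*pi} \<theta> * ennreal ((norm (u \<theta>))\<^sup>2)"
      using AE_lborel_singleton[of "2 * pi"] by eventually_elim (auto split: split_indicator)
  qed
  finally have le: "ennreal ((norm I)\<^sup>2) \<le> ennreal (2 * pi) * (\<integral>\<^sup>+\<theta>. indicator {0..<2*pi} \<theta> * ennreal ((norm (u \<theta>))\<^sup>2) \<partial>lborel)"
    by (simp add: ennreal_power)
  have "2 * pi * (norm (radial_coeff \<gamma> k f (r, s)))\<^sup>2 = 1 / (2 * pi) * (norm I)\<^sup>2"
    unfolding eq by (simp add: norm_mult norm_divide power_divide power2_eq_square)
  then have "ennreal (2 * pi) * ennreal ((norm (radial_coeff \<gamma> k f (r, s)))\<^sup>2) = ennreal (1 / (2 * pi)) * ennreal ((norm I)\<^sup>2)"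
    by (simp add: ennreal_mult[symmetric])
  also have "\<dots> \<le> ennreal (1 / (2 * pi)) * (ennreal (2 * pi) * (\<integral>\<^sup>+\<theta>. indicator {0..<2*pi} \<theta> * ennreal ((norm (u \<theta>))\<^sup>2) \<partial>lborel))"
    by (intro mult_left_mono le) simp
  also have "\<dots> = (\<integral>\<^sup>+\<theta>. indicator {0..<2*pi} \<theta> * ennreal ((norm (u \<theta>))\<^sup>2) \<partial>lborel)"
  proof -
    have "ennreal (1 / (2 * pi)) * ennreal (2 * pi) = 1" by (subst ennreal_mult[symmetric]) auto
    then show ?thesis by (simp only: mult.assoc[symmetric] mult_1_left)
  qed
  finally show ?thesis unfolding u_def .
qed

definition chart_norm_sq :: "real \<Rightarrow> (complex \<times> complex \<Rightarrow> complex) \<Rightarrow> complex \<times> real \<Rightarrow> ennreal" where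
  "chart_norm_sq \<gamma> f p = ennreal ((norm (indicator punctured p *\<^sub>R chart \<gamma> f p))\<^sup>2)"

lemma norm_test_fun_eq:
  assumes f: "test_fun \<gamma> f"
  shows "energy (hyp_measure \<gamma> d) f =
    polar_integral d (chart_norm_sq \<gamma> f)"
    and "chart_norm_sq \<gamma> f \<in> borel_measurable borel"
proof -
  have "(\<lambda>p. indicator punctured p *\<^sub>R chart \<gamma> f p) \<in> borel_measurable borel"
    by (rule borel_measurable_continuous_on_indicator[OF _ chart_continuous[OF f]])
      (simp add: open_punctured borel_open)
  then show m: "chart_norm_sq \<gamma> f \<in> borel_measurable borel"
    unfolding chart_norm_sq_def by measurable
  show "energy (hyp_measure \<gamma> d) f =
    polar_integral d (chart_norm_sq \<gamma> f)"
    by (rule nn_integral_hyp_measure_iterated[OF m]) (simp add: chart_norm_sq_def chart_param)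
qed

theorem norm_sub_leray_le:
  assumes g: "\<gamma> > 1" and d: "-1 < d" "d < 2 * \<gamma> - 1" and f: "test_fun \<gamma> f"
  shows "energy (hyp_measure \<gamma> d) (sub_leray \<gamma> k f)
    \<le> ennreal (leray_symbol d \<gamma> k) * energy (hyp_measure \<gamma> d) f"
proof -
  obtain r0 r1 S where cp: "compact_profile \<gamma> (radial_coeff \<gamma> k f) r0 r1 S"
    using radial_coeff_compact_profile[OF g f] by blast
  have m [measurable]: "chart_norm_sq \<gamma> f \<in> borel_measurable (borel \<Otimes>\<^sub>M borel)"
    using norm_test_fun_eq(2)[OF f] by (simp add: borel_prod)
  have "energy (hyp_measure \<gamma> d) (sub_leray \<gamma> k f) \<le> ennreal (leray_symbol d \<gamma> k) *
    (\<integral>\<^sup>+r. ennreal (r powr d) * indicator {0<..} r * (\<integral>\<^sup>+s. ennreal (2 * pi) * ennreal ((norm (radial_coeff \<gamma> k f (r, s)))\<^sup>2) \<partial>lborel) \<partial>lborel)"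
    unfolding sub_leray_def
    by (rule compact_profile.norm_leray_bdry_le[OF cp _ d less_imp_le[OF leray_symbol_pos[OF g d]]])
      (simp add: fourier_component_param radial_coeff_def)
  also have "\<dots> \<le> ennreal (leray_symbol d \<gamma> k) *
    polar_integral d (chart_norm_sq \<gamma> f)"
  proof (rule mult_left_mono, rule nn_integral_mono)
    fix r :: real
    show "ennreal (r powr d) * indicator {0<..} r * (\<integral>\<^sup>+s. ennreal (2 * pi) * ennreal ((norm (radial_coeff \<gamma> k f (r, s)))\<^sup>2) \<partial>lborel)
      \<le> ennreal (r powr d) * indicator {0<..} r * circle_integral (chart_norm_sq \<gamma> f) r"
    proof (cases "r > 0")
      case True
      have "(\<integral>\<^sup>+s. ennreal (2 * pi) * ennreal ((norm (radial_coeff \<gamma> k f (r, s)))\<^sup>2) \<partial>lborel)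
        \<le> (\<integral>\<^sup>+s. (\<integral>\<^sup>+\<theta>. indicator {0..<2*pi} \<theta> * chart_norm_sq \<gamma> f (of_real r * cis \<theta>, s) \<partial>lborel) \<partial>lborel)"
        using norm_radial_coeff_le[OF f True] True by (intro nn_integral_mono) (simp add: chart_norm_sq_def)
      also have "\<dots> = (\<integral>\<^sup>+\<theta>. (\<integral>\<^sup>+s. indicator {0..<2*pi} \<theta> * chart_norm_sq \<gamma> f (of_real r * cis \<theta>, s) \<partial>lborel) \<partial>lborel)"
        by (rule lborel_pair.Fubini') measurable
      also have "\<dots> = circle_integral (chart_norm_sq \<gamma> f) r"
        by (subst nn_integral_cmult) measurable
      finally show ?thesis by (intro mult_left_mono) auto
    qed simp
  qed simp
  finally show ?thesis unfolding norm_test_fun_eq(1)[OF f] .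
qed

lemma sub_leray_norm_le:
  assumes "\<gamma> > 1" "-1 < d" "d < 2 * \<gamma> - 1"
  shows "sub_leray_norm \<gamma> k (hyp_measure \<gamma> d) \<le> ennreal (sqrt (leray_symbol d \<gamma> k))"
  unfolding sub_leray_norm_def
  by (intro SUP_least L2_norm_on_quotient_le less_imp_le[OF leray_symbol_pos[OF assms]])
    (use norm_sub_leray_le[OF assms] in auto)

section \<open>Wave packets that nearly attain the norm\<close>

text \<open>A smooth function with support in \<open>[1/n, n]\<close> that tends to \<open>1\<close> on the positive axis; its
  values between \<open>0\<close> and \<open>1\<close> make the truncated integrals comparable.\<close>

definition cutoff :: "nat \<Rightarrow> real \<Rightarrow> real" where
  "cutoff n r = bump 1 (real n * r - 1) * bump 1 (real n * (real n - r))"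

definition window :: "real \<Rightarrow> real" where
  "window x = bump 1 x * bump 1 (1 - x)"

text \<open>Equality in the Cauchy-Schwarz inequality at \<open>\<xi> = 1\<close> holds for
  \<open>r\<^sup>m\<^sup>-\<^sup>d exp (- (\<gamma> - 1) r\<^sup>\<gamma>)\<close> with \<open>m = wexp \<gamma> k\<close>; the cutoff makes its support compact.\<close>

definition extremal :: "real \<Rightarrow> real \<Rightarrow> nat \<Rightarrow> nat \<Rightarrow> real \<Rightarrow> real" where
  "extremal \<gamma> d k n r = r powr (wexp \<gamma> k - d) * exp (- ((\<gamma> - 1) * r powr \<gamma>)) * cutoff n r"

text \<open>A wave of frequency \<open>1\<close> with a wide envelope: its Fourier transform concentrates at \<open>\<xi> = 1\<close> as \<open>e\<close>
  tends to \<open>0\<close>.\<close>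

definition wave :: "real \<Rightarrow> real \<Rightarrow> complex" where
  "wave e s = cis s * of_real (window (e * s))"

definition test_packet :: "real \<Rightarrow> real \<Rightarrow> nat \<Rightarrow> nat \<Rightarrow> real \<Rightarrow> complex \<times> complex \<Rightarrow> complex" where
  "test_packet \<gamma> d k n e \<zeta> = (fst \<zeta> * of_real (norm (fst \<zeta>) powr (-1))) ^ k *
     of_real (extremal \<gamma> d k n (norm (fst \<zeta>))) * wave e (Re (snd \<zeta>))"

lemma bump_1: "bump 1 x = (if x > 0 then exp (- (1 / x)) else 0)"
  by (simp add: bump_def)

lemma bump_1_bounds: "0 \<le> bump 1 x" "bump 1 x \<le> 1"
  by (auto simp: bump_1)

lemma bump_continuous: "continuous_on A (bump P)"
  using bump_has_derivative by (meson DERIV_isCont continuous_at_imp_continuous_on)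

lemma bump_continuous_compose [continuous_intros]:
  "continuous_on A f \<Longrightarrow> continuous_on A (\<lambda>x. bump P (f x))"
  by (rule continuous_on_compose2[OF bump_continuous[of UNIV]]) auto

lemma cutoff_bounds: "0 \<le> cutoff n r" "cutoff n r \<le> 1"
  using bump_1_bounds[of "real n * r - 1"] bump_1_bounds[of "real n * (real n - r)"]
  by (auto simp: cutoff_def intro!: mult_le_one)

lemma cutoff_support: "cutoff n r \<noteq> 0 \<Longrightarrow> 0 < n \<and> 1 / real n \<le> r \<and> r \<le> real n"
  by (cases "n = 0") (auto simp: cutoff_def bump_1 zero_less_mult_iff field_simps split: if_splits)

lemma cutoff_continuous: "continuous_on A (cutoff n)"
  unfolding cutoff_def[abs_def] by (intro continuous_intros)

lemma cutoff_tendsto: "r > 0 \<Longrightarrow> (\<lambda>n. cutoff n r) \<longlonglongrightarrow> 1"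
proof -
  assume r: "r > 0"
  have ev: "\<forall>\<^sub>F n in sequentially. exp (- (1 / (real n * r - 1))) * exp (- (1 / (real n * (real n - r)))) = cutoff n r"
    using eventually_gt_at_top[of "nat \<lceil>max r (1 / r)\<rceil>"]
  proof eventually_elim
    case (elim n)
    then have "real n > r" "real n > 1 / r" by linarith+
    then have "real n * r - 1 > 0" "real n * (real n - r) > 0" using r by (auto simp: field_simps)
    then show ?case by (simp add: cutoff_def bump_1)
  qed
  have "(\<lambda>n. exp (- (1 / (real n * r - 1))) * exp (- (1 / (real n * (real n - r))))) \<longlonglongrightarrow> 1"
    using r by real_asymp
  then show ?thesis using ev by (rule Lim_transform_eventually)
qed

lemma window_bounds: "0 \<le> window x" "window x \<le> 1"
  using bump_1_bounds[of x] bump_1_bounds[of "1 - x"] by (auto simp: window_def intro!: mult_le_one)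

lemma window_support: "window x \<noteq> 0 \<Longrightarrow> 0 \<le> x \<and> x \<le> 1"
  by (auto simp: window_def bump_1 split: if_splits)

lemma window_pos: "0 < x \<Longrightarrow> x < 1 \<Longrightarrow> window x > 0"
  by (simp add: window_def bump_1)

lemma window_continuous: "continuous_on A window"
  unfolding window_def[abs_def] by (intro continuous_intros)

lemma window_measurable [measurable]: "window \<in> borel_measurable borel"
  by (rule borel_measurable_continuous_onI[OF window_continuous])

lemma cutoff_measurable [measurable]: "cutoff n \<in> borel_measurable borel"
  by (rule borel_measurable_continuous_onI[OF cutoff_continuous])

lemma extremal_support: "extremal \<gamma> d k n r \<noteq> 0 \<Longrightarrow> 0 < n \<and> 1 / real n \<le> r \<and> r \<le> real n"
  using cutoff_support[of n r] by (auto simp: extremal_def)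

lemma extremal_nonpos: "r \<le> 0 \<Longrightarrow> extremal \<gamma> d k n r = 0"
  using extremal_support[of \<gamma> d k n r] by (cases "extremal \<gamma> d k n r = 0") (auto simp: divide_le_0_iff dest: order_trans)

lemma extremal_measurable [measurable]: "extremal \<gamma> d k n \<in> borel_measurable borel"
  unfolding extremal_def[abs_def] by measurable

lemma extremal_continuous: "continuous_on UNIV (extremal \<gamma> d k n)"
proof (cases "n = 0")
  case True
  then have "extremal \<gamma> d k n = (\<lambda>_. 0)" using extremal_support[of \<gamma> d k n] by auto
  then show ?thesis by simp
next
  case False
  have 1: "continuous_on {0<..} (extremal \<gamma> d k n)"
    unfolding extremal_def[abs_def] by (intro continuous_intros cutoff_continuous) auto
  have 2: "continuous_on {..<1 / real n} (extremal \<gamma> d k n)"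
    by (rule continuous_on_eq[of _ "\<lambda>_. 0"]) (use extremal_support[of \<gamma> d k n] in force)+
  have "{0<..} \<union> {..<1 / real n} = (UNIV :: real set)"
  proof -
    have "0 < 1 / real n" using False by simp
    then have "x > 0 \<or> x < 1 / real n" for x :: real by linarith
    then show ?thesis by auto
  qed
  then show ?thesis using continuous_on_open_Un[OF _ _ 1 2] by simp
qed

lemma wave_continuous: "continuous_on A (wave e)"
  unfolding wave_def[abs_def]
  by (intro continuous_intros continuous_on_compose2[OF window_continuous[of UNIV]]) auto

lemma packet_compact_profile:
  assumes "\<gamma> > 1" "n > 0" "e > 0"
  shows "compact_profile \<gamma> (\<lambda>(r, s). of_real (extremal \<gamma> d k n r) * wave e s) (1 / real n) (real n) (1 / e)"
proof
  show "continuous_on UNIV (\<lambda>(r, s). of_real (extremal \<gamma> d k n r) * wave e s)"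
    unfolding case_prod_beta'
    by (intro continuous_intros continuous_on_compose2[OF extremal_continuous] continuous_on_compose2[OF wave_continuous[of UNIV]]) auto
  fix r s assume "(case (r, s) of (r, s) \<Rightarrow> complex_of_real (extremal \<gamma> d k n r) * wave e s) \<noteq> 0"
  then have "extremal \<gamma> d k n r \<noteq> 0" "window (e * s) \<noteq> 0" by (auto simp: wave_def)
  then show "1 / real n \<le> r \<and> r \<le> real n \<and> \<bar>s\<bar> \<le> 1 / e"
    using extremal_support[of \<gamma> d k n r] window_support[of "e * s"] assms
    by (auto simp: zero_le_mult_iff field_simps)
qed (use assms in auto)

lemma smooth_gen_fst: "smooth_gen fst"
  by (rule smooth_gen.linear[OF bounded_linear_fst])

lemma smooth_gen_snd: "smooth_gen (\<lambda>x. of_real (snd x))"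
  by (intro smooth_gen.linear bounded_linear_compose[OF bounded_linear_of_real] bounded_linear_snd)

lemma smooth_gen_norm: "smooth_gen (\<lambda>x. of_real (norm (fst x)))"
  using smooth_gen.norm_powr[of 1] by simp

lemma smooth_gen_affine:
  assumes "smooth_gen (\<lambda>x. of_real (u x))"
  shows "smooth_gen (\<lambda>x. of_real (a + b * u x))"
  using smooth_gen.add[OF smooth_gen.const[of "of_real a"] smooth_gen.mult[OF smooth_gen.const[of "of_real b"] assms]]
  by simp

lemma test_packet_test_fun:
  assumes g: "\<gamma> > 1" and n: "n > 0" and e: "e > 0"
  shows "test_fun \<gamma> (test_packet \<gamma> d k n e)"
proof -
  define m where "m = wexp \<gamma> k - d"
  have ext: "of_real (extremal \<gamma> d k n r) = of_real (r powr m) * exp (of_real (0 + (- (\<gamma> - 1)) * r powr \<gamma>)) *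
      (of_real (bump 1 (- 1 + real n * r)) * of_real (bump 1 (real n * real n + (- real n) * r)) :: complex)" for r
    by (simp add: extremal_def cutoff_def m_def exp_of_real[symmetric] algebra_simps)
  have wav: "wave e s = exp (\<i> * of_real s) * (of_real (bump 1 (0 + e * s)) * of_real (bump 1 (1 + (- e) * s)))" for s
    by (simp add: wave_def window_def cis_conv_exp)
  have "smooth_gen (\<lambda>x. (fst x * of_real (norm (fst x) powr (-1))) ^ k * of_real (extremal \<gamma> d k n (norm (fst x))) * wave e (snd x))"
    unfolding ext wav
    by (intro smooth_gen.mult smooth_gen_power smooth_gen.norm_powr smooth_gen_fst smooth_gen.exp smooth_gen.bump
        smooth_gen_affine smooth_gen_norm smooth_gen_snd smooth_gen.const)
  then have "smooth_fun_on punctured (\<lambda>(w, s). test_packet \<gamma> d k n e (w, Complex s (norm w powr \<gamma>)))"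
    using smooth_gen_smooth unfolding test_packet_def case_prod_beta' by simp
  moreover have "\<exists>K. compact K \<and> K \<subseteq> hypersurface \<gamma> \<inter> {\<zeta>. fst \<zeta> \<noteq> 0} \<and>
      (\<forall>\<zeta> \<in> hypersurface \<gamma> - K. test_packet \<gamma> d k n e \<zeta> = 0)"
  proof -
    define A where "A = cball (0::complex) (real n) \<inter> {w. 1 / real n \<le> norm w}"
    define K where "K = (\<lambda>(w, s). (w, Complex s (norm w powr \<gamma>))) ` (A \<times> {0..1/e})"
    have "closed {w::complex. 1 / real n \<le> norm w}" by (intro closed_Collect_le continuous_intros)
    then have "compact A" unfolding A_def by (intro compact_Int_closed) auto
    have A0: "w \<noteq> 0" if "w \<in> A" for w using that n by (auto simp: A_def)
    have "compact K" unfolding K_def case_prod_beta' Complex_eq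
      using A0 \<open>compact A\<close> by (intro compact_continuous_image compact_Times continuous_intros) auto
    moreover have "K \<subseteq> hypersurface \<gamma> \<inter> {\<zeta>. fst \<zeta> \<noteq> 0}"
      using A0 by (auto simp: K_def hypersurface_def)
    moreover have "test_packet \<gamma> d k n e \<zeta> = 0" if \<zeta>: "\<zeta> \<in> hypersurface \<gamma> - K" for \<zeta>
    proof (rule ccontr)
      assume "test_packet \<gamma> d k n e \<zeta> \<noteq> 0"
      then have nz: "extremal \<gamma> d k n (norm (fst \<zeta>)) \<noteq> 0" "window (e * Re (snd \<zeta>)) \<noteq> 0"
        by (auto simp: test_packet_def wave_def)
      have "fst \<zeta> \<in> A" using extremal_support[OF nz(1)] by (simp add: A_def)
      moreover have "Re (snd \<zeta>) \<in> {0..1/e}" using window_support[OF nz(2)] e by (auto simp: zero_le_mult_iff field_simps)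
      moreover have "\<zeta> = (fst \<zeta>, Complex (Re (snd \<zeta>)) (norm (fst \<zeta>) powr \<gamma>))"
        using \<zeta> by (simp add: hypersurface_def prod_eq_iff complex_eq_iff)
      ultimately have "\<zeta> \<in> K" unfolding K_def by (metis (mono_tags, lifting) SigmaI case_prod_conv image_eqI)
      then show False using \<zeta> by simp
    qed
    ultimately show ?thesis by blast
  qed
  ultimately show ?thesis unfolding test_fun_def by blast
qed

lemma test_packet_param:
  assumes "r > 0"
  shows "test_packet \<gamma> d k n e (param \<gamma> (r, \<theta>, s)) = of_real (extremal \<gamma> d k n r) * wave e s * cis (real k * \<theta>)"
proof -
  have "complex_of_real r * of_real (r powr (-1)) = 1"
    using assms by (simp add: powr_minus flip: of_real_mult)
  then have "of_real r * cis \<theta> * of_real (r powr (-1)) = cis \<theta>"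
    by (metis mult.assoc mult.commute mult_1_left)
  then have "(of_real r * cis \<theta> * of_real (r powr (-1))) ^ k = cis (real k * \<theta>)"
    by (simp only: Complex.DeMoivre)
  moreover have "norm (of_real r * cis \<theta>) = r" using assms by (simp add: norm_mult)
  ultimately show ?thesis unfolding test_packet_def param_def prod.case fst_conv snd_conv
    by (simp only: complex.sel mult.commute[of "cis (real k * \<theta>)"] mult.assoc mult.left_commute[of "cis (real k * \<theta>)"])
qed

text \<open>A packet has a single angular mode, so it equals its \<open>k\<close>-th Fourier component.\<close>

lemma fourier_component_test_packet:
  assumes r: "r > 0"
  shows "fourier_component \<gamma> k (test_packet \<gamma> d k n e) (param \<gamma> (r, \<theta>, s)) =
    of_real (extremal \<gamma> d k n r) * wave e s * cis (real k * \<theta>)"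
proof -
  have "cis (real k * \<phi>) * cis (- real k * \<phi>) = 1" for \<phi> by (simp add: cis_mult)
  then have "test_packet \<gamma> d k n e (param \<gamma> (r, \<phi>, s)) * cis (- real k * \<phi>) = of_real (extremal \<gamma> d k n r) * wave e s" for \<phi>
    unfolding test_packet_param[OF r] by (metis mult.assoc mult.right_neutral)
  then have "fourier_coeff \<gamma> k (test_packet \<gamma> d k n e) r s = of_real (extremal \<gamma> d k n r) * wave e s"
    unfolding fourier_coeff_def set_lebesgue_integral_def by (simp add: scaleR_conv_of_real)
  then show ?thesis by (simp add: fourier_component_param[OF r])
qed

definition window_energy :: ennreal where
  "window_energy = (\<integral>\<^sup>+x. ennreal ((window x)\<^sup>2) \<partial>lborel)"

lemma window_energy_pos: "window_energy > 0"
proof (rule ccontr)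
  assume "\<not> window_energy > 0"
  then have "AE x in lborel. ennreal ((window x)\<^sup>2) = 0"
    unfolding window_energy_def by (subst nn_integral_0_iff_AE[symmetric]) auto
  then have "AE x in lborel. x \<notin> {0<..<1::real}"
  proof eventually_elim
    case (elim x)
    then show ?case using window_pos[of x] by (auto simp: ennreal_eq_0_iff)
  qed
  then have "{0<..<1::real} \<in> null_sets lborel" by (subst AE_iff_null_sets) auto
  then show False by (simp add: null_sets_def)
qed

lemma window_energy_finite: "window_energy < \<infinity>"
proof -
  have "window_energy \<le> (\<integral>\<^sup>+x. indicator {0..1::real} x \<partial>lborel)"
    unfolding window_energy_def
  proof (rule nn_integral_mono)
    fix x show "ennreal ((window x)\<^sup>2) \<le> indicator {0..1::real} x"
      using window_bounds[of x] window_support[of x] power_le_one[of "window x" 2]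
      by (cases "window x = 0") auto
  qed
  then show ?thesis by (auto simp: less_top[symmetric] top_unique)
qed

definition window_hat :: "real \<Rightarrow> complex" where
  "window_hat = fourier (\<lambda>x. of_real (window x))"

lemma window_hat_measurable [measurable]: "window_hat \<in> borel_measurable borel"
  unfolding window_hat_def by measurable

lemma window_hat_energy: "energy lborel window_hat = ennreal (2 * pi) * window_energy"
proof -
  have "integrable lborel (\<lambda>x. complex_of_real (window x))"
  proof (rule Bochner_Integration.integrable_bound[OF integrable_indicator_Icc[of 0 1]])
    show "AE x in lborel. norm (complex_of_real (window x)) \<le> norm (indicator {0..1} x :: real)"
    proof (rule AE_I2)
      fix x show "norm (complex_of_real (window x)) \<le> norm (indicator {0..1} x :: real)"
        using window_bounds[of x] window_support[of x] by (cases "window x = 0") auto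
    qed
  qed simp
  moreover have "norm (complex_of_real (window x)) \<le> 1" for x using window_bounds[of x] by simp
  moreover have "continuous_on UNIV (\<lambda>x. complex_of_real (window x))"
    by (intro continuous_intros window_continuous)
  ultimately show ?thesis unfolding window_hat_def window_energy_def by (subst plancherel) auto
qed

lemma fourier_wave:
  assumes e: "e > 0"
  shows "fourier (wave e) (- \<xi>) = of_real (1 / e) * window_hat ((1 - \<xi>) / e)"
proof -
  have "fourier (wave e) (- \<xi>) = (\<integral>x. cis ((1 - \<xi>) * x) * of_real (window (e * x)) \<partial>lborel)"
    unfolding fourier_def wave_def
  proof (rule Bochner_Integration.integral_cong[OF refl])
    fix x
    have "cis (x * - \<xi>) * cis x = cis ((1 - \<xi>) * x)" by (simp add: cis_mult algebra_simps)
    then show "cis (x * - \<xi>) * (cis x * of_real (window (e * x))) = cis ((1 - \<xi>) * x) * of_real (window (e * x))"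
      by (simp add: mult.assoc[symmetric])
  qed
  also have "\<dots> = \<bar>1 / e\<bar> *\<^sub>R (\<integral>x. cis ((1 - \<xi>) * (0 + 1 / e * x)) * of_real (window (e * (0 + 1 / e * x))) \<partial>lborel)"
    using e by (intro lborel_integral_real_affine) auto
  also have "(\<lambda>x. cis ((1 - \<xi>) * (0 + 1 / e * x)) * of_real (window (e * (0 + 1 / e * x)))) = (\<lambda>x. cis (x * ((1 - \<xi>) / e)) * complex_of_real (window x))"
    using e by (auto simp: fun_eq_iff mult_ac)
  finally show ?thesis using e by (simp add: window_hat_def fourier_def scaleR_conv_of_real)
qed

text \<open>The profile of a packet factors into this function of \<open>\<xi>\<close> and the Fourier transform of its wave.\<close>

definition radial_moment :: "real \<Rightarrow> real \<Rightarrow> nat \<Rightarrow> nat \<Rightarrow> real \<Rightarrow> real" where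
  "radial_moment \<gamma> d k n \<xi> = (\<integral>r. r powr (wexp \<gamma> k) * damping \<gamma> \<xi> r * extremal \<gamma> d k n r \<partial>lborel)"

lemma radial_moment_continuous:
  assumes g: "\<gamma> > 1" shows "continuous_on UNIV (radial_moment \<gamma> d k n)"
proof (rule continuous_at_imp_continuous_on, rule ballI)
  fix \<xi> :: real
  define w where "w = (\<lambda>r. r powr (wexp \<gamma> k) * \<bar>extremal \<gamma> d k n r\<bar>)"
  have w: "integrable lborel w"
  proof -
    have c: "continuous_on {1 / real n..real n} w"
    proof (cases "n = 0")
      case False
      then show ?thesis unfolding w_def
        by (intro continuous_intros continuous_on_subset[OF extremal_continuous]) (auto simp: field_simps)
    qed (simp add: w_def)
    \<comment> \<open>The factor \<open>extremal\<close> vanishes off \<open>[1/n, n]\<close>, so integrability is a matter of continuity there.\<close>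
    have "integrable lborel (\<lambda>r. indicator {1 / real n..real n} r *\<^sub>R w r)"
      by (rule borel_integrable_compact[OF _ c]) simp
    moreover have "(\<lambda>r. indicator {1 / real n..real n} r *\<^sub>R w r) = w"
      using extremal_support[of \<gamma> d k n] by (fastforce simp: w_def fun_eq_iff split: split_indicator)
    ultimately show ?thesis by simp
  qed
  have fac: "damping \<gamma> x r \<le> 1" for x r using g by simp
  show "isCont (radial_moment \<gamma> d k n) \<xi>"
    unfolding continuous_at_sequentially
  proof (intro allI impI)
    fix X :: "nat \<Rightarrow> real" assume X: "X \<longlonglongrightarrow> \<xi>"
    have "(\<lambda>i. radial_moment \<gamma> d k n (X i)) \<longlonglongrightarrow> radial_moment \<gamma> d k n \<xi>"
      unfolding radial_moment_def
    proof (rule integral_dominated_convergence[where w = w])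
      show "AE r in lborel. (\<lambda>i. r powr (wexp \<gamma> k) * damping \<gamma> (X i) r * extremal \<gamma> d k n r)
         \<longlonglongrightarrow> r powr (wexp \<gamma> k) * damping \<gamma> \<xi> r * extremal \<gamma> d k n r"
        by (intro AE_I2 tendsto_intros X)
      show "AE r in lborel. norm (r powr (wexp \<gamma> k) * damping \<gamma> (X i) r * extremal \<gamma> d k n r) \<le> w r" for i
      proof (rule AE_I2)
        fix r
        have "w r * damping \<gamma> (X i) r \<le> w r * 1"
          by (intro mult_left_mono fac) (simp add: w_def)
        then show "norm (r powr (wexp \<gamma> k) * damping \<gamma> (X i) r * extremal \<gamma> d k n r) \<le> w r"
          by (simp add: w_def abs_mult mult_ac)
      qed
    qed (use w in auto)
    then show "(radial_moment \<gamma> d k n \<circ> X) \<longlonglongrightarrow> radial_moment \<gamma> d k n \<xi>" by (simp add: o_def)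
  qed
qed

lemma radial_moment_measurable: "\<gamma> > 1 \<Longrightarrow> radial_moment \<gamma> d k n \<in> borel_measurable borel"
  by (rule borel_measurable_continuous_onI[OF radial_moment_continuous])

lemma packet_profile:
  assumes g: "\<gamma> > 1" and n: "n > 0" and e: "e > 0"
  shows "profile \<gamma> k (\<lambda>(r, s). of_real (extremal \<gamma> d k n r) * wave e s) \<xi>
    = of_real (radial_moment \<gamma> d k n \<xi> / e) * window_hat ((1 - \<xi>) / e)"
proof -
  note cp = packet_compact_profile[OF g n e, of d k]
  have sl: "fourier (compact_profile.slice (\<lambda>(r, s). of_real (extremal \<gamma> d k n r) * wave e s) r) (- \<xi>) = of_real (extremal \<gamma> d k n r) * fourier (wave e) (- \<xi>)" for r
    unfolding fourier_def compact_profile.slice_def[OF cp]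
    by (simp add: mult.left_commute[of "cis _"])
  have "profile \<gamma> k (\<lambda>(r, s). of_real (extremal \<gamma> d k n r) * wave e s) \<xi>
    = (\<integral>r. of_real (r powr (wexp \<gamma> k) * damping \<gamma> \<xi> r * extremal \<gamma> d k n r) * fourier (wave e) (- \<xi>) \<partial>lborel)"
    unfolding compact_profile.profile_eq_slices[OF cp] sl by (simp add: mult.assoc)
  also have "\<dots> = of_real (radial_moment \<gamma> d k n \<xi>) * fourier (wave e) (- \<xi>)"
    unfolding radial_moment_def by (simp only: integral_mult_left_zero integral_complex_of_real)
  finally show ?thesis unfolding fourier_wave[OF e] by simp
qed

text \<open>After the substitution \<open>\<xi> = 1 - e y\<close> the frequency distribution of the packet is fixed and the weights
  are evaluated near \<open>1\<close>.\<close>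

lemma norm_sub_leray_test_packet:
  assumes g: "\<gamma> > 1" and d: "d > -1" and n: "n > 0" and e: "e > 0"
  shows "energy (hyp_measure \<gamma> d) (sub_leray \<gamma> k (test_packet \<gamma> d k n e))
    = ennreal (1 / e) * (\<integral>\<^sup>+y. indicator {0<..} (1 - e * y) * ennreal (symbol_weight d \<gamma> k (1 - e * y)) *
        ennreal ((radial_moment \<gamma> d k n (1 - e * y))\<^sup>2) * ennreal ((norm (window_hat y))\<^sup>2) \<partial>lborel)"
proof -
  let ?F = "\<lambda>(r, s). of_real (extremal \<gamma> d k n r) * wave e s"
  note cp = packet_compact_profile[OF g n e, of d k]
  note [measurable] = radial_moment_measurable[OF g, of d k n]
  define h where "h = (\<lambda>\<xi>. indicator {0<..} \<xi> * ennreal (symbol_weight d \<gamma> k \<xi>) * ennreal ((norm (profile \<gamma> k ?F \<xi>))\<^sup>2))"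
  have hm: "h \<in> borel_measurable borel"
    unfolding h_def packet_profile[OF g n e] symbol_weight_def by measurable
  have "energy (hyp_measure \<gamma> d) (sub_leray \<gamma> k (test_packet \<gamma> d k n e)) = (\<integral>\<^sup>+\<xi>. h \<xi> \<partial>lborel)"
    unfolding sub_leray_def h_def
    by (rule compact_profile.norm_leray_bdry_eq[OF cp _ d]) (simp add: fourier_component_test_packet)
  also have "\<dots> = ennreal \<bar>- e\<bar> * (\<integral>\<^sup>+y. h (1 + - e * y) \<partial>lborel)"
    using e by (intro nn_integral_real_affine hm) simp
  also have "(\<integral>\<^sup>+y. h (1 + - e * y) \<partial>lborel) = (\<integral>\<^sup>+y. ennreal (1 / e\<^sup>2) * (indicator {0<..} (1 - e * y) * ennreal (symbol_weight d \<gamma> k (1 - e * y)) *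
        ennreal ((radial_moment \<gamma> d k n (1 - e * y))\<^sup>2) * ennreal ((norm (window_hat y))\<^sup>2)) \<partial>lborel)"
  proof (rule nn_integral_cong)
    fix y
    have "(norm (profile \<gamma> k ?F (1 - e * y)))\<^sup>2 = 1 / e\<^sup>2 * ((radial_moment \<gamma> d k n (1 - e * y))\<^sup>2 * (norm (window_hat y))\<^sup>2)"
      unfolding packet_profile[OF g n e] using e by (simp add: norm_mult norm_divide power_mult_distrib power_divide)
    then have "ennreal ((norm (profile \<gamma> k ?F (1 - e * y)))\<^sup>2) = ennreal (1 / e\<^sup>2) * (ennreal ((radial_moment \<gamma> d k n (1 - e * y))\<^sup>2) * ennreal ((norm (window_hat y))\<^sup>2))"
      by (simp only: ennreal_mult zero_le_power2 zero_le_divide_1_iff mult_nonneg_nonneg)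
    then show "h (1 + - e * y) = ennreal (1 / e\<^sup>2) * (indicator {0<..} (1 - e * y) * ennreal (symbol_weight d \<gamma> k (1 - e * y)) *
        ennreal ((radial_moment \<gamma> d k n (1 - e * y))\<^sup>2) * ennreal ((norm (window_hat y))\<^sup>2))"
      by (simp add: h_def mult_ac)
  qed
  also have "\<dots> = ennreal (1 / e\<^sup>2) * (\<integral>\<^sup>+y. (indicator {0<..} (1 - e * y) * ennreal (symbol_weight d \<gamma> k (1 - e * y)) *
        ennreal ((radial_moment \<gamma> d k n (1 - e * y))\<^sup>2) * ennreal ((norm (window_hat y))\<^sup>2)) \<partial>lborel)"
    unfolding symbol_weight_def by (rule nn_integral_cmult) measurable
  finally show ?thesis using e
    by (simp add: mult.assoc[symmetric] ennreal_mult[symmetric] power2_eq_square)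
qed

definition radial_energy :: "real \<Rightarrow> real \<Rightarrow> nat \<Rightarrow> nat \<Rightarrow> ennreal" where
  "radial_energy \<gamma> d k n = (\<integral>\<^sup>+r. ennreal (r powr d) * indicator {0<..} r * ennreal ((extremal \<gamma> d k n r)\<^sup>2) \<partial>lborel)"

lemma norm_test_packet:
  assumes g: "\<gamma> > 1" and n: "n > 0" and e: "e > 0"
  shows "energy (hyp_measure \<gamma> d) (test_packet \<gamma> d k n e)
    = ennreal (1 / e) * (radial_energy \<gamma> d k n * (ennreal (2 * pi) * window_energy))"
proof -
  have win: "(\<integral>\<^sup>+s. ennreal ((window (e * s))\<^sup>2) \<partial>lborel) = ennreal (1 / e) * window_energy"
    using nn_integral_real_affine[of "\<lambda>s. ennreal ((window (e * s))\<^sup>2)" "1 / e" 0] e by (simp add: window_energy_def)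
  have "energy (hyp_measure \<gamma> d) (test_packet \<gamma> d k n e)
    = polar_integral d (chart_norm_sq \<gamma> (test_packet \<gamma> d k n e))"
    by (rule norm_test_fun_eq(1)[OF test_packet_test_fun[OF g n e]])
  also have "\<dots> = (\<integral>\<^sup>+r. (ennreal (r powr d) * indicator {0<..} r * ennreal ((extremal \<gamma> d k n r)\<^sup>2)) * (ennreal (2 * pi) * (ennreal (1 / e) * window_energy)) \<partial>lborel)"
  proof (rule nn_integral_cong)
    fix r :: real
    show "ennreal (r powr d) * indicator {0<..} r * circle_integral (chart_norm_sq \<gamma> (test_packet \<gamma> d k n e)) r
      = (ennreal (r powr d) * indicator {0<..} r * ennreal ((extremal \<gamma> d k n r)\<^sup>2)) * (ennreal (2 * pi) * (ennreal (1 / e) * window_energy))"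
    proof (cases "r > 0")
      case True
      have "chart_norm_sq \<gamma> (test_packet \<gamma> d k n e) (of_real r * cis \<theta>, s) = ennreal ((extremal \<gamma> d k n r)\<^sup>2) * ennreal ((window (e * s))\<^sup>2)" for \<theta> s
        using True by (simp add: chart_norm_sq_def chart_param[symmetric] test_packet_param wave_def norm_mult power_mult_distrib ennreal_mult)
      then have "(\<integral>\<^sup>+s. chart_norm_sq \<gamma> (test_packet \<gamma> d k n e) (of_real r * cis \<theta>, s) \<partial>lborel) = ennreal ((extremal \<gamma> d k n r)\<^sup>2) * (ennreal (1 / e) * window_energy)" for \<theta>
        by (simp add: nn_integral_cmult win)
      then show ?thesis by (simp only: nn_integral_period_const) (simp only: mult_ac)
    qed simp
  qed
  also have "\<dots> = radial_energy \<gamma> d k n * (ennreal (2 * pi) * (ennreal (1 / e) * window_energy))"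
    unfolding radial_energy_def by (rule nn_integral_multc) measurable
  finally show ?thesis by (simp only: mult_ac)
qed

section \<open>The norms of the sub-Leray operators\<close>

text \<open>The integrand of \<open>dual_weight\<close> at \<open>\<xi> = 1\<close>. Both the moment and the energy of \<open>extremal\<close> are integrals
  of it, against \<open>cutoff\<close> and its square.\<close>

definition dual_density :: "real \<Rightarrow> real \<Rightarrow> nat \<Rightarrow> real \<Rightarrow> real" where
  "dual_density \<gamma> d k r = indicator {0<..} r *
     (r powr (2 * (wexp \<gamma> k) - d) * exp (- (2 * (\<gamma> - 1) * r powr \<gamma>)))"

lemma dual_density_nonneg: "dual_density \<gamma> d k r \<ge> 0"
  by (simp add: dual_density_def)

lemma dual_density_measurable [measurable]: "dual_density \<gamma> d k \<in> borel_measurable borel"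
  unfolding dual_density_def[abs_def] by measurable

lemma dual_density_integral:
  assumes g: "\<gamma> > 1" and d: "d < 2 * \<gamma> - 1"
  shows "integrable lborel (dual_density \<gamma> d k)" "(\<integral>r. dual_density \<gamma> d k r \<partial>lborel) = dual_weight d \<gamma> k 1"
    "dual_weight d \<gamma> k 1 > 0"
proof -
  define a where "a = \<gamma> * (2 * real k + 2) - (2 * real k + 1 + d)"
  have "a = (\<gamma> - 1) * (2 * real k) + (2 * \<gamma> - 1 - d)"
    by (simp add: a_def algebra_simps)
  moreover have "(\<gamma> - 1) * (2 * real k) \<ge> 0" using g by simp
  ultimately have a: "a > 0" using d by linarith
  have ag: "a / \<gamma> = 2 * real k + 2 - (2 * real k + 1 + d) / \<gamma>" using g by (simp add: a_def diff_divide_distrib)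
  have e: "2 * ((\<gamma> - 1) * (1 + real k)) - d = a - 1" by (simp add: a_def algebra_simps)
  show pos: "dual_weight d \<gamma> k 1 > 0"
    unfolding dual_weight_def ag[symmetric] using a g by (simp add: Gamma_real_pos)
  have "(\<integral>\<^sup>+r. ennreal (dual_density \<gamma> d k r) \<partial>lborel) =
    (\<integral>\<^sup>+r. ennreal (r powr (a - 1) * exp (- ((2 * (\<gamma> - 1)) * r powr \<gamma>))) * indicator {0<..} r \<partial>lborel)"
    by (intro nn_integral_cong) (auto simp: dual_density_def e split: split_indicator)
  also have "\<dots> = ennreal (Gamma (a / \<gamma>) / \<gamma> * (2 * (\<gamma> - 1)) powr (- (a / \<gamma>)))"
    using a g by (intro nn_integral_powr_exp) auto
  also have "\<dots> = ennreal (dual_weight d \<gamma> k 1)" by (simp add: dual_weight_def ag)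
  finally have "integrable lborel (dual_density \<gamma> d k) \<and> (\<integral>r. dual_density \<gamma> d k r \<partial>lborel) = dual_weight d \<gamma> k 1"
    using pos by (subst (asm) nn_integral_eq_integrable) (auto simp: dual_density_nonneg)
  then show "integrable lborel (dual_density \<gamma> d k)" "(\<integral>r. dual_density \<gamma> d k r \<partial>lborel) = dual_weight d \<gamma> k 1" by auto
qed

lemma cutoff_dual_density_integrable:
  assumes "\<gamma> > 1" "d < 2 * \<gamma> - 1"
  shows "integrable lborel (\<lambda>r. dual_density \<gamma> d k r * cutoff n r)"
proof (rule Bochner_Integration.integrable_bound[OF dual_density_integral(1)[OF assms, of k]])
  show "AE r in lborel. norm (dual_density \<gamma> d k r * cutoff n r) \<le> norm (dual_density \<gamma> d k r)"
    using cutoff_bounds[of n] by (intro AE_I2) (auto simp: abs_mult intro!: mult_left_le)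
qed simp

lemma radial_moment_at_1: "radial_moment \<gamma> d k n 1 = (\<integral>r. dual_density \<gamma> d k r * cutoff n r \<partial>lborel)"
  unfolding radial_moment_def
proof (rule Bochner_Integration.integral_cong[OF refl])
  fix r :: real
  show "r powr (wexp \<gamma> k) * damping \<gamma> 1 r * extremal \<gamma> d k n r = dual_density \<gamma> d k r * cutoff n r"
  proof (cases "r > 0")
    case True
    define m where "m = wexp \<gamma> k"
    have "r powr m * r powr (m - d) = r powr (2 * m - d)" by (simp add: powr_add[symmetric])
    moreover have "exp (- ((\<gamma> - 1) * r powr \<gamma>)) * exp (- ((\<gamma> - 1) * r powr \<gamma>)) = exp (- (2 * (\<gamma> - 1) * r powr \<gamma>))"
      by (simp add: exp_add[symmetric])
    ultimately have "(r powr m * r powr (m - d)) * (exp (- ((\<gamma> - 1) * r powr \<gamma>)) * exp (- ((\<gamma> - 1) * r powr \<gamma>))) * cutoff n r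
       = dual_density \<gamma> d k r * cutoff n r"
      using True by (simp only: dual_density_def m_def[symmetric]) simp
    then show ?thesis unfolding extremal_def m_def[symmetric] by (simp add: mult_ac)
  next
    case False
    then show ?thesis by (simp add: extremal_nonpos dual_density_def)
  qed
qed

lemma radial_moment_at_1_tendsto:
  assumes "\<gamma> > 1" "d < 2 * \<gamma> - 1"
  shows "(\<lambda>n. radial_moment \<gamma> d k n 1) \<longlonglongrightarrow> dual_weight d \<gamma> k 1"
  unfolding radial_moment_at_1 dual_density_integral(2)[OF assms, symmetric]
proof (rule integral_dominated_convergence[where w = "dual_density \<gamma> d k"])
  show "integrable lborel (dual_density \<gamma> d k)" by (rule dual_density_integral(1)[OF assms])
  show "AE r in lborel. (\<lambda>n. dual_density \<gamma> d k r * cutoff n r) \<longlonglongrightarrow> dual_density \<gamma> d k r"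
  proof (rule AE_I2)
    fix r :: real
    show "(\<lambda>n. dual_density \<gamma> d k r * cutoff n r) \<longlonglongrightarrow> dual_density \<gamma> d k r"
    proof (cases "r > 0")
      case True
      show ?thesis using tendsto_mult[OF tendsto_const cutoff_tendsto[OF True]] by simp
    qed (simp add: dual_density_def)
  qed
  show "AE r in lborel. norm (dual_density \<gamma> d k r * cutoff n r) \<le> dual_density \<gamma> d k r" for n
    using cutoff_bounds[of n] dual_density_nonneg[of \<gamma> d k] by (intro AE_I2) (auto simp: abs_mult intro!: mult_left_le)
qed auto

lemma radial_energy_eq:
  "radial_energy \<gamma> d k n = (\<integral>\<^sup>+r. ennreal (dual_density \<gamma> d k r * (cutoff n r)\<^sup>2) \<partial>lborel)"
  unfolding radial_energy_def
proof (rule nn_integral_cong)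
  fix r :: real
  show "ennreal (r powr d) * indicator {0<..} r * ennreal ((extremal \<gamma> d k n r)\<^sup>2) = ennreal (dual_density \<gamma> d k r * (cutoff n r)\<^sup>2)"
  proof (cases "r > 0")
    case True
    define m where "m = wexp \<gamma> k"
    have "r powr d * (r powr (m - d))\<^sup>2 = r powr (2 * m - d)"
      using True by (simp add: powr_power powr_add[symmetric] algebra_simps)
    moreover have "(exp (- ((\<gamma> - 1) * r powr \<gamma>)))\<^sup>2 = exp (- (2 * (\<gamma> - 1) * r powr \<gamma>))"
      by (simp add: exp_double[symmetric] mult_ac)
    ultimately have "dual_density \<gamma> d k r * (cutoff n r)\<^sup>2 = r powr d * (extremal \<gamma> d k n r)\<^sup>2"
      unfolding dual_density_def extremal_def m_def[symmetric] using True
      by (simp add: power_mult_distrib mult.assoc[symmetric])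
    then show ?thesis using True by (simp add: ennreal_mult)
  qed (simp add: dual_density_def)
qed

lemma radial_energy_bounds:
  assumes "\<gamma> > 1" "d < 2 * \<gamma> - 1" and pos: "radial_moment \<gamma> d k n 1 > 0"
  obtains v where "radial_energy \<gamma> d k n = ennreal v" "0 < v" "v \<le> radial_moment \<gamma> d k n 1"
proof -
  note nn = dual_density_nonneg[of \<gamma> d k]
  have le: "radial_energy \<gamma> d k n \<le> ennreal (radial_moment \<gamma> d k n 1)"
  proof -
    have "radial_energy \<gamma> d k n \<le> (\<integral>\<^sup>+r. ennreal (dual_density \<gamma> d k r * cutoff n r) \<partial>lborel)"
      unfolding radial_energy_eq
    proof (intro nn_integral_mono ennreal_leI mult_left_mono nn)
      fix r show "(cutoff n r)\<^sup>2 \<le> cutoff n r"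
        using cutoff_bounds[of n r] by (simp add: power2_eq_square mult_left_le)
    qed
    also have "\<dots> = ennreal (radial_moment \<gamma> d k n 1)"
      unfolding radial_moment_at_1 using nn cutoff_bounds
      by (intro nn_integral_eq_integral cutoff_dual_density_integrable assms) auto
    finally show ?thesis .
  qed
  have "radial_energy \<gamma> d k n \<noteq> 0"
  proof
    assume "radial_energy \<gamma> d k n = 0"
    then have "AE r in lborel. ennreal (dual_density \<gamma> d k r * (cutoff n r)\<^sup>2) = 0"
      unfolding radial_energy_eq by (subst (asm) nn_integral_0_iff_AE) auto
    then have "AE r in lborel. dual_density \<gamma> d k r * cutoff n r = 0"
    proof eventually_elim
      case (elim r)
      then have "dual_density \<gamma> d k r * (cutoff n r)\<^sup>2 \<le> 0" by (simp add: ennreal_eq_0_iff)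
      moreover have "dual_density \<gamma> d k r * (cutoff n r)\<^sup>2 \<ge> 0" using nn by simp
      ultimately show ?case by (metis antisym mult_eq_0_iff power_eq_0_iff)
    qed
    then have "radial_moment \<gamma> d k n 1 = 0" unfolding radial_moment_at_1 by (rule integral_eq_zero_AE)
    then show False using pos by simp
  qed
  then show ?thesis using le that by (cases "radial_energy \<gamma> d k n") (auto simp: top_unique ennreal_le_iff pos less_imp_le)
qed

lemma symbol_weight_continuous_at_1: "isCont (symbol_weight d \<gamma> k) 1"
  unfolding symbol_weight_def[abs_def] by (intro continuous_intros) auto

text \<open>Fatou's lemma, with the continuity of the weights at \<open>\<xi> = 1\<close>.\<close>

lemma packet_ratio_liminf:
  assumes g: "\<gamma> > 1"
  shows "ennreal (symbol_weight d \<gamma> k 1 * (radial_moment \<gamma> d k n 1)\<^sup>2) * (ennreal (2 * pi) * window_energy)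
    \<le> liminf (\<lambda>j. \<integral>\<^sup>+y. indicator {0<..} (1 - 1 / real (Suc j) * y) * ennreal (symbol_weight d \<gamma> k (1 - 1 / real (Suc j) * y)) *
        ennreal ((radial_moment \<gamma> d k n (1 - 1 / real (Suc j) * y))\<^sup>2) * ennreal ((norm (window_hat y))\<^sup>2) \<partial>lborel)"
proof -
  note [measurable] = radial_moment_measurable[OF g, of d k n]
  have [measurable]: "symbol_weight d \<gamma> k \<in> borel_measurable borel" unfolding symbol_weight_def[abs_def] by measurable
  define P where "P = (\<lambda>\<xi>. ennreal (symbol_weight d \<gamma> k \<xi> * (radial_moment \<gamma> d k n \<xi>)\<^sup>2))"
  have cP: "isCont (\<lambda>\<xi>. symbol_weight d \<gamma> k \<xi> * (radial_moment \<gamma> d k n \<xi>)\<^sup>2) 1"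
    using radial_moment_continuous[OF g, of d k n] symbol_weight_continuous_at_1[of d \<gamma> k]
    by (intro continuous_intros) (auto simp: continuous_on_eq_continuous_at)
  define u where "u = (\<lambda>j y. indicator {0<..} (1 - 1 / real (Suc j) * y) * ennreal (symbol_weight d \<gamma> k (1 - 1 / real (Suc j) * y)) *
        ennreal ((radial_moment \<gamma> d k n (1 - 1 / real (Suc j) * y))\<^sup>2) * ennreal ((norm (window_hat y))\<^sup>2))"
  have lim: "(\<lambda>j. u j y) \<longlonglongrightarrow> P 1 * ennreal ((norm (window_hat y))\<^sup>2)" for y
  proof -
    have x: "(\<lambda>j. 1 - 1 / real (Suc j) * y) \<longlonglongrightarrow> 1" by real_asymp
    then have "\<forall>\<^sub>F j in sequentially. 1 - 1 / real (Suc j) * y > 0"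
      by (rule order_tendstoD) simp
    then have ev: "\<forall>\<^sub>F j in sequentially. ennreal ((symbol_weight d \<gamma> k (1 - 1 / real (Suc j) * y) * (radial_moment \<gamma> d k n (1 - 1 / real (Suc j) * y))\<^sup>2) * (norm (window_hat y))\<^sup>2) = u j y"
      by eventually_elim (simp add: u_def ennreal_mult'')
    have "(\<lambda>j. ennreal ((symbol_weight d \<gamma> k (1 - 1 / real (Suc j) * y) * (radial_moment \<gamma> d k n (1 - 1 / real (Suc j) * y))\<^sup>2) * (norm (window_hat y))\<^sup>2))
      \<longlonglongrightarrow> ennreal ((symbol_weight d \<gamma> k 1 * (radial_moment \<gamma> d k n 1)\<^sup>2) * (norm (window_hat y))\<^sup>2)"
      by (intro tendsto_ennrealI tendsto_mult[OF isCont_tendsto_compose[OF cP x] tendsto_const])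
    then have "(\<lambda>j. u j y) \<longlonglongrightarrow> ennreal ((symbol_weight d \<gamma> k 1 * (radial_moment \<gamma> d k n 1)\<^sup>2) * (norm (window_hat y))\<^sup>2)"
      using ev by (rule Lim_transform_eventually)
    then show ?thesis by (simp add: P_def ennreal_mult'')
  qed
  have "P 1 * (ennreal (2 * pi) * window_energy) = (\<integral>\<^sup>+y. P 1 * ennreal ((norm (window_hat y))\<^sup>2) \<partial>lborel)"
    unfolding window_hat_energy[symmetric] by (rule nn_integral_cmult[symmetric]) measurable
  also have "\<dots> = (\<integral>\<^sup>+y. liminf (\<lambda>j. u j y) \<partial>lborel)"
    using lim_imp_Liminf[OF _ lim] by (intro nn_integral_cong) simp
  also have "\<dots> \<le> liminf (\<lambda>j. \<integral>\<^sup>+y. u j y \<partial>lborel)"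
    by (rule nn_integral_liminf) (simp add: u_def)
  finally show ?thesis unfolding u_def P_def .
qed

text \<open>Write \<open>W\<close> for the weight at \<open>\<xi> = 1\<close>, \<open>b\<close> for the moment and \<open>v\<close> for the energy of the truncated
  extremal function. In the limit of wide envelopes the squared quotient of norms is at least
  \<open>W b\<^sup>2 / v\<close>. Since \<open>v \<le> b\<close> this is at least \<open>W b\<close>, which tends to the symbol as the cutoff is
  removed. So first \<open>n\<close> and then the width of the envelope is chosen.\<close>

lemma sub_leray_norm_ge_approx:
  assumes g: "\<gamma> > 1" and d: "-1 < d" "d < 2 * \<gamma> - 1" and c: "0 \<le> c" "c < leray_symbol d \<gamma> k"
  shows "ennreal (sqrt c) \<le> sub_leray_norm \<gamma> k (hyp_measure \<gamma> d)"
proof -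
  define W where "W = symbol_weight d \<gamma> k 1"
  have D: "dual_weight d \<gamma> k 1 > 0" by (rule dual_density_integral(3)[OF g d(2)])
  have WD: "W * dual_weight d \<gamma> k 1 = leray_symbol d \<gamma> k"
    unfolding W_def using g by (rule symbol_weight_times_dual_weight) simp
  then have W: "W > 0" using leray_symbol_pos[OF g d, of k] D by (metis zero_less_mult_pos2)
  have "(\<lambda>n. W * radial_moment \<gamma> d k n 1) \<longlonglongrightarrow> leray_symbol d \<gamma> k"
    unfolding WD[symmetric] by (intro tendsto_mult tendsto_const radial_moment_at_1_tendsto[OF g d(2)])
  then have "\<forall>\<^sub>F n in sequentially. c < W * radial_moment \<gamma> d k n 1" using c(2) by (rule order_tendstoD)
  then have "\<forall>\<^sub>F n in sequentially. n > 0 \<and> c < W * radial_moment \<gamma> d k n 1"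
    using eventually_gt_at_top[of 0] by eventually_elim simp
  then obtain n where n: "n > 0" and cn: "c < W * radial_moment \<gamma> d k n 1"
    by (auto dest: eventually_happens)
  define b where "b = radial_moment \<gamma> d k n 1"
  have "0 < W * b" using cn c(1) by (simp add: b_def)
  then have b: "b > 0" using W by (simp add: zero_less_mult_iff)
  obtain v where v: "radial_energy \<gamma> d k n = ennreal v" "0 < v" "v \<le> b"
    using radial_energy_bounds[OF g d(2)] b unfolding b_def by metis
  obtain X where X: "ennreal (2 * pi) * window_energy = ennreal X" "X > 0"
  proof -
    obtain x where x: "window_energy = ennreal x"
      using window_energy_finite by (cases window_energy) auto
    moreover have "x > 0" using window_energy_pos unfolding x by (metis ennreal_neg less_irrefl not_le)
    ultimately show ?thesis using that[of "2 * pi * x"] by (simp add: ennreal_mult)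
  qed
  define a where "a = (\<lambda>j. \<integral>\<^sup>+y. indicator {0<..} (1 - 1 / real (Suc j) * y) * ennreal (symbol_weight d \<gamma> k (1 - 1 / real (Suc j) * y)) *
        ennreal ((radial_moment \<gamma> d k n (1 - 1 / real (Suc j) * y))\<^sup>2) * ennreal ((norm (window_hat y))\<^sup>2) \<partial>lborel)"
  have "c * v < W * b\<^sup>2"
  proof -
    have "c * v < (W * b) * v" using cn v(2) unfolding b_def by (intro mult_strict_right_mono) auto
    also have "\<dots> \<le> (W * b) * b" using v(3) W b by (intro mult_left_mono) auto
    finally show ?thesis by (simp add: power2_eq_square mult_ac)
  qed
  then have "c * v * X < W * b\<^sup>2 * X" using X(2) by simp
  then have "ennreal (c * v * X) < ennreal (W * b\<^sup>2 * X)"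
    using c(1) v(2) X(2) by (intro ennreal_lessI) (auto intro: le_less_trans[of 0 "c * v * X"])
  also have "\<dots> = ennreal (W * b\<^sup>2) * (ennreal (2 * pi) * window_energy)"
    unfolding X(1) using X(2) by (simp add: ennreal_mult'')
  also have "\<dots> \<le> liminf a"
    unfolding W_def b_def a_def by (rule packet_ratio_liminf[OF g])
  finally have "\<forall>\<^sub>F j in sequentially. ennreal (c * v * X) < a j" by (rule less_LiminfD)
  then obtain j where j: "ennreal (c * v * X) < a j" by (auto dest: eventually_happens)
  define e where "e = 1 / real (Suc j)"
  have e: "e > 0" by (simp add: e_def)
  define f where "f = test_packet \<gamma> d k n e"
  have tf: "test_fun \<gamma> f" unfolding f_def by (rule test_packet_test_fun[OF g n e])
  have V: "energy (hyp_measure \<gamma> d) f = ennreal (1 / e * (v * X))"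
    unfolding f_def norm_test_packet[OF g n e] v(1) X(1) using e v(2) X(2) by (simp add: ennreal_mult[symmetric])
  have U: "energy (hyp_measure \<gamma> d) (sub_leray \<gamma> k f) = ennreal (1 / e) * a j"
    using norm_sub_leray_test_packet[OF g d(1) n e, of k] unfolding f_def a_def e_def .
  have Vpos: "0 < ennreal (1 / e * (v * X))" using e v(2) X(2) by simp
  have "ennreal (sqrt c) \<le> L2_norm_on (hyp_measure \<gamma> d) (sub_leray \<gamma> k f) / L2_norm_on (hyp_measure \<gamma> d) f"
  proof (rule L2_norm_on_quotient_ge)
    have "ennreal c * ennreal (1 / e * (v * X)) = ennreal (1 / e) * ennreal (c * v * X)"
      using c(1) e v(2) X(2) by (simp add: ennreal_mult[symmetric] mult_ac)
    also have "\<dots> \<le> ennreal (1 / e) * a j" using j by (intro mult_left_mono) auto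
    finally show "ennreal c * energy (hyp_measure \<gamma> d) f
       \<le> energy (hyp_measure \<gamma> d) (sub_leray \<gamma> k f)" unfolding U V .
  qed (use c(1) V Vpos in auto)
  moreover have "\<exists>\<zeta>\<in>hypersurface \<gamma>. f \<zeta> \<noteq> 0"
  proof (rule ccontr)
    assume "\<not> ?thesis"
    then have z: "\<And>\<zeta>. \<zeta> \<in> hypersurface \<gamma> \<Longrightarrow> f \<zeta> = 0" by blast
    have "energy (hyp_measure \<gamma> d) f = (\<integral>\<^sup>+\<zeta>. 0 \<partial>hyp_measure \<gamma> d)"
    proof (rule nn_integral_cong_AE)
      show "AE \<zeta> in hyp_measure \<gamma> d. ennreal ((norm (f \<zeta>))\<^sup>2) = 0"
        using AE_hyp_measure[of \<gamma> d] by eventually_elim (simp add: z hypersurface_def)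
    qed
    then show False using V Vpos by simp
  qed
  ultimately show ?thesis
    unfolding sub_leray_norm_def using tf by (intro SUP_upper2[of f]) auto
qed

theorem sub_leray_norm_eq:
  assumes g: "\<gamma> > 1" and d: "-1 < d" "d < 2 * \<gamma> - 1"
  shows "sub_leray_norm \<gamma> k (hyp_measure \<gamma> d) = ennreal (sqrt (leray_symbol d \<gamma> k))"
proof (rule antisym[OF sub_leray_norm_le[OF assms]], rule ccontr)
  define J where "J = leray_symbol d \<gamma> k"
  have J: "J > 0" unfolding J_def by (rule leray_symbol_pos[OF assms])
  assume "\<not> ennreal (sqrt (leray_symbol d \<gamma> k)) \<le> sub_leray_norm \<gamma> k (hyp_measure \<gamma> d)"
  then have lt: "sub_leray_norm \<gamma> k (hyp_measure \<gamma> d) < ennreal (sqrt J)" by (simp add: J_def)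
  then obtain t where t: "sub_leray_norm \<gamma> k (hyp_measure \<gamma> d) = ennreal t" "t \<ge> 0"
    by (cases "sub_leray_norm \<gamma> k (hyp_measure \<gamma> d)") auto
  then have "t < sqrt J" using lt by (simp add: ennreal_less_iff)
  then have tJ: "t\<^sup>2 < J" using t(2) J by (metis real_sqrt_less_iff real_sqrt_abs abs_of_nonneg)
  define c where "c = (t\<^sup>2 + J) / 2"
  have c: "0 \<le> c" "c < J" "t\<^sup>2 < c" using tJ J by (auto simp: c_def add_nonneg_nonneg)
  have "ennreal (sqrt c) \<le> ennreal t"
    using sub_leray_norm_ge_approx[OF g d c(1), of k] c(2) t(1) by (simp add: J_def)
  then have "sqrt c \<le> t" using t(2) by (simp add: ennreal_le_iff)
  then have "c \<le> t\<^sup>2" using c(1) by (metis real_sqrt_le_iff real_sqrt_abs abs_of_nonneg t(2))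
  then show False using c(3) by simp
qed

theorem theorem1p15:
  fixes \<gamma> :: real
  assumes "\<gamma> > 1"
  shows
    "(\<gamma> = 2 \<longrightarrow> (\<forall>d \<in> {-1<..<1} \<union> {1<..<3}.
        strict_antimono_on UNIV (leray_symbol d \<gamma>) \<and>
        (\<forall>k. sub_leray_norm \<gamma> k (hyp_measure \<gamma> d) > sub_leray_norm \<gamma> (k + 1) (hyp_measure \<gamma> d)))) \<and>
     (\<gamma> > 2 \<longrightarrow> (\<forall>d \<in> {-1<..1} \<union> {\<gamma> - 1..<2 * \<gamma> - 1}.
        strict_antimono_on UNIV (leray_symbol d \<gamma>) \<and>
        (\<forall>k. sub_leray_norm \<gamma> k (hyp_measure \<gamma> d) > sub_leray_norm \<gamma> (k + 1) (hyp_measure \<gamma> d)))) \<and>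
     (\<gamma> < 2 \<longrightarrow> (\<forall>d \<in> {-1<..\<gamma> - 1} \<union> {1..<2 * \<gamma> - 1}.
        strict_antimono_on UNIV (leray_symbol d \<gamma>) \<and>
        (\<forall>k. sub_leray_norm \<gamma> k (hyp_measure \<gamma> d) > sub_leray_norm \<gamma> (k + 1) (hyp_measure \<gamma> d)))) \<and>
     (\<gamma> \<noteq> 2 \<longrightarrow>
        strict_mono (preferred_symbol \<gamma>) \<and>
        (\<forall>k. sub_leray_norm \<gamma> k (preferred_measure \<gamma>) < sub_leray_norm \<gamma> (k + 1) (preferred_measure \<gamma>)))"
proof -
  have antimono: "strict_antimono_on UNIV J" if "\<And>k. J (Suc k) < J k" for J :: "nat \<Rightarrow> real"
    using lift_Suc_mono_less[of "\<lambda>k. - J k"] that by (auto simp: monotone_on_def)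
  have decreasing: "strict_antimono_on UNIV (leray_symbol d \<gamma>) \<and>
      (\<forall>k. sub_leray_norm \<gamma> k (hyp_measure \<gamma> d) > sub_leray_norm \<gamma> (k + 1) (hyp_measure \<gamma> d))"
    if d: "-1 < d" "d < 2 * \<gamma> - 1" and step: "\<And>k. leray_symbol d \<gamma> (Suc k) < leray_symbol d \<gamma> k" for d
    using antimono[of "leray_symbol d \<gamma>", OF step] step sub_leray_norm_eq[OF assms d] leray_symbol_pos[OF assms d]
    by (auto simp: ennreal_less_iff less_imp_le)
  have "strict_mono (preferred_symbol \<gamma>) \<and>
      (\<forall>k. sub_leray_norm \<gamma> k (preferred_measure \<gamma>) < sub_leray_norm \<gamma> (k + 1) (preferred_measure \<gamma>))" if "\<gamma> \<noteq> 2"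
  proof -
    have d: "-1 < (\<gamma> + 1) / 3" "(\<gamma> + 1) / 3 < 2 * \<gamma> - 1" using assms by auto
    have step: "preferred_symbol \<gamma> k < preferred_symbol \<gamma> (Suc k)" for k
      by (rule preferred_symbol_increasing[OF assms that])
    then show ?thesis
      using sub_leray_norm_eq[OF assms d] leray_symbol_pos[OF assms d]
      by (auto simp: strict_mono_Suc_iff ennreal_less_iff less_imp_le)
  qed
  then show ?thesis
  proof (intro conjI impI ballI)
    fix d :: real assume "\<gamma> = 2" "d \<in> {-1<..<1} \<union> {1<..<3}"
    then have "-1 < d" "d < 2 * \<gamma> - 1" "\<And>k. leray_symbol d \<gamma> (Suc k) < leray_symbol d \<gamma> k"
      using leray_symbol_two_decreasing by auto
    from decreasing[OF this] show "strict_antimono_on UNIV (leray_symbol d \<gamma>)"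
      "\<forall>k. sub_leray_norm \<gamma> (k + 1) (hyp_measure \<gamma> d) < sub_leray_norm \<gamma> k (hyp_measure \<gamma> d)" by auto
  next
    fix d :: real assume "\<gamma> > 2" "d \<in> {-1<..1} \<union> {\<gamma> - 1..<2 * \<gamma> - 1}"
    then have "-1 < d" "d < 2 * \<gamma> - 1" "\<And>k. leray_symbol d \<gamma> (Suc k) < leray_symbol d \<gamma> k"
      by (auto intro!: leray_symbol_decreasing)
    from decreasing[OF this] show "strict_antimono_on UNIV (leray_symbol d \<gamma>)"
      "\<forall>k. sub_leray_norm \<gamma> (k + 1) (hyp_measure \<gamma> d) < sub_leray_norm \<gamma> k (hyp_measure \<gamma> d)" by auto
  next
    fix d :: real assume "\<gamma> < 2" "d \<in> {-1<..\<gamma> - 1} \<union> {1..<2 * \<gamma> - 1}"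
    then have "-1 < d" "d < 2 * \<gamma> - 1" "\<And>k. leray_symbol d \<gamma> (Suc k) < leray_symbol d \<gamma> k"
      using assms by (auto intro!: leray_symbol_decreasing)
    from decreasing[OF this] show "strict_antimono_on UNIV (leray_symbol d \<gamma>)"
      "\<forall>k. sub_leray_norm \<gamma> (k + 1) (hyp_measure \<gamma> d) < sub_leray_norm \<gamma> k (hyp_measure \<gamma> d)" by auto
  qed auto
qed

end
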